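(* Let $n\ge2$ and let $t_{i,j},s_{i,j}$ ($1\le i<j\le n$) be independent variables. Consider the factorization, over the field of rational functions in these variables, $$X^{(n)}(-t,-s)\,\bar w_0^{(n)}=Y\cdot T\cdot X^{(n)}(p,q)$$ in the group $SO_{n,n}$, with $Y$ lower triangular unipotent, $T$ diagonal, and $p=(p_{i,j})$, $q=(q_{i,j})$ rational functions of $(t,s)$. With $\epsilon(k)=(-1)^k$ and $u_{i,j},r_{i,j}$ as in the context: a) for $1\le i<j<n$ $$p_{i,j}=r_{i,j}\prod_{k<i}\frac{t_{k,j-1}}{s_{k,j-1}}\prod_{k<i}\frac{s_{k,j}}{t_{k,j}},\qquad q_{i,j}=r_{i,j}\prod_{k<i}\frac{t_{k,j-1}}{s_{k,j-1}}\prod_{k\le i}\frac{s_{k,j}}{t_{k,j}},$$ and for $1\le i<n$ $$p_{i,n}=r_{i,n}\prod_{k<i}\frac{t_{k,n-1}}{s_{k,n-1}}\prod_{k<i}\Big(\frac{t_{k,n}}{s_{k,n}}\Big)^{\epsilon(n-i)},\qquad q_{i,n}=r_{i,n}\prod_{k<i}\frac{t_{k,n-1}}{s_{k,n-1}}\prod_{k\le i}\Big(\frac{s_{k,n}}{t_{k,n}}\Big)^{\epsilon(n-i)};$$ b) $T=\sum_{k=1}^n\big(T_ke_{k,k}+T_k^{-1}e_{\hat k,\hat k}\big)$ with $$T_k=\prod_{j<k}\frac{s_{j,k}}{t_{j,k}}\cdot\prod_{j>k}s_{k,j}t_{k,j};$$ c) the map $(t,s)\mapsto(p,q)$ preserves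 the measure: $\prod_{i<j}\frac{dt_{i,j}ds_{i,j}}{t_{i,j}s_{i,j}}=\prod_{i<j}\frac{dp_{i,j}dq_{i,j}}{p_{i,j}q_{i,j}}$ (as measures on the positive orthant).
   Context: Let $e_{a,b}$ be the $2n\times2n$ matrix units, $\hat k=2n+1-k$, $\epsilon(k)=(-1)^k$. $SO(n,n)$ is the group preserving $\sum_{i=1}^{2n}x_iy_{\hat i}$. Chevalley generators: $e_i=e_{i,i+1}-e_{2n-i,2n+1-i}$, $f_i=e_{i+1,i}-e_{2n+1-i,2n-i}$ for $1\le i\le n-2$; $e^+_{n-1}=e_{n-1,n}-e_{n+1,n+2}$, $f^+_{n-1}=e_{n,n-1}-e_{n+2,n+1}$; $e^-_{n-1}=e_{n-1,n+1}-e_{n,n+2}$, $f^-_{n-1}=e_{n+1,n-1}-e_{n+2,n}$ ($e^{\pm1}_{n-1}$ means $e^\pm_{n-1}$). $X^{(n)}(t,s)=R_{n-1}R_{n-2}\cdots R_1$ with $$R_i=\exp(s_{i,i+1}e_i)\exp(s_{i,i+2}e_{i+1})\cdots\exp(s_{i,n-1}e_{n-2})\exp(s_{i,n}e_{n-1}^{\epsilon(n-i)})\exp(t_{i,n}e_{n-1}^{\epsilon(n-i+1)})\exp(t_{i,n-1}e_{n-2})\cdots\exp(t_{i,i+1}e_i).$$ $X^{(n)}(p,q)$ is the same product with $p_{i,j}$ in place of $t_{i,j}$ and $q_{i,j}$ in place of $s_{i,j}$. $\bar w_0^{(n)}$ is the matrix obtained from this product by replacing each factor $\exp(c\,e)$,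 with $e$ a Chevalley generator with partner $f$, by $\exp(e)\exp(-f)\exp(e)$. Set $s_{j,j}=t_{j,j}=u_{j,j}=1$, and for $1\le i<j\le n$: $u_{i,j}=t_{i,j}+s_{i,j}$ if $j<n$; $u_{i,n}=t_{i,n}$ if $n-i$ is odd; $u_{i,n}=s_{i,n}$ if $n-i$ is even; and $r_{i,j}=\dfrac{u_{i,j-1}}{u_{i,j}\,s_{i,j-1}}$. *)

theory Defs
  imports
    "HOL-Probability.Probability"
    "HOL-Library.Poly_Mapping"
    "HOL-Computational_Algebra.Fraction_Field"
    "Jordan_Normal_Form.Determinant"
begin

section \<open>The field of rational functions in the independent variables\<close>

datatype var = TVar nat nat | SVar nat nat

text \<open>
  The order on \<open>var\<close> carries no meaning: the library proves that \<^typ>\<open>('v \<Rightarrow>\<^sub>0 nat) \<Rightarrow>\<^sub>0 real\<close>,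
  i.e. real polynomials in the variables \<open>'v\<close>, is an integral domain only for linearly ordered \<open>'v\<close>.
\<close>

fun var_code :: "var \<Rightarrow> nat" where
  "var_code (TVar i j) = 2 * prod_encode (i, j)"
| "var_code (SVar i j) = 2 * prod_encode (i, j) + 1"

lemma var_code_inject: "var_code v = var_code w \<longleftrightarrow> v = w"
proof (cases v; cases w)
  fix a b c d
  assume "v = TVar a b" "w = SVar c d"
  then show ?thesis by simp presburger
next
  fix a b c d
  assume "v = SVar a b" "w = TVar c d"
  then show ?thesis by simp presburger
qed auto

instantiation var :: linorder
begin

definition less_eq_var :: "var \<Rightarrow> var \<Rightarrow> bool" where
  "less_eq_var v w \<longleftrightarrow> var_code v \<le> var_code w"

definition less_var :: "var \<Rightarrow> var \<Rightarrow> bool" where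
  "less_var v w \<longleftrightarrow> var_code v < var_code w"

instance
  by standard (auto simp: less_eq_var_def less_var_def var_code_inject)

end

type_synonym mpoly = "(var \<Rightarrow>\<^sub>0 nat) \<Rightarrow>\<^sub>0 real"

type_synonym ratfun = "mpoly fract"

definition indet :: "var \<Rightarrow> ratfun" where
  "indet v = Fraction_Field.Fract (Poly_Mapping.single (Poly_Mapping.single v 1) 1) 1"

definition t_var :: "nat \<Rightarrow> nat \<Rightarrow> ratfun" where
  "t_var i j = indet (TVar i j)"

definition s_var :: "nat \<Rightarrow> nat \<Rightarrow> ratfun" where
  "s_var i j = indet (SVar i j)"

definition mpoly_eval :: "(var \<Rightarrow> real) \<Rightarrow> mpoly \<Rightarrow> real" where
  "mpoly_eval x P =
     (\<Sum>m\<in>Poly_Mapping.keys P. Poly_Mapping.lookup P m *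
        (\<Prod>v\<in>Poly_Mapping.keys m. x v ^ Poly_Mapping.lookup m v))"

text \<open>The value at \<open>x\<close> of a rational function that is regular at \<open>x\<close> (unspecified otherwise).\<close>

definition ratfun_eval :: "(var \<Rightarrow> real) \<Rightarrow> ratfun \<Rightarrow> real" where
  "ratfun_eval x f =
     (THE y. \<exists>a b. f = Fraction_Field.Fract a b \<and> mpoly_eval x b \<noteq> 0 \<and>
        y = mpoly_eval x a / mpoly_eval x b)"

section \<open>Matrices and the group \<open>SO(n,n)\<close>\<close>

text \<open>
  Rows and columns of \<^typ>\<open>'a mat\<close> are numbered from 0, those of the mathematical text from 1.
\<close>

definition munit :: "nat \<Rightarrow> nat \<Rightarrow> nat \<Rightarrow> 'a::field mat" where
  "munit n a b = Matrix.mat (2*n) (2*n) (\<lambda>(i, j). if i + 1 = a \<and> j + 1 = b then 1 else 0)"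

definition hat :: "nat \<Rightarrow> nat \<Rightarrow> nat" where
  "hat n k = 2*n + 1 - k"

definition form_mat :: "nat \<Rightarrow> 'a::field mat" where
  "form_mat n = Matrix.mat (2*n) (2*n) (\<lambda>(i, j). if j + 1 = hat n (i + 1) then 1 else 0)"

definition SO :: "nat \<Rightarrow> 'a::field mat set" where
  "SO n = {A \<in> carrier_mat (2*n) (2*n).
             transpose_mat A * form_mat n * A = form_mat n \<and> Determinant.det A = 1}"

definition lower_unipotent :: "'a::field mat \<Rightarrow> bool" where
  "lower_unipotent A \<longleftrightarrow>
     (\<forall>i<dim_row A. A $$ (i, i) = 1) \<and> (\<forall>j<dim_col A. \<forall>i<j. A $$ (i, j) = 0)"

text \<open>
  The exponential series of a nilpotent \<open>N \<times> N\<close> matrix; its terms vanish from the \<open>N\<close>-th power on.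
\<close>

definition nilp_exp :: "'a::field mat \<Rightarrow> 'a mat" where
  "nilp_exp A = Matrix.mat (dim_row A) (dim_row A)
     (\<lambda>(i, j). \<Sum>k<dim_row A. (A ^\<^sub>m k) $$ (i, j) / of_nat (fact k))"

section \<open>Chevalley generators and the matrices \<open>X\<close> and \<open>w\<^sub>0\<close>\<close>

definition eps :: "nat \<Rightarrow> int" where
  "eps k = (- 1) ^ k"

text \<open>\<open>Simple i\<close> stands for \<open>e\<^sub>i, f\<^sub>i\<close> with \<open>1 \<le> i \<le> n - 2\<close>, and \<open>Spin \<sigma>\<close> for
  \<open>e\<^sub>n\<^sub>-\<^sub>1, f\<^sub>n\<^sub>-\<^sub>1\<close> with superscript \<open>\<sigma> = \<plusminus>1\<close>.\<close>

datatype gen = Simple nat | Spin int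

fun gen_e :: "nat \<Rightarrow> gen \<Rightarrow> 'a::field mat" where
  "gen_e n (Simple i) = munit n i (i+1) - munit n (2*n - i) (2*n + 1 - i)"
| "gen_e n (Spin \<sigma>) =
     (if \<sigma> = 1 then munit n (n-1) n - munit n (n+1) (n+2)
      else munit n (n-1) (n+1) - munit n n (n+2))"

fun gen_f :: "nat \<Rightarrow> gen \<Rightarrow> 'a::field mat" where
  "gen_f n (Simple i) = munit n (i+1) i - munit n (2*n + 1 - i) (2*n - i)"
| "gen_f n (Spin \<sigma>) =
     (if \<sigma> = 1 then munit n n (n-1) - munit n (n+2) (n+1)
      else munit n (n+1) (n-1) - munit n (n+2) n)"

text \<open>The factors \<open>exp (c e)\<close> of \<open>R\<^sub>i\<close> and of \<open>X\<close>, from left to right, as pairs \<open>(c, e)\<close>.\<close>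

definition R_word :: "nat \<Rightarrow> (nat \<Rightarrow> nat \<Rightarrow> 'a) \<Rightarrow> (nat \<Rightarrow> nat \<Rightarrow> 'a) \<Rightarrow> nat \<Rightarrow> ('a \<times> gen) list" where
  "R_word n t s i =
     map (\<lambda>j. (s i j, Simple (j-1))) [i+1..<n]
     @ [(s i n, Spin (eps (n-i))), (t i n, Spin (eps (n-i+1)))]
     @ map (\<lambda>j. (t i j, Simple (j-1))) (rev [i+1..<n])"

definition X_word :: "nat \<Rightarrow> (nat \<Rightarrow> nat \<Rightarrow> 'a) \<Rightarrow> (nat \<Rightarrow> nat \<Rightarrow> 'a) \<Rightarrow> ('a \<times> gen) list" where
  "X_word n t s = concat (map (R_word n t s) (rev [1..<n]))"

definition mat_prod :: "nat \<Rightarrow> 'a::field mat list \<Rightarrow> 'a mat" where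
  "mat_prod n As = foldr (*) As (1\<^sub>m (2*n))"

definition X_mat :: "nat \<Rightarrow> (nat \<Rightarrow> nat \<Rightarrow> 'a::field) \<Rightarrow> (nat \<Rightarrow> nat \<Rightarrow> 'a) \<Rightarrow> 'a mat" where
  "X_mat n t s = mat_prod n (map (\<lambda>(c, g). nilp_exp (c \<cdot>\<^sub>m gen_e n g)) (X_word n t s))"

text \<open>Only the generators of the word matter here; the coefficients 0 are discarded.\<close>

definition w0_mat :: "nat \<Rightarrow> 'a::field mat" where
  "w0_mat n = mat_prod n
     (map (\<lambda>(c, g). nilp_exp (gen_e n g) * nilp_exp (- gen_f n g) * nilp_exp (gen_e n g))
        (X_word n (\<lambda>i j. 0 :: 'a) (\<lambda>i j. 0)))"

definition factorization ::
  "nat \<Rightarrow> (nat \<Rightarrow> nat \<Rightarrow> 'a::field) \<Rightarrow> (nat \<Rightarrow> nat \<Rightarrow> 'a) \<Rightarrow> 'a mat \<Rightarrow> 'a mat \<Rightarrow>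
   (nat \<Rightarrow> nat \<Rightarrow> 'a) \<Rightarrow> (nat \<Rightarrow> nat \<Rightarrow> 'a) \<Rightarrow> bool" where
  "factorization n t s Y T p q \<longleftrightarrow>
     Y \<in> SO n \<and> lower_unipotent Y \<and> T \<in> SO n \<and> diagonal_mat T \<and>
     X_mat n (\<lambda>i j. - t i j) (\<lambda>i j. - s i j) * w0_mat n = Y * T * X_mat n p q"

section \<open>The ingredients of the formulas\<close>

definition u_par :: "nat \<Rightarrow> (nat \<Rightarrow> nat \<Rightarrow> 'a::field) \<Rightarrow> (nat \<Rightarrow> nat \<Rightarrow> 'a) \<Rightarrow> nat \<Rightarrow> nat \<Rightarrow> 'a" where
  "u_par n t s i j =
     (if i = j then 1
      else if j < n then t i j + s i j
      else if odd (n - i) then t i n else s i n)"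

definition r_par :: "nat \<Rightarrow> (nat \<Rightarrow> nat \<Rightarrow> 'a::field) \<Rightarrow> (nat \<Rightarrow> nat \<Rightarrow> 'a) \<Rightarrow> nat \<Rightarrow> nat \<Rightarrow> 'a" where
  "r_par n t s i j =
     u_par n t s i (j-1) / (u_par n t s i j * (if i = j-1 then 1 else s i (j-1)))"

definition T_par :: "nat \<Rightarrow> (nat \<Rightarrow> nat \<Rightarrow> 'a::field) \<Rightarrow> (nat \<Rightarrow> nat \<Rightarrow> 'a) \<Rightarrow> nat \<Rightarrow> 'a" where
  "T_par n t s k = (\<Prod>j\<in>{1..<k}. s j k / t j k) * (\<Prod>j\<in>{k<..n}. s k j * t k j)"

text \<open>\<open>\<Sum>\<^sub>k (d\<^sub>k e\<^sub>k\<^sub>,\<^sub>k + d\<^sub>k\<^sup>-\<^sup>1 e\<^sub>k\<^sub>^\<^sub>,\<^sub>k\<^sub>^)\<close>, written entrywise.\<close>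

definition torus_mat :: "nat \<Rightarrow> (nat \<Rightarrow> 'a::field) \<Rightarrow> 'a mat" where
  "torus_mat n d = Matrix.mat (2*n) (2*n)
     (\<lambda>(a, b). \<Sum>k\<in>{1..n}. (d k \<cdot>\<^sub>m munit n k k + inverse (d k) \<cdot>\<^sub>m munit n (hat n k) (hat n k)) $$ (a, b))"

section \<open>The positive orthant and its invariant measure\<close>

definition coords :: "nat \<Rightarrow> var set" where
  "coords n = (\<Union>i\<in>{1..n}. \<Union>j\<in>{i<..n}. {TVar i j, SVar i j})"

definition orthant :: "nat \<Rightarrow> (var \<Rightarrow> real) set" where
  "orthant n = (\<Pi>\<^sub>E v\<in>coords n. {0<..})"

text \<open>\<open>\<Prod>\<^sub>i\<^sub><\<^sub>j dt\<^sub>i\<^sub>j ds\<^sub>i\<^sub>j / (t\<^sub>i\<^sub>j s\<^sub>i\<^sub>j)\<close> on the orthant.\<close>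

definition log_measure :: "nat \<Rightarrow> (var \<Rightarrow> real) measure" where
  "log_measure n =
     density (restrict_space (Pi\<^sub>M (coords n) (\<lambda>_. lborel)) (orthant n))
       (\<lambda>x. ennreal (\<Prod>v\<in>coords n. 1 / x v))"

text \<open>The map \<open>(t, s) \<mapsto> (p, q)\<close>: the coordinate \<open>TVar i j\<close> of the image is \<open>p\<^sub>i\<^sub>j\<close>, the
  coordinate \<open>SVar i j\<close> is \<open>q\<^sub>i\<^sub>j\<close>.\<close>

definition pq_map ::
  "nat \<Rightarrow> (nat \<Rightarrow> nat \<Rightarrow> ratfun) \<Rightarrow> (nat \<Rightarrow> nat \<Rightarrow> ratfun) \<Rightarrow> (var \<Rightarrow> real) \<Rightarrow> (var \<Rightarrow> real)" where
  "pq_map n p q x = restrict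
     (\<lambda>v. case v of TVar i j \<Rightarrow> ratfun_eval x (p i j) | SVar i j \<Rightarrow> ratfun_eval x (q i j))
     (coords n)"

end

theory Submission
  imports Defs
begin

text \<open>
  Write \<open>X\<^sub>i\<close> and \<open>w\<^sub>i\<close> for the parts \<open>R\<^sub>n\<^sub>-\<^sub>1 \<cdots> R\<^sub>i\<close> of \<open>X\<close> and of \<open>w\<^sub>0\<close>. The matrix \<open>w\<^sub>i\<close> is, up to the
  sign \<open>(-1)\<^sup>n\<^sup>-\<^sup>i\<close>, the reversal of the block of indices \<open>i, \<dots>, 2n+1-i\<close> (exchanging or fixing the two
  central indices according to the parity of \<open>n - i\<close>), so that the matrix \<open>Z\<close> given by
  \<open>R\<^sub>i(-t,-s) w\<^sub>i = w\<^sub>i\<^sub>+\<^sub>1 Z\<close> is explicit. It factors as \<open>Z = L D R\<^sub>i(p,q)\<close>, where \<open>p, q\<close> are given by the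
  formulas without the products over \<open>k < i\<close>, \<open>D\<close> is diagonal, and \<open>L\<close> is lower unipotent and differs
  from the identity inside the block only in its first column and last row. Such \<open>L\<close> are normalised by
  \<open>X\<^sub>i\<^sub>+\<^sub>1\<close>, so descending induction on \<open>i\<close> gives the factorization; moving \<open>D\<close> to the left through
  \<open>X\<^sub>i\<^sub>+\<^sub>1\<close> rescales its parameters and produces the products over \<open>k < i\<close>.

  Conversely, the lower-diagonal-upper factorization determines \<open>X(p,q)\<close>, and the \<open>i\<close>-th row of \<open>X\<^sub>i\<close> is that
  of \<open>R\<^sub>i\<close>, from which the parameters can be read off as soon as none of them vanishes.

  In the coordinates \<open>m = s/t\<close> the map is \<open>(t,s) \<mapsto> (t,m) \<mapsto> (p,m) \<mapsto> (p,q)\<close>, and each of these steps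
  multiplies every coordinate, or its inverse, by a function of coordinates that come earlier in some order.
  Such maps preserve the measure by Fubini and the invariance of \<open>dx/x\<close>.
\<close>

section \<open>Values of rational functions\<close>

text \<open>In one row put \<open>g l = u l / v l\<close>. Then
  \<open>p j = g (j-1) / (g j * s j)\<close> and \<open>q j = g (j-1) / (g j * t j)\<close> for
  \<open>j < n\<close>, so products of consecutive parameters telescope. Moreover
  \<open>t j + s j = g j * s j\<close> collapses \<open>p j + q j\<close>, the only non-monomial
  ingredient of \<open>R_i(p,q)\<close>, to \<open>g (j-1) / t j\<close>. This makes the rows of
  \<open>R_i(p,q)\<close> proportional beyond the diagonal and allows an entrywise comparison with
  \<open>Z\<close>. The last rows of \<open>L\<close> would be the hard ones. They are never
  computed: once the first rows of an orthogonal matrix are unit vectors, the invariant form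
  dictates its last columns. The algebra is done over an arbitrary field in which the relevant
  \<open>t\<close>, \<open>s\<close> and \<open>t + s\<close> are nonzero, and is applied to the
  indeterminates at the end. The resulting formulas have no vanishing denominators at positive
  points, so evaluating them there gives a real map with explicit formulas. Integrals run over the
  full product space with a weight that is 0 off the orthant; thus Fubini applies to plain product
  measures.\<close>

definition mono_eval :: "(var \<Rightarrow> real) \<Rightarrow> (var \<Rightarrow>\<^sub>0 nat) \<Rightarrow> real" where
  "mono_eval x m = (\<Prod>v\<in>Poly_Mapping.keys m. x v ^ Poly_Mapping.lookup m v)"

lemma mono_eval_superset:
  assumes "finite V" "Poly_Mapping.keys m \<subseteq> V"
  shows "mono_eval x m = (\<Prod>v\<in>V. x v ^ Poly_Mapping.lookup m v)"
  unfolding mono_eval_def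
  by (rule prod.mono_neutral_left) (use assms in \<open>auto simp: in_keys_iff\<close>)

lemma mono_eval_add: "mono_eval x (m + m') = mono_eval x m * mono_eval x m'"
proof -
  let ?V = "Poly_Mapping.keys m \<union> Poly_Mapping.keys m'"
  have "Poly_Mapping.keys (m + m') \<subseteq> ?V" by (rule keys_add)
  then show ?thesis
    by (simp add: mono_eval_superset[of ?V] lookup_add power_add prod.distrib)
qed

lemma mpoly_eval_superset:
  assumes "finite M" "Poly_Mapping.keys P \<subseteq> M"
  shows "mpoly_eval x P = (\<Sum>m\<in>M. Poly_Mapping.lookup P m * mono_eval x m)"
  unfolding mpoly_eval_def mono_eval_def[symmetric]
  by (rule sum.mono_neutral_left) (use assms in \<open>auto simp: in_keys_iff\<close>)

lemma mpoly_eval_add: "mpoly_eval x (P + Q) = mpoly_eval x P + mpoly_eval x Q"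
proof -
  let ?M = "Poly_Mapping.keys P \<union> Poly_Mapping.keys Q"
  have "Poly_Mapping.keys (P + Q) \<subseteq> ?M" by (rule keys_add)
  then show ?thesis
    by (simp add: mpoly_eval_superset[of ?M] lookup_add algebra_simps sum.distrib)
qed

lemma mpoly_eval_0 [simp]: "mpoly_eval x 0 = 0"
  by (simp add: mpoly_eval_def)

lemma mpoly_eval_sum: "mpoly_eval x (sum f A) = (\<Sum>a\<in>A. mpoly_eval x (f a))"
  by (induction A rule: infinite_finite_induct) (simp_all add: mpoly_eval_add)

lemma mpoly_eval_single: "mpoly_eval x (Poly_Mapping.single m c) = c * mono_eval x m"
  by (subst mpoly_eval_superset[of "{m}"]) auto

text \<open>This expansion reduces multiplicativity of evaluation to single terms, where it is
  \<open>mono_eval_add\<close>.\<close>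

lemma mpoly_sum_single:
  "(P :: mpoly) = (\<Sum>m\<in>Poly_Mapping.keys P. Poly_Mapping.single m (Poly_Mapping.lookup P m))"
proof (rule poly_mapping_eqI)
  fix k
  have "Poly_Mapping.lookup (\<Sum>m\<in>M. Poly_Mapping.single m (Poly_Mapping.lookup P m)) k
    = (\<Sum>m\<in>M. Poly_Mapping.lookup (Poly_Mapping.single m (Poly_Mapping.lookup P m)) k)" for M
    by (rule lookup_sum)
  then show "Poly_Mapping.lookup P k = Poly_Mapping.lookup
      (\<Sum>m\<in>Poly_Mapping.keys P. Poly_Mapping.single m (Poly_Mapping.lookup P m)) k"
    by (simp add: lookup_single when_def in_keys_iff)
qed

lemma mpoly_eval_mult: "mpoly_eval x (P * Q) = mpoly_eval x P * mpoly_eval x Q"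
proof -
  have "P * Q = (\<Sum>m\<in>Poly_Mapping.keys P. \<Sum>m'\<in>Poly_Mapping.keys Q.
      Poly_Mapping.single (m + m') (Poly_Mapping.lookup P m * Poly_Mapping.lookup Q m'))"
    by (subst mpoly_sum_single[of P], subst mpoly_sum_single[of Q])
       (simp add: sum_product mult_single)
  then have "mpoly_eval x (P * Q) = (\<Sum>m\<in>Poly_Mapping.keys P. \<Sum>m'\<in>Poly_Mapping.keys Q.
      (Poly_Mapping.lookup P m * mono_eval x m) * (Poly_Mapping.lookup Q m' * mono_eval x m'))"
    by (simp add: mpoly_eval_sum mpoly_eval_single mono_eval_add mult_ac)
  then show ?thesis
    by (simp add: sum_product mpoly_eval_def mono_eval_def[symmetric])
qed

lemma mono_eval_0 [simp]: "mono_eval x 0 = 1"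
  by (simp add: mono_eval_def)

lemma mpoly_eval_1 [simp]: "mpoly_eval x 1 = 1"
  using mpoly_eval_single[of x 0 1] by simp

text \<open>\<open>ratfun_eval\<close> is a definite description and does not compute. This relation
  does: it is compatible with the field operations, and its uniqueness property leads back to
  \<open>ratfun_eval\<close>.\<close>

definition regular_value :: "(var \<Rightarrow> real) \<Rightarrow> ratfun \<Rightarrow> real \<Rightarrow> bool" where
  "regular_value x f y \<longleftrightarrow> (\<exists>a b. f = Fraction_Field.Fract a b \<and> mpoly_eval x b \<noteq> 0 \<and>
     y = mpoly_eval x a / mpoly_eval x b)"

lemma regular_valueI:
  "f = Fraction_Field.Fract a b \<Longrightarrow> mpoly_eval x b \<noteq> 0 \<Longrightarrow> y = mpoly_eval x a / mpoly_eval x b \<Longrightarrow>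
    regular_value x f y"
  by (auto simp: regular_value_def)

lemma regular_valueE:
  assumes "regular_value x f y"
  obtains a b where "f = Fraction_Field.Fract a b" "b \<noteq> 0" "mpoly_eval x b \<noteq> 0"
    "y = mpoly_eval x a / mpoly_eval x b"
  using assms by (force simp: regular_value_def)

text \<open>Two representations of \<open>f\<close> are cross-multiplied; evaluation respects the
  resulting polynomial identity, and neither denominator vanishes at \<open>x\<close>.\<close>

lemma regular_value_unique:
  assumes "regular_value x f y" "regular_value x f z"
  shows "y = z"
proof -
  obtain a b where ab: "f = Fraction_Field.Fract a b" "b \<noteq> 0" "mpoly_eval x b \<noteq> 0"
    "y = mpoly_eval x a / mpoly_eval x b" using assms(1) by (rule regular_valueE)
  obtain c d where cd: "f = Fraction_Field.Fract c d" "d \<noteq> 0" "mpoly_eval x d \<noteq> 0"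
    "z = mpoly_eval x c / mpoly_eval x d" using assms(2) by (rule regular_valueE)
  have "a * d = c * b" using ab cd eq_fract(1)[of b d a c] by simp
  then have "mpoly_eval x a * mpoly_eval x d = mpoly_eval x c * mpoly_eval x b"
    by (simp add: mpoly_eval_mult[symmetric])
  then show ?thesis using ab cd by (simp add: frac_eq_eq)
qed

lemma ratfun_eval_eqI: "regular_value x f y \<Longrightarrow> ratfun_eval x f = y"
  unfolding ratfun_eval_def regular_value_def[symmetric]
  using regular_value_unique by blast

lemma regular_value_add:
  assumes "regular_value x f y" "regular_value x g z"
  shows "regular_value x (f + g) (y + z)"
proof -
  obtain a b where ab: "f = Fraction_Field.Fract a b" "b \<noteq> 0" "mpoly_eval x b \<noteq> 0"
    "y = mpoly_eval x a / mpoly_eval x b" using assms(1) by (rule regular_valueE)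
  obtain c d where cd: "g = Fraction_Field.Fract c d" "d \<noteq> 0" "mpoly_eval x d \<noteq> 0"
    "z = mpoly_eval x c / mpoly_eval x d" using assms(2) by (rule regular_valueE)
  show ?thesis
    by (rule regular_valueI[of _ "a * d + c * b" "b * d"])
       (use ab cd in \<open>simp_all add: mpoly_eval_mult mpoly_eval_add add_frac_eq\<close>)
qed

lemma regular_value_mult:
  assumes "regular_value x f y" "regular_value x g z"
  shows "regular_value x (f * g) (y * z)"
proof -
  obtain a b where ab: "f = Fraction_Field.Fract a b" "b \<noteq> 0" "mpoly_eval x b \<noteq> 0"
    "y = mpoly_eval x a / mpoly_eval x b" using assms(1) by (rule regular_valueE)
  obtain c d where cd: "g = Fraction_Field.Fract c d" "d \<noteq> 0" "mpoly_eval x d \<noteq> 0"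
    "z = mpoly_eval x c / mpoly_eval x d" using assms(2) by (rule regular_valueE)
  show ?thesis
    by (rule regular_valueI[of _ "a * c" "b * d"]) (use ab cd in \<open>simp_all add: mpoly_eval_mult\<close>)
qed

lemma regular_value_inverse:
  assumes "regular_value x f y" "y \<noteq> 0"
  shows "regular_value x (inverse f) (inverse y)"
proof -
  obtain a b where "f = Fraction_Field.Fract a b" "b \<noteq> 0" "mpoly_eval x b \<noteq> 0"
    "y = mpoly_eval x a / mpoly_eval x b" using assms(1) by (rule regular_valueE)
  then show ?thesis
    using assms(2) by (intro regular_valueI[of _ b a]) simp_all
qed

lemma regular_value_divide:
  "regular_value x f y \<Longrightarrow> regular_value x g z \<Longrightarrow> z \<noteq> 0 \<Longrightarrow> regular_value x (f / g) (y / z)"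
  unfolding divide_inverse by (intro regular_value_mult regular_value_inverse)

lemma regular_value_1: "regular_value x 1 1"
  unfolding regular_value_def by (intro exI[of _ 1]) (simp add: One_fract_def)

lemma regular_value_prod:
  "(\<And>k. k \<in> K \<Longrightarrow> regular_value x (f k) (y k)) \<Longrightarrow> regular_value x (prod f K) (prod y K)"
  by (induction K rule: infinite_finite_induct) (auto intro: regular_value_1 regular_value_mult)

lemma regular_value_powi_eps:
  assumes "regular_value x f y" "y \<noteq> 0"
  shows "regular_value x (f powi eps k) (y powi eps k)"
  using assms regular_value_inverse[OF assms]
  by (cases "even k") (simp_all add: eps_def power_int_minus)

lemma regular_value_indet: "regular_value x (indet v) (x v)"
  unfolding regular_value_def indet_def
  by (intro exI[of _ "Poly_Mapping.single (Poly_Mapping.single v 1) 1"] exI[of _ 1])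
     (simp add: mpoly_eval_single mono_eval_def)

text \<open>One point with a nonzero value certifies that a rational function is not zero. It is
  applied to \<open>t\<close>, \<open>s\<close> and \<open>t + s\<close> at the point with all
  coordinates 1.\<close>

lemma regular_value_nonzero: "regular_value x f y \<Longrightarrow> y \<noteq> 0 \<Longrightarrow> f \<noteq> 0"
proof
  assume "regular_value x f y" "y \<noteq> 0" "f = 0"
  moreover have "regular_value x 0 0"
    unfolding regular_value_def by (intro exI[of _ 0] exI[of _ 1]) (simp add: Zero_fract_def)
  ultimately show False using regular_value_unique by blast
qed

section \<open>Triangular maps and the invariant measure\<close>

definition haar :: "real \<Rightarrow> ennreal" where
  "haar y = (if 0 < y then ennreal (1 / y) else 0)"

lemma haar_measurable [measurable]: "haar \<in> borel_measurable borel"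
  unfolding haar_def[abs_def] by measurable

text \<open>Substituting \<open>y = exp z\<close> for \<open>z\<close> between \<open>-k\<close> and
  \<open>k\<close> cancels \<open>1 / y\<close> against the derivative. The sets \<open>C k\<close>
  exhaust the positive axis, which carries the whole measure, so continuity from below gives the
  general case.\<close>

lemma density_haar: "density lborel haar = distr lborel borel exp"
proof (rule measure_eqI)
  fix A :: "real set" assume "A \<in> sets (density lborel haar)"
  then have A [measurable]: "A \<in> sets borel" by simp
  let ?\<nu> = "density lborel haar"
  define C where "C k = {exp (- real k)..exp (real k)}" for k :: nat
  have trunc: "emeasure ?\<nu> (A \<inter> C k) = emeasure lborel (exp -` A \<inter> {- real k..real k})" for k
  proof -
    let ?f = "\<lambda>y. indicator A y * (1 / y) :: real"
    have "emeasure ?\<nu> (A \<inter> C k) = (\<integral>\<^sup>+y. haar y * indicator (A \<inter> C k) y \<partial>lborel)"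
      by (subst emeasure_density) (auto simp: C_def)
    also have "\<dots> = (\<integral>\<^sup>+y. ennreal (?f y * indicator {exp (- real k)..exp (real k)} y) \<partial>lborel)"
    proof (rule nn_integral_cong)
      fix y :: real
      have "0 < y" if "exp (- real k) \<le> y" using that exp_gt_zero[of "- real k"] by linarith
      then show "haar y * indicator (A \<inter> C k) y = ennreal (?f y * indicator {exp (- real k)..exp (real k)} y)"
        by (auto simp: C_def haar_def indicator_def)
    qed
    also have "\<dots> = (\<integral>\<^sup>+z. ennreal (?f (exp z) * exp z * indicator {- real k..real k} z) \<partial>lborel)"
      by (rule nn_integral_substitution)
         (auto intro!: derivative_eq_intros continuous_intros simp: set_borel_measurable_def)
    also have "\<dots> = (\<integral>\<^sup>+z. indicator (exp -` A \<inter> {- real k..real k}) z \<partial>lborel)"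
      by (rule nn_integral_cong) (auto simp: indicator_def)
    also have "\<dots> = emeasure lborel (exp -` A \<inter> {- real k..real k})"
      by (rule nn_integral_indicator) (auto intro!: measurable_sets_borel[of exp borel])
    finally show ?thesis .
  qed
  have "emeasure ?\<nu> A = emeasure ?\<nu> (\<Union>k. A \<inter> C k)"
  proof -
    have "(\<Union>k. A \<inter> C k) = A \<inter> {0<..}"
    proof (intro equalityI subsetI)
      fix y assume y: "y \<in> A \<inter> {0<..}"
      obtain k where "\<bar>ln y\<bar> \<le> real k" using real_arch_simple by blast
      then have "exp (- real k) \<le> exp (ln y)" "exp (ln y) \<le> exp (real k)" by auto
      moreover have "exp (ln y) = y" using y by simp
      ultimately have "exp (- real k) \<le> y" "y \<le> exp (real k)" by simp_all
      then show "y \<in> (\<Union>k. A \<inter> C k)" using y by (auto simp: C_def)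
    next
      fix y assume "y \<in> (\<Union>k. A \<inter> C k)"
      then show "y \<in> A \<inter> {0<..}" by (auto simp: C_def intro: less_le_trans[OF exp_gt_zero])
    qed
    moreover have "emeasure ?\<nu> A = emeasure ?\<nu> (A \<inter> {0<..})"
      by (subst (1 2) emeasure_density) (auto intro!: nn_integral_cong simp: haar_def indicator_def)
    ultimately show ?thesis by simp
  qed
  also have "\<dots> = (SUP k. emeasure ?\<nu> (A \<inter> C k))"
  proof (rule SUP_emeasure_incseq[symmetric])
    have "C m \<subseteq> C k" if "m \<le> k" for m k
    proof -
      have "exp (- real k) \<le> exp (- real m)" "exp (real m) \<le> exp (real k)" using that by simp_all
      then show ?thesis unfolding C_def by (intro atLeastatMost_subset_iff[THEN iffD2] disjI2 conjI)
    qed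
    then show "incseq (\<lambda>k. A \<inter> C k)" by (auto simp: incseq_def)
  qed (auto simp: C_def)
  also have "\<dots> = (SUP k. emeasure lborel (exp -` A \<inter> {- real k..real k}))"
    by (simp only: trunc)
  also have "\<dots> = emeasure lborel (\<Union>k. exp -` A \<inter> {- real k..real k})"
    by (rule SUP_emeasure_incseq)
       (auto simp: incseq_def intro!: measurable_sets_borel[of exp borel])
  also have "(\<Union>k. exp -` A \<inter> {- real k..real k}) = exp -` A"
  proof (intro equalityI subsetI)
    fix z assume z: "z \<in> exp -` A"
    obtain k where "\<bar>z\<bar> \<le> real k" using real_arch_simple by blast
    then show "z \<in> (\<Union>k. exp -` A \<inter> {- real k..real k})" using z by (auto simp: abs_le_iff intro!: exI[of _ k])
  qed auto
  also have "emeasure lborel (exp -` A) = emeasure (distr lborel borel exp) A"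
    by (subst emeasure_distr) auto
  finally show "emeasure ?\<nu> A = emeasure (distr lborel borel exp) A" .
qed simp

lemma nn_integral_haar:
  assumes [measurable]: "F \<in> borel_measurable borel"
  shows "(\<integral>\<^sup>+y. haar y * F y \<partial>lborel) = (\<integral>\<^sup>+z. F (exp z) \<partial>lborel)"
proof -
  have "(\<integral>\<^sup>+y. haar y * F y \<partial>lborel) = (\<integral>\<^sup>+y. F y \<partial>density lborel haar)"
    by (subst nn_integral_density) auto
  also have "\<dots> = (\<integral>\<^sup>+z. F (exp z) \<partial>lborel)"
    unfolding density_haar by (rule nn_integral_distr) auto
  finally show ?thesis .
qed

text \<open>On the logarithmic scale the map is \<open>z\<close> to
  \<open>ln c + \<sigma> * z\<close> with \<sigma> equal to 1 or -1, under which Lebesgue measure is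
  invariant.\<close>

lemma nn_integral_haar_invariant:
  assumes [measurable]: "F \<in> borel_measurable borel" and c: "0 < c" and \<sigma>: "\<sigma> = 1 \<or> \<sigma> = - 1"
  shows "(\<integral>\<^sup>+y. haar y * F (c * y powi \<sigma>) \<partial>lborel) = (\<integral>\<^sup>+y. haar y * F y \<partial>lborel)"
proof -
  have [measurable]: "(\<lambda>y. c * y powi \<sigma>) \<in> borel_measurable borel"
    using \<sigma> by (auto simp: power_int_minus)
  have e: "c * exp z powi \<sigma> = exp (ln c + real_of_int \<sigma> * z)" for z
    using \<sigma> c by (auto simp: exp_add exp_minus power_int_minus)
  have "(\<integral>\<^sup>+y. haar y * F (c * y powi \<sigma>) \<partial>lborel) = (\<integral>\<^sup>+z. F (exp (ln c + real_of_int \<sigma> * z)) \<partial>lborel)"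
    by (subst nn_integral_haar) (auto simp: e)
  also have "\<dots> = (\<integral>\<^sup>+z. F (exp z) \<partial>lborel)"
    using \<sigma> nn_integral_real_affine[of "\<lambda>z. F (exp z)" "real_of_int \<sigma>" "ln c"] by auto
  also have "\<dots> = (\<integral>\<^sup>+y. haar y * F y \<partial>lborel)"
    by (rule nn_integral_haar[symmetric]) simp
  finally show ?thesis .
qed

section \<open>Weighted integrals over products of lines, and triangular maps\<close>

abbreviation lborels :: "'v set \<Rightarrow> ('v \<Rightarrow> real) measure" where
  "lborels I \<equiv> Pi\<^sub>M I (\<lambda>_. lborel)"

definition haar_wt :: "'v set \<Rightarrow> ('v \<Rightarrow> real) \<Rightarrow> ennreal" where
  "haar_wt I x = (\<Prod>v\<in>I. haar (x v))"

lemma haar_wt_measurable [measurable]: "haar_wt I \<in> borel_measurable (lborels I)"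
  unfolding haar_wt_def[abs_def] by measurable

lemma haar_wt_eq_0: "finite I \<Longrightarrow> haar_wt I x = 0 \<longleftrightarrow> (\<exists>v\<in>I. x v \<le> 0)"
  by (auto simp: haar_wt_def haar_def not_less ennreal_eq_0_iff split: if_splits)

text \<open>Invariance is expressed by integrals over the whole product space because this form
  composes and can be fed to Fubini. Off the orthant the weight is 0, so there only measurability of
  the map is demanded.\<close>

definition log_preserving :: "'v set \<Rightarrow> (('v \<Rightarrow> real) \<Rightarrow> ('v \<Rightarrow> real)) \<Rightarrow> bool" where
  "log_preserving I \<Phi> \<longleftrightarrow> \<Phi> \<in> measurable (lborels I) (lborels I) \<and>
     (\<forall>F\<in>borel_measurable (lborels I).
        (\<integral>\<^sup>+x. haar_wt I x * F (\<Phi> x) \<partial>lborels I) = (\<integral>\<^sup>+x. haar_wt I x * F x \<partial>lborels I))"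

lemma log_preserving_comp:
  assumes "log_preserving I \<Phi>" "log_preserving I \<Psi>"
  shows "log_preserving I (\<lambda>x. \<Psi> (\<Phi> x))"
proof -
  have [measurable]: "\<Phi> \<in> measurable (lborels I) (lborels I)"
    "\<Psi> \<in> measurable (lborels I) (lborels I)"
    using assms by (auto simp: log_preserving_def)
  have "(\<integral>\<^sup>+x. haar_wt I x * F (\<Psi> (\<Phi> x)) \<partial>lborels I) = (\<integral>\<^sup>+x. haar_wt I x * F x \<partial>lborels I)"
    if [measurable]: "F \<in> borel_measurable (lborels I)" for F
  proof -
    have "(\<lambda>x. F (\<Psi> x)) \<in> borel_measurable (lborels I)" by measurable
    from bspec[OF conjunct2[OF assms(1)[unfolded log_preserving_def]] this]
      bspec[OF conjunct2[OF assms(2)[unfolded log_preserving_def]] that]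
    show ?thesis by simp
  qed
  then show ?thesis by (auto simp: log_preserving_def)
qed

text \<open>The explicit \<open>restrict\<close> enforces triangularity: \<open>g v\<close> is
  handed only coordinates of smaller rank. Coordinates of equal rank do not influence each other, so
  two ranks are often enough.\<close>

definition triangular_map :: "'v set \<Rightarrow> ('v \<Rightarrow> nat) \<Rightarrow> ('v \<Rightarrow> ('v \<Rightarrow> real) \<Rightarrow> real) \<Rightarrow> ('v \<Rightarrow> int) \<Rightarrow>
    ('v \<Rightarrow> real) \<Rightarrow> ('v \<Rightarrow> real)" where
  "triangular_map I \<rho> g \<sigma> x =
     (\<lambda>v\<in>I. g v (restrict x {w \<in> I. \<rho> w < \<rho> v}) * x v powi \<sigma> v)"

text \<open>A coordinate \<open>v\<close> of maximal rank influences no other one. With the others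
  fixed, the integral over it undergoes a scaling, possibly after an inversion, and is unchanged;
  what remains is the triangular map on \<open>I - {v}\<close>, which the induction hypothesis
  covers.\<close>

lemma triangular_map_preserving:
  fixes I :: "'v set"
  assumes "finite I"
    and "\<And>v. v \<in> I \<Longrightarrow> g v \<in> borel_measurable (lborels {w \<in> I. \<rho> w < \<rho> v})"
    and "\<And>v x. v \<in> I \<Longrightarrow> (\<And>w. w \<in> I \<Longrightarrow> \<rho> w < \<rho> v \<Longrightarrow> 0 < x w) \<Longrightarrow>
      0 < g v (restrict x {w \<in> I. \<rho> w < \<rho> v})"
    and "\<And>v. v \<in> I \<Longrightarrow> \<sigma> v = 1 \<or> \<sigma> v = - 1"
  shows "log_preserving I (triangular_map I \<rho> g \<sigma>)"
  using assms
proof (induction "card I" arbitrary: I)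
  case 0
  then have "I = {}" by simp
  moreover have "triangular_map {} \<rho> g \<sigma> = (\<lambda>x. \<lambda>_. undefined)"
    by (simp add: triangular_map_def restrict_def fun_eq_iff)
  ultimately show ?case
    by (simp add: log_preserving_def PiM_empty nn_integral_count_space_finite)
next
  case (Suc c)
  interpret product_sigma_finite "\<lambda>_::'v. lborel :: real measure" by standard
  have "I \<noteq> {}" using Suc.hyps(2) by auto
  then have "Max (\<rho> ` I) \<in> \<rho> ` I" using Suc.prems(1) by (intro Max_in) auto
  then obtain v where v: "v \<in> I" "Max (\<rho> ` I) = \<rho> v" by auto
  then have v_max: "\<rho> w \<le> \<rho> v" if "w \<in> I" for w
    using that Suc.prems(1) by (metis Max_ge finite_imageI imageI)
  define J where "J = I - {v}"
  have J: "finite J" "v \<notin> J" "I = insert v J" "card J = c"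
    using v Suc by (auto simp: J_def)
  define L where "L w = {w' \<in> I. \<rho> w' < \<rho> w}" for w
  \<comment> \<open>Since \<open>v\<close> has maximal rank it lies in no \<open>L w\<close>, so
    removing it changes none of these sets.\<close>
  have LJ: "L w = {w' \<in> J. \<rho> w' < \<rho> w}" if "w \<in> I" for w
    using v_max[OF that] by (auto simp: L_def J_def)
  have Lsub: "L w \<subseteq> J" if "w \<in> I" for w using LJ[OF that] by auto
  have g [measurable]: "(\<lambda>x. g w (restrict x (L w))) \<in> borel_measurable (lborels J)" if "w \<in> I" for w
  proof -
    have "g w \<in> borel_measurable (lborels (L w))" using Suc.prems(2)[OF that] by (simp add: L_def)
    from measurable_compose[OF measurable_restrict_subset[OF Lsub[OF that]] this] show ?thesis .
  qed
  have \<sigma>m: "(\<lambda>y :: real. y powi \<sigma> w) \<in> borel_measurable borel" if "w \<in> I" for w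
    using Suc.prems(4)[OF that] by (auto simp: power_int_minus)
  let ?P = "lborels J" and ?Q = "lborels I"
  let ?\<Phi> = "triangular_map J \<rho> g \<sigma>" and ?\<Psi> = "triangular_map I \<rho> g \<sigma>"
  have IH: "log_preserving J ?\<Phi>"
  proof (rule Suc.hyps(1))
    fix w assume w: "w \<in> J"
    then have wI: "w \<in> I" by (simp add: J)
    show "g w \<in> borel_measurable (lborels {w' \<in> J. \<rho> w' < \<rho> w})"
      using Suc.prems(2)[OF wI] unfolding LJ[OF wI, symmetric] L_def .
    show "0 < g w (restrict x {w' \<in> J. \<rho> w' < \<rho> w})" if "\<And>w'. w' \<in> J \<Longrightarrow> \<rho> w' < \<rho> w \<Longrightarrow> 0 < x w'" for x
      using Suc.prems(3)[OF wI, of x] that unfolding LJ[OF wI, symmetric] L_def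
      by (metis (mono_tags, lifting) LJ L_def mem_Collect_eq wI)
    show "\<sigma> w = 1 \<or> \<sigma> w = - 1" using Suc.prems(4)[OF wI] .
  qed (use J in auto)
  then have \<Phi>m [measurable]: "?\<Phi> \<in> measurable ?P ?P"
    and \<Phi>int: "\<And>F. F \<in> borel_measurable ?P \<Longrightarrow> (\<integral>\<^sup>+x. haar_wt J x * F (?\<Phi> x) \<partial>?P) = (\<integral>\<^sup>+x. haar_wt J x * F x \<partial>?P)"
    by (auto simp: log_preserving_def)
  have \<Psi>m [measurable]: "?\<Psi> \<in> measurable ?Q ?Q"
    unfolding triangular_map_def L_def[symmetric]
  proof (rule measurable_restrict)
    fix w assume w: "w \<in> I"
    have "(\<lambda>x. g w (restrict (restrict x J) (L w))) \<in> borel_measurable ?Q"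
      by (rule measurable_compose[OF measurable_restrict_subset g[OF w]]) (auto simp: J)
    moreover have "restrict (restrict x J) (L w) = restrict x (L w)" for x :: "'v \<Rightarrow> real"
      using Lsub[OF w] by (auto simp: restrict_def fun_eq_iff)
    moreover have "(\<lambda>x. x w powi \<sigma> w) \<in> borel_measurable ?Q"
      using measurable_compose[OF _ \<sigma>m[OF w], of "\<lambda>x. x w" ?Q] w by simp
    ultimately show "(\<lambda>x. g w (restrict x (L w)) * x w powi \<sigma> w) \<in> measurable ?Q lborel"
      by simp
  qed
  have triI: "?\<Psi> x w = (if w \<in> I then g w (restrict x (L w)) * x w powi \<sigma> w else undefined)" for x w
    by (simp add: triangular_map_def L_def)
  have triJ: "?\<Phi> x w = (if w \<in> J then g w (restrict x (L w)) * x w powi \<sigma> w else undefined)" for x w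
    using LJ[of w] J(3) by (simp add: triangular_map_def)
  have \<Psi>upd: "?\<Psi> (x(v := y)) = (?\<Phi> x)(v := g v (restrict x (L v)) * y powi \<sigma> v)" for x y
  proof
    fix w
    have "restrict (x(v := y)) (L w) = restrict x (L w)" if "w \<in> I"
      using Lsub[OF that] J(2) by (auto simp: restrict_def fun_eq_iff)
    then show "?\<Psi> (x(v := y)) w = ((?\<Phi> x)(v := g v (restrict x (L v)) * y powi \<sigma> v)) w"
      using J(2,3) unfolding triI triJ by auto
  qed
  have wtupd: "haar_wt I (x(v := y)) = haar y * haar_wt J x" for x y
  proof -
    have "(\<Prod>w\<in>J. haar ((x(v := y)) w)) = (\<Prod>w\<in>J. haar (x w))"
      using J(2) by (intro prod.cong) auto
    then show ?thesis unfolding haar_wt_def J(3) using J by simp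
  qed
  have "(\<integral>\<^sup>+x. haar_wt I x * F (?\<Psi> x) \<partial>?Q) = (\<integral>\<^sup>+x. haar_wt I x * F x \<partial>?Q)"
    if Fm [measurable]: "F \<in> borel_measurable ?Q" for F
  proof -
    have upd [measurable]: "(\<lambda>(x, y). x(v := y)) \<in> measurable (?P \<Otimes>\<^sub>M lborel) ?Q"
      unfolding J(3) by (rule measurable_add_dim)
    have Fu: "(\<lambda>(x, y). F (x(v := y))) \<in> borel_measurable (?P \<Otimes>\<^sub>M lborel)"
      using measurable_compose[OF upd Fm] by (simp add: case_prod_beta')
    have Fy: "(\<lambda>y. F (x(v := y))) \<in> borel_measurable borel" if "x \<in> space ?P" for x
      using measurable_compose_Pair1[OF that Fu] by simp
    \<comment> \<open>\<open>F\<close> with the coordinate \<open>v\<close> integrated out; the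
      induction hypothesis is applied to this function.\<close>
    define F' where "F' x = (\<integral>\<^sup>+y. haar y * F (x(v := y)) \<partial>lborel)" for x
    have F'm: "F' \<in> borel_measurable ?P"
      unfolding F'_def using Fu by (intro lborel.borel_measurable_nn_integral) (simp add: case_prod_beta')
    have "(\<integral>\<^sup>+x. haar_wt I x * F (?\<Psi> x) \<partial>?Q)
      = (\<integral>\<^sup>+x. \<integral>\<^sup>+y. haar_wt I (x(v := y)) * F (?\<Psi> (x(v := y))) \<partial>lborel \<partial>?P)"
      unfolding J(3) by (rule product_nn_integral_insert[OF J(1,2)]) (simp add: J(3)[symmetric])
    also have "\<dots> = (\<integral>\<^sup>+x. haar_wt J x * F' (?\<Phi> x) \<partial>?P)"
    proof (rule nn_integral_cong)
      fix x assume x: "x \<in> space ?P"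
      have \<Phi>x: "?\<Phi> x \<in> space ?P" using measurable_space[OF \<Phi>m x] .
      let ?c = "g v (restrict x (L v))"
      have "(\<integral>\<^sup>+y. haar_wt I (x(v := y)) * F (?\<Psi> (x(v := y))) \<partial>lborel)
        = (\<integral>\<^sup>+y. haar_wt J x * (haar y * F ((?\<Phi> x)(v := ?c * y powi \<sigma> v))) \<partial>lborel)"
        unfolding wtupd \<Psi>upd by (simp add: mult_ac)
      also have "\<dots> = haar_wt J x * (\<integral>\<^sup>+y. haar y * F ((?\<Phi> x)(v := ?c * y powi \<sigma> v)) \<partial>lborel)"
      proof (rule nn_integral_cmult)
        have "(\<lambda>y. F ((?\<Phi> x)(v := ?c * y powi \<sigma> v))) \<in> borel_measurable borel"
          using measurable_compose[OF borel_measurable_times[OF borel_measurable_const \<sigma>m[OF v(1)]] Fy[OF \<Phi>x]]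
          by simp
        then show "(\<lambda>y. haar y * F ((?\<Phi> x)(v := ?c * y powi \<sigma> v))) \<in> borel_measurable lborel" by simp
      qed
      also have "\<dots> = haar_wt J x * F' (?\<Phi> x)"
      \<comment> \<open>The factor \<open>?c\<close> is known to be positive only if all coordinates
        in \<open>J\<close> are; elsewhere both sides carry the weight 0.\<close>
      proof (cases "haar_wt J x = 0")
        case False
        then have pos: "\<And>w. w \<in> J \<Longrightarrow> 0 < x w" using J(1) by (auto simp: haar_wt_eq_0 not_le)
        have "0 < ?c" unfolding L_def
          by (rule Suc.prems(3)[OF v(1)]) (use pos J in auto)
        then show ?thesis
          unfolding F'_def using nn_integral_haar_invariant[OF Fy[OF \<Phi>x] _ Suc.prems(4)[OF v(1)]] by simp
      qed simp
      finally show "(\<integral>\<^sup>+y. haar_wt I (x(v := y)) * F (?\<Psi> (x(v := y))) \<partial>lborel) = haar_wt J x * F' (?\<Phi> x)" .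
    qed
    also have "\<dots> = (\<integral>\<^sup>+x. haar_wt J x * F' x \<partial>?P)" by (rule \<Phi>int[OF F'm])
    also have "\<dots> = (\<integral>\<^sup>+x. \<integral>\<^sup>+y. haar_wt I (x(v := y)) * F (x(v := y)) \<partial>lborel \<partial>?P)"
    proof (rule nn_integral_cong)
      fix x assume x: "x \<in> space ?P"
      have "haar_wt J x * F' x = (\<integral>\<^sup>+y. haar_wt J x * (haar y * F (x(v := y))) \<partial>lborel)"
        unfolding F'_def using Fy[OF x] by (intro nn_integral_cmult[symmetric]) simp
      then show "haar_wt J x * F' x = (\<integral>\<^sup>+y. haar_wt I (x(v := y)) * F (x(v := y)) \<partial>lborel)"
        unfolding wtupd by (simp add: mult_ac)
    qed
    also have "\<dots> = (\<integral>\<^sup>+x. haar_wt I x * F x \<partial>?Q)"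
      unfolding J(3) by (rule product_nn_integral_insert[OF J(1,2), symmetric]) (simp add: J(3)[symmetric])
    finally show ?thesis .
  qed
  then show ?case using \<Psi>m by (auto simp: log_preserving_def)
qed

section \<open>The invariant measure of the orthant as a weighted product measure\<close>

lemma coords_iff [simp]:
  "TVar i j \<in> coords n \<longleftrightarrow> 1 \<le> i \<and> i < j \<and> j \<le> n"
  "SVar i j \<in> coords n \<longleftrightarrow> 1 \<le> i \<and> i < j \<and> j \<le> n"
  by (auto simp: coords_def)

lemma finite_coords: "finite (coords n)"
  by (simp add: coords_def)

lemma orthant_sets: "orthant n \<in> sets (lborels (coords n))"
  unfolding orthant_def by (rule sets_PiM_I_finite) (auto simp: finite_coords)

lemma space_log_measure: "space (log_measure n) = orthant n"
proof -
  have "orthant n \<subseteq> space (lborels (coords n))"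
    by (rule sets.sets_into_space[OF orthant_sets])
  then show ?thesis by (auto simp: log_measure_def space_restrict_space)
qed

lemma sets_log_measure:
  "sets (log_measure n) = sets (restrict_space (lborels (coords n)) (orthant n))"
  by (simp add: log_measure_def)

lemma sets_log_measure_PiM:
  "A \<in> sets (log_measure n) \<Longrightarrow> A \<in> sets (lborels (coords n))"
  using orthant_sets unfolding sets_log_measure
  by (subst (asm) sets_restrict_space_iff) (auto simp: Int_absorb2 sets.sets_into_space)

lemma haar_wt_orthant:
  assumes "x \<in> space (lborels (coords n))"
  shows "haar_wt (coords n) x = indicator (orthant n) x * ennreal (\<Prod>v\<in>coords n. 1 / x v)"
proof (cases "x \<in> orthant n")
  case True
  then have pos: "\<And>v. v \<in> coords n \<Longrightarrow> 0 < x v" by (auto simp: orthant_def PiE_def)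
  then have "haar_wt (coords n) x = (\<Prod>v\<in>coords n. ennreal (1 / x v))"
    unfolding haar_wt_def by (intro prod.cong) (auto simp: haar_def)
  also have "\<dots> = ennreal (\<Prod>v\<in>coords n. 1 / x v)"
    using pos by (intro prod_ennreal) (auto intro: less_imp_le)
  finally show ?thesis using True by simp
next
  case False
  then have "\<exists>v\<in>coords n. x v \<le> 0"
    using assms by (auto simp: orthant_def space_PiM PiE_def not_less[symmetric])
  then show ?thesis using False by (simp add: haar_wt_eq_0[OF finite_coords])
qed

lemma emeasure_log_measure:
  assumes A: "A \<in> sets (log_measure n)"
  shows "emeasure (log_measure n) A =
    (\<integral>\<^sup>+x. haar_wt (coords n) x * indicator A x \<partial>lborels (coords n))"
proof -
  let ?P = "lborels (coords n)"
  have m: "(\<lambda>x. ennreal (\<Prod>v\<in>coords n. 1 / x v)) \<in> borel_measurable ?P"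
    by measurable
  have O: "orthant n \<inter> space ?P \<in> sets ?P" using orthant_sets by auto
  have "emeasure (log_measure n) A = (\<integral>\<^sup>+x. ennreal (\<Prod>v\<in>coords n. 1 / x v) * indicator A x
      \<partial>restrict_space ?P (orthant n))"
    unfolding log_measure_def
    by (rule emeasure_density) (use A m in \<open>auto simp: sets_log_measure intro: measurable_restrict_space1\<close>)
  also have "\<dots> = (\<integral>\<^sup>+x. ennreal (\<Prod>v\<in>coords n. 1 / x v) * indicator A x * indicator (orthant n) x \<partial>?P)"
    by (rule nn_integral_restrict_space[OF O])
  also have "\<dots> = (\<integral>\<^sup>+x. haar_wt (coords n) x * indicator A x \<partial>?P)"
    by (rule nn_integral_cong) (simp add: haar_wt_orthant mult_ac)
  finally show ?thesis .
qed

text \<open>Agreement of \<open>f\<close> with \<Phi> on the orthant suffices because the orthant is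
  the whole space of \<open>log_measure n\<close>. This accommodates \<open>pq_map\<close>, whose
  values elsewhere may be unspecified.\<close>

lemma log_preserving_distr:
  assumes \<Phi>: "log_preserving (coords n) \<Phi>"
    and eq: "\<And>x. x \<in> orthant n \<Longrightarrow> f x = \<Phi> x" and into: "\<And>x. x \<in> orthant n \<Longrightarrow> \<Phi> x \<in> orthant n"
  shows "f \<in> measurable (log_measure n) (log_measure n) \<and>
    distr (log_measure n) (log_measure n) f = log_measure n"
proof
  let ?P = "lborels (coords n)"
  have \<Phi>m: "\<Phi> \<in> measurable ?P ?P" using \<Phi> by (simp add: log_preserving_def)
  have "\<Phi> \<in> measurable (restrict_space ?P (orthant n)) (restrict_space ?P (orthant n))"
    by (rule measurable_restrict_space3[OF \<Phi>m]) (use into in auto)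
  then have "\<Phi> \<in> measurable (log_measure n) (log_measure n)"
    by (simp add: measurable_cong_sets[OF sets_log_measure sets_log_measure])
  then show fm: "f \<in> measurable (log_measure n) (log_measure n)"
    by (rule measurable_cong[THEN iffD2, rotated]) (use eq in \<open>auto simp: space_log_measure\<close>)
  show "distr (log_measure n) (log_measure n) f = log_measure n"
  proof (rule measure_eqI)
    fix A assume "A \<in> sets (distr (log_measure n) (log_measure n) f)"
    then have A: "A \<in> sets (log_measure n)" by simp
    note AP = sets_log_measure_PiM[OF A]
    have fA: "f -` A \<inter> space (log_measure n) \<in> sets (log_measure n)"
      by (rule measurable_sets[OF fm A])
    have "emeasure (distr (log_measure n) (log_measure n) f) A
      = (\<integral>\<^sup>+x. haar_wt (coords n) x * indicator (f -` A \<inter> space (log_measure n)) x \<partial>?P)"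
      by (simp only: emeasure_distr[OF fm A] emeasure_log_measure[OF fA])
    also have "\<dots> = (\<integral>\<^sup>+x. haar_wt (coords n) x * indicator A (\<Phi> x) \<partial>?P)"
    proof (rule nn_integral_cong)
      fix x assume "x \<in> space ?P"
      then show "haar_wt (coords n) x * indicator (f -` A \<inter> space (log_measure n)) x = haar_wt (coords n) x * indicator A (\<Phi> x)"
        by (cases "x \<in> orthant n") (auto simp: space_log_measure eq haar_wt_orthant indicator_def)
    qed
    also have "\<dots> = (\<integral>\<^sup>+x. haar_wt (coords n) x * indicator A x \<partial>?P)"
      using bspec[OF conjunct2[OF \<Phi>[unfolded log_preserving_def]], of "indicator A"] AP by simp
    also have "\<dots> = emeasure (log_measure n) A" by (rule emeasure_log_measure[OF A, symmetric])
    finally show "emeasure (distr (log_measure n) (log_measure n) f) A = emeasure (log_measure n) A" .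
  qed simp
qed

lemma triangular_map_apply:
  assumes "v \<in> I" "g v (restrict x {w \<in> I. \<rho> w < \<rho> v}) = g v x"
  shows "triangular_map I \<rho> g \<sigma> x v = g v x * x v powi \<sigma> v"
  using assms by (simp add: triangular_map_def)

lemma component_measurable:
  "w \<in> L \<Longrightarrow> (\<lambda>x. x w) \<in> borel_measurable (lborels L)"
  using measurable_component_singleton[of w L "\<lambda>_. lborel :: real measure"] by simp

lemma powi_eps: "x powi eps k = (if even k then x else inverse x)" for x :: "'a::field"
  by (simp add: eps_def power_int_minus)

lemma eps_cases: "eps k = 1 \<or> eps k = - 1"
  by (simp add: eps_def minus_one_power_iff)

section \<open>The three triangular maps that make up the parameter map\<close>

fun ratio_rank :: "var \<Rightarrow> nat" where
  "ratio_rank (TVar i j) = 0" | "ratio_rank (SVar i j) = 1"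

fun ratio_fac :: "var \<Rightarrow> (var \<Rightarrow> real) \<Rightarrow> real" where
  "ratio_fac (TVar i j) x = 1" | "ratio_fac (SVar i j) x = inverse (x (TVar i j))"

fun p_rank :: "var \<Rightarrow> nat" where
  "p_rank (TVar i j) = 1" | "p_rank (SVar i j) = 0"

text \<open>\<open>p\<^sub>i\<^sub>,\<^sub>j t\<^sub>i\<^sub>,\<^sub>j\<close> as a function of \<open>m = s/t\<close>.\<close>

definition p_fac_aux :: "nat \<Rightarrow> (nat \<Rightarrow> nat \<Rightarrow> real) \<Rightarrow> nat \<Rightarrow> nat \<Rightarrow> real" where
  "p_fac_aux n m i j = (if i = j - 1 then 1 else (1 + m i (j - 1)) / m i (j - 1)) *
    (\<Prod>k\<in>{1..<i}. inverse (m k (j - 1))) *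
    (if j < n then inverse (1 + m i j) * (\<Prod>k\<in>{1..<i}. m k j)
     else (if odd (n - i) then 1 else inverse (m i n)) * (\<Prod>k\<in>{1..<i}. inverse (m k n) powi eps (n - i)))"

fun p_fac :: "nat \<Rightarrow> var \<Rightarrow> (var \<Rightarrow> real) \<Rightarrow> real" where
  "p_fac n (TVar i j) x = p_fac_aux n (\<lambda>i j. x (SVar i j)) i j" | "p_fac n (SVar i j) x = 1"

text \<open>The exponent -1 records that \<open>p i j\<close> is a function of \<open>m\<close>
  divided by \<open>t i j\<close>.\<close>

fun p_sign :: "var \<Rightarrow> int" where
  "p_sign (TVar i j) = - 1" | "p_sign (SVar i j) = 1"

text \<open>In the last column the factor of \<open>q i n\<close> involves \<open>m k n\<close> for
  all \<open>k < i\<close>, hence the rank \<open>i\<close>. As \<open>i\<close> is at least 1, all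
  coordinates \<open>p\<close>, of rank 0, lie below.\<close>

fun q_rank :: "var \<Rightarrow> nat" where
  "q_rank (TVar i j) = 0" | "q_rank (SVar i j) = i"

text \<open>Between \<open>p i n\<close> and \<open>q i n\<close> the factors with
  \<open>k < i\<close> change from \<open>t/s\<close> to \<open>s/t\<close>, raised to
  \<open>eps (n - i)\<close>. Each change costs the square of a power of \<open>m k n\<close>; the
  extra factor with \<open>k = i\<close> is supplied by \<open>q_sign\<close>.\<close>

fun q_fac :: "nat \<Rightarrow> var \<Rightarrow> (var \<Rightarrow> real) \<Rightarrow> real" where
  "q_fac n (TVar i j) x = 1"
| "q_fac n (SVar i j) x = x (TVar i j) *
     (if j < n then 1 else \<Prod>k\<in>{1..<i}. x (SVar k n) powi eps (n - i) * x (SVar k n) powi eps (n - i))"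

fun q_sign :: "nat \<Rightarrow> var \<Rightarrow> int" where
  "q_sign n (TVar i j) = 1" | "q_sign n (SVar i j) = (if j < n then 1 else eps (n - i))"

definition "ratio_map n = triangular_map (coords n) ratio_rank ratio_fac (\<lambda>_. 1)"
definition "p_map n = triangular_map (coords n) p_rank (p_fac n) p_sign"
definition "q_map n = triangular_map (coords n) q_rank (q_fac n) (q_sign n)"

lemma borel_powi_eps: "f \<in> borel_measurable M \<Longrightarrow> (\<lambda>x. f x powi eps k :: real) \<in> borel_measurable M"
  by (simp add: powi_eps)

lemma ratio_map_preserving: "log_preserving (coords n) (ratio_map n)"
  unfolding ratio_map_def
proof (rule triangular_map_preserving[OF finite_coords])
  fix v assume v: "v \<in> coords n"
  show "ratio_fac v \<in> borel_measurable (lborels {w \<in> coords n. ratio_rank w < ratio_rank v})"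
    using v by (cases v) (auto intro!: borel_measurable_inverse component_measurable simp: fun_eq_iff cong: measurable_cong)
  show "0 < ratio_fac v (restrict x {w \<in> coords n. ratio_rank w < ratio_rank v})"
    if "\<And>w. w \<in> coords n \<Longrightarrow> ratio_rank w < ratio_rank v \<Longrightarrow> 0 < x w" for x
    using v that by (cases v) auto
qed auto

lemma p_fac_aux_measurable:
  assumes m: "\<And>k l. 1 \<le> k \<Longrightarrow> k < l \<Longrightarrow> l \<le> n \<Longrightarrow> (\<lambda>x. f x k l) \<in> borel_measurable M"
    and ij: "1 \<le> i" "i < j" "j \<le> n"
  shows "(\<lambda>x. p_fac_aux n (f x) i j) \<in> borel_measurable M"
proof -
  have 1: "(\<lambda>x. if i = j - 1 then 1 else (1 + f x i (j - 1)) / f x i (j - 1)) \<in> borel_measurable M"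
    using m[of i "j - 1"] ij by (cases "i = j - 1") auto
  have 2: "(\<lambda>x. \<Prod>k\<in>{1..<i}. inverse (f x k (j - 1))) \<in> borel_measurable M"
    using ij by (intro borel_measurable_prod borel_measurable_inverse m) auto
  have 3: "(\<lambda>x. if j < n then inverse (1 + f x i j) * (\<Prod>k\<in>{1..<i}. f x k j)
     else (if odd (n - i) then 1 else inverse (f x i n)) * (\<Prod>k\<in>{1..<i}. inverse (f x k n) powi eps (n - i)))
     \<in> borel_measurable M"
    using ij by (cases "j < n"; cases "odd (n - i)")
      (auto intro!: borel_measurable_times borel_measurable_prod borel_powi_eps borel_measurable_inverse
        borel_measurable_add m simp del: even_diff_nat)
  show ?thesis unfolding p_fac_aux_def by (intro borel_measurable_times 1 2 3)
qed

lemma p_map_preserving: "log_preserving (coords n) (p_map n)"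
  unfolding p_map_def
proof (rule triangular_map_preserving[OF finite_coords])
  fix v assume v: "v \<in> coords n"
  let ?L = "{w \<in> coords n. p_rank w < p_rank v}"
  show "p_fac n v \<in> borel_measurable (lborels ?L)"
  proof (cases v)
    case [simp]: (TVar i j)
    have ij: "1 \<le> i" "i < j" "j \<le> n" using v by auto
    have m: "(\<lambda>x. x (SVar k l)) \<in> borel_measurable (lborels ?L)"
      if "1 \<le> k" "k < l" "l \<le> n" for k l
      by (rule component_measurable) (use that in auto)
    show ?thesis
      unfolding TVar p_fac.simps by (rule p_fac_aux_measurable[OF m[unfolded TVar] ij])
  next
    case (SVar i j)
    then have "p_fac n v = (\<lambda>_. 1)" by (simp add: fun_eq_iff)
    then show ?thesis by simp
  qed
  show "0 < p_fac n v (restrict x ?L)"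
    if "\<And>w. w \<in> coords n \<Longrightarrow> p_rank w < p_rank v \<Longrightarrow> 0 < x w" for x
  proof (cases v)
    case [simp]: (TVar i j)
    have ij: "1 \<le> i" "i < j" "j \<le> n" using v by auto
    have m: "0 < x (SVar k l)" if "1 \<le> k" "k < l" "l \<le> n" for k l
      using \<open>\<And>w. w \<in> coords n \<Longrightarrow> p_rank w < p_rank v \<Longrightarrow> 0 < x w\<close>[of "SVar k l"] that by auto
    show ?thesis using ij
      by (auto simp: p_fac_aux_def powi_eps intro!: mult_pos_pos prod_pos divide_pos_pos add_pos_pos m)
  qed simp
  show "p_sign v = 1 \<or> p_sign v = - 1" by (cases v) auto
qed

lemma q_map_preserving: "log_preserving (coords n) (q_map n)"
  unfolding q_map_def
proof (rule triangular_map_preserving[OF finite_coords])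
  fix v assume v: "v \<in> coords n"
  let ?L = "{w \<in> coords n. q_rank w < q_rank v}"
  show "q_fac n v \<in> borel_measurable (lborels ?L)"
  proof (cases v)
    case [simp]: (SVar i j)
    have ij: "1 \<le> i" "i < j" "j \<le> n" using v by auto
    show ?thesis
      unfolding SVar q_fac.simps using ij
      by (cases "j < n")
         (auto intro!: borel_measurable_times borel_measurable_prod borel_powi_eps component_measurable)
  next
    case (TVar i j)
    then have "q_fac n v = (\<lambda>_. 1)" by (simp add: fun_eq_iff)
    then show ?thesis by simp
  qed
  show "0 < q_fac n v (restrict x ?L)"
    if "\<And>w. w \<in> coords n \<Longrightarrow> q_rank w < q_rank v \<Longrightarrow> 0 < x w" for x
  proof (cases v)
    case [simp]: (SVar i j)
    have ij: "1 \<le> i" "i < j" "j \<le> n" using v by auto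
    have "0 < x (TVar i j)" "\<And>k. 1 \<le> k \<Longrightarrow> k < i \<Longrightarrow> 0 < x (SVar k n)"
      using that[of "TVar i j"] that[of "SVar _ n"] ij by auto
    then show ?thesis using ij
      by (auto simp: powi_eps intro!: mult_pos_pos prod_pos)
  qed simp
  show "q_sign n v = 1 \<or> q_sign n v = - 1" using eps_cases by (cases v) auto
qed

section \<open>The group \<open>SO(n,n)\<close> and unipotent matrices\<close>

abbreviation sqmats :: "nat \<Rightarrow> 'a mat set" where
  "sqmats n \<equiv> carrier_mat (2 * n) (2 * n)"

text \<open>The involution \<open>hat\<close> for indices counted from 0.\<close>

definition opp :: "nat \<Rightarrow> nat \<Rightarrow> nat" where
  "opp n a = 2 * n - 1 - a"

lemma opp_opp [simp]: "a < 2 * n \<Longrightarrow> opp n (opp n a) = a"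
  by (auto simp: opp_def)

lemma opp_less [simp]: "a < 2 * n \<Longrightarrow> opp n a < 2 * n"
  by (auto simp: opp_def)

lemma opp_eq_iff [simp]: "a < 2 * n \<Longrightarrow> b < 2 * n \<Longrightarrow> opp n a = opp n b \<longleftrightarrow> a = b"
  by (auto simp: opp_def)

lemma opp_eq_swap: "a < 2 * n \<Longrightarrow> b < 2 * n \<Longrightarrow> a = opp n b \<longleftrightarrow> b = opp n a"
  by (auto simp: opp_def)

lemma opp_neq_self [simp]:
  assumes "a < 2 * n"
  shows "opp n a \<noteq> a" "a \<noteq> opp n a"
  using assms unfolding opp_def by presburger+

lemma index_mult_sum:
  "A \<in> carrier_mat N N \<Longrightarrow> B \<in> carrier_mat N N \<Longrightarrow> i < N \<Longrightarrow> j < N \<Longrightarrow>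
    (A * B) $$ (i, j) = (\<Sum>k<N. A $$ (i, k) * B $$ (k, j))"
  by (simp add: scalar_prod_def lessThan_atLeast0)

lemma square_mult_carrier:
  "A \<in> carrier_mat N N \<Longrightarrow> B \<in> carrier_mat N N \<Longrightarrow> A * B \<in> carrier_mat N N"
  by simp

lemmas square_assoc = assoc_mult_mat[of _ "2*n" "2*n" _ "2*n" _ "2*n" for n]
  square_mult_carrier[of _ "2*n" for n]

text \<open>For \<open>a \<noteq> b\<close> and \<open>a \<noteq> opp n b\<close> this is the
  one-parameter subgroup of a root: the root vector squares to zero, so its exponential stops after
  the linear term.\<close>

definition root_mat :: "nat \<Rightarrow> nat \<Rightarrow> nat \<Rightarrow> 'a::field \<Rightarrow> 'a mat" where
  "root_mat n a b c = Matrix.mat (2*n) (2*n) (\<lambda>(i, j). (if i = j then 1 else 0) +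
     (if i = a \<and> j = b then c else 0) - (if i = opp n b \<and> j = opp n a then c else 0))"

lemma root_mat_carrier [simp]: "root_mat n a b c \<in> sqmats n"
  by (simp add: root_mat_def)

lemma root_mat_dim [simp]: "dim_row (root_mat n a b c) = 2*n" "dim_col (root_mat n a b c) = 2*n"
  by (simp_all add: root_mat_def)

lemma root_mat_index:
  "i < 2*n \<Longrightarrow> j < 2*n \<Longrightarrow> root_mat n a b c $$ (i, j) = (if i = j then 1 else 0) +
     (if i = a \<and> j = b then c else 0) - (if i = opp n b \<and> j = opp n a then c else 0)"
  by (simp add: root_mat_def)

text \<open>Right multiplication is a pair of column operations; in this form products of
  exponentials are evaluated one factor at a time.\<close>

lemma mult_root_mat_index:
  assumes "A \<in> sqmats n" "a < 2*n" "b < 2*n" "i < 2*n" "j < 2*n"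
  shows "(A * root_mat n a b c) $$ (i, j) = A $$ (i, j) + (if j = b then c * A $$ (i, a) else 0)
     - (if j = opp n a then c * A $$ (i, opp n b) else 0)"
proof -
  have "(A * root_mat n a b c) $$ (i, j) =
    (\<Sum>k<2*n. (if k = j then A $$ (i, j) else 0)
      + (if k = a then (if j = b then c * A $$ (i, a) else 0) else 0)
      - (if k = opp n b then (if j = opp n a then c * A $$ (i, opp n b) else 0) else 0))"
    unfolding index_mult_sum[OF assms(1) root_mat_carrier assms(4,5)]
    by (rule sum.cong) (use assms in \<open>auto simp: root_mat_def algebra_simps\<close>)
  also have "\<dots> = A $$ (i, j) + (if j = b then c * A $$ (i, a) else 0)
     - (if j = opp n a then c * A $$ (i, opp n b) else 0)"
    using assms by (simp add: sum.distrib sum_subtractf)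
  finally show ?thesis .
qed

lemma lower_unipotentI:
  assumes "A \<in> carrier_mat N N" "\<And>i. i < N \<Longrightarrow> A $$ (i, i) = 1"
    "\<And>i j. i < j \<Longrightarrow> j < N \<Longrightarrow> A $$ (i, j) = 0"
  shows "lower_unipotent A"
  using assms by (auto simp: lower_unipotent_def)

lemma lower_unipotent_mult:
  assumes A: "A \<in> carrier_mat N N" "lower_unipotent A"
    and B: "B \<in> carrier_mat N N" "lower_unipotent B"
  shows "lower_unipotent (A * B)"
proof (rule lower_unipotentI)
  show "A * B \<in> carrier_mat N N" using A B by simp
next
  fix i assume i: "i < N"
  have "(A * B) $$ (i, i) = (\<Sum>k<N. A $$ (i, k) * B $$ (k, i))"
    by (rule index_mult_sum) (use A B i in auto)
  also have "\<dots> = (\<Sum>k<N. if k = i then 1 else 0)"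
  proof (rule sum.cong)
    fix k assume "k \<in> {..<N}"
    then show "A $$ (i, k) * B $$ (k, i) = (if k = i then 1 else 0)"
      using A B i by (cases k i rule: linorder_cases) (auto simp: lower_unipotent_def)
  qed simp
  finally show "(A * B) $$ (i, i) = 1" using i by simp
next
  fix i j assume ij: "i < j" "j < N"
  have "(A * B) $$ (i, j) = (\<Sum>k<N. A $$ (i, k) * B $$ (k, j))"
    by (rule index_mult_sum) (use A B ij in auto)
  also have "\<dots> = (\<Sum>k<N. 0)"
  proof (rule sum.cong)
    fix k assume "k \<in> {..<N}"
    then show "A $$ (i, k) * B $$ (k, j) = 0"
      using A B ij by (cases "k < j") (auto simp: lower_unipotent_def)
  qed simp
  finally show "(A * B) $$ (i, j) = 0" by simp
qed

definition upper_unipotent :: "'a::field mat \<Rightarrow> bool" where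
  "upper_unipotent A \<longleftrightarrow> lower_unipotent (transpose_mat A)"

lemma upper_unipotent_mult:
  assumes A: "A \<in> carrier_mat N N" "upper_unipotent A"
    and B: "B \<in> carrier_mat N N" "upper_unipotent B"
  shows "upper_unipotent (A * B)"
  unfolding upper_unipotent_def transpose_mult[OF A(1) B(1)]
  by (rule lower_unipotent_mult) (use A B in \<open>auto simp: upper_unipotent_def\<close>)

lemma lower_unipotent_det:
  assumes "A \<in> carrier_mat N N" "lower_unipotent A"
  shows "Determinant.det A = 1"
proof -
  have "Determinant.det A = prod_list (diag_mat A)"
    by (rule det_lower_triangular[of N]) (use assms in \<open>auto simp: lower_unipotent_def\<close>)
  also have "diag_mat A = replicate N 1"
    using assms by (auto simp: diag_mat_def lower_unipotent_def list_eq_iff_nth_eq)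
  finally show ?thesis by simp
qed

lemma upper_unipotent_det:
  assumes "A \<in> carrier_mat N N" "upper_unipotent A"
  shows "Determinant.det A = 1"
  using lower_unipotent_det[of "transpose_mat A" N] assms det_transpose[of A N]
  by (simp add: upper_unipotent_def)

section \<open>The invariant form and inverses in the orthogonal group\<close>

lemma form_mat_carrier [simp]: "form_mat n \<in> sqmats n"
  by (simp add: form_mat_def)

lemma form_mat_index:
  "i < 2*n \<Longrightarrow> j < 2*n \<Longrightarrow> form_mat n $$ (i, j) = (if j = opp n i then 1 else 0)"
  by (auto simp: form_mat_def hat_def opp_def)

lemma mult_form_mat_index:
  assumes "A \<in> sqmats n" "i < 2*n" "j < 2*n"
  shows "(A * form_mat n) $$ (i, j) = A $$ (i, opp n j)"
proof -
  have "(A * form_mat n) $$ (i, j) = (\<Sum>k<2*n. if k = opp n j then A $$ (i, opp n j) else 0)"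
    unfolding index_mult_sum[OF assms(1) form_mat_carrier assms(2,3)]
    by (rule sum.cong) (use assms in \<open>auto simp: form_mat_index opp_eq_swap\<close>)
  then show ?thesis using assms by simp
qed

lemma form_mat_mult_index:
  assumes "A \<in> sqmats n" "i < 2*n" "j < 2*n"
  shows "(form_mat n * A) $$ (i, j) = A $$ (opp n i, j)"
proof -
  have "(form_mat n * A) $$ (i, j) = (\<Sum>k<2*n. if k = opp n i then A $$ (opp n i, j) else 0)"
    unfolding index_mult_sum[OF form_mat_carrier assms(1) assms(2,3)]
    by (rule sum.cong) (use assms in \<open>auto simp: form_mat_index\<close>)
  then show ?thesis using assms by simp
qed

text \<open>The transpose along the antidiagonal: the inverse on \<^term>\<open>SO n\<close>.\<close>

definition adj :: "nat \<Rightarrow> 'a::field mat \<Rightarrow> 'a mat" where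
  "adj n A = Matrix.mat (2*n) (2*n) (\<lambda>(i, j). A $$ (opp n j, opp n i))"

lemma adj_carrier [simp]: "adj n A \<in> sqmats n"
  by (simp add: adj_def)

lemma adj_index: "i < 2*n \<Longrightarrow> j < 2*n \<Longrightarrow> adj n A $$ (i, j) = A $$ (opp n j, opp n i)"
  by (simp add: adj_def)

lemma SO_carrier: "A \<in> SO n \<Longrightarrow> A \<in> sqmats n"
  by (simp add: SO_def)

lemma form_mat_square: "form_mat n * form_mat n = (1\<^sub>m (2*n) :: 'a::field mat)"
proof (rule eq_matI)
  fix i j assume "i < dim_row (1\<^sub>m (2*n) :: 'a mat)" "j < dim_col (1\<^sub>m (2*n) :: 'a mat)"
  then show "((form_mat n :: 'a mat) * form_mat n) $$ (i, j) = 1\<^sub>m (2*n) $$ (i, j)"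
    by (simp add: form_mat_mult_index[OF form_mat_carrier] form_mat_index del: index_mult_mat(1))
qed (auto simp: form_mat_def)

lemma adj_eq:
  assumes "A \<in> sqmats n"
  shows "adj n A = form_mat n * transpose_mat A * form_mat n"
proof (rule eq_matI)
  fix i j
  assume "i < dim_row (form_mat n * transpose_mat A * form_mat n)"
    "j < dim_col (form_mat n * transpose_mat A * form_mat n)"
  then have ij: "i < 2*n" "j < 2*n" by (auto simp: form_mat_def)
  have c: "form_mat n * transpose_mat A \<in> sqmats n"
    using assms by (intro mult_carrier_mat) auto
  show "adj n A $$ (i, j) = (form_mat n * transpose_mat A * form_mat n) $$ (i, j)"
    using assms ij
    by (simp add: mult_form_mat_index[OF c] form_mat_mult_index adj_index del: index_mult_mat(1))
qed (auto simp: form_mat_def adj_def)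

lemma SO_adj_left:
  assumes "A \<in> SO n"
  shows "adj n A * A = 1\<^sub>m (2*n)"
proof -
  note [simp] = SO_carrier[OF assms]
  have "adj n A * A = form_mat n * (transpose_mat A * form_mat n * A)"
    unfolding adj_eq[OF SO_carrier[OF assms]]
    by (simp add: square_assoc[where n=n])
  then show ?thesis using assms by (simp add: SO_def form_mat_square)
qed

lemma SO_adj_right:
  assumes "A \<in> SO n"
  shows "A * adj n A = 1\<^sub>m (2*n)"
  by (rule mat_mult_left_right_inverse[OF adj_carrier SO_carrier[OF assms] SO_adj_left[OF assms]])

lemma SO_mult:
  assumes "A \<in> SO n" "B \<in> SO n"
  shows "A * B \<in> SO n"
proof -
  note [simp] = SO_carrier[OF assms(1)] SO_carrier[OF assms(2)]
  have "transpose_mat (A * B) * form_mat n * (A * B)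
    = transpose_mat B * (transpose_mat A * form_mat n * A) * B"
    by (simp add: transpose_mult[of A "2*n" "2*n" B "2*n"]
        square_assoc[where n=n])
  also have "\<dots> = form_mat n" using assms by (simp add: SO_def)
  finally show ?thesis using assms
    by (simp add: SO_def det_mult[of A "2*n" B] square_mult_carrier[of _ "2*n"])
qed

lemma SO_adj:
  assumes "A \<in> SO n"
  shows "adj n A \<in> SO n"
proof -
  note [simp] = SO_carrier[OF assms]
  have "transpose_mat (adj n A) * form_mat n * adj n A
      = transpose_mat (adj n A) * (transpose_mat A * form_mat n * A) * adj n A"
    using assms by (simp add: SO_def)
  also have "\<dots> = transpose_mat (A * adj n A) * form_mat n * (A * adj n A)"
    by (simp add: transpose_mult[of A "2*n" "2*n" _ "2*n"]
        square_assoc[where n=n])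
  also have "\<dots> = form_mat n" 
    by (simp add: SO_adj_right[OF assms] left_mult_one_mat[OF form_mat_carrier]
        right_mult_one_mat[OF form_mat_carrier])
  finally have 1: "transpose_mat (adj n A) * form_mat n * adj n A = form_mat n" .
  have "Determinant.det (adj n A) * Determinant.det A = 1"
    using det_mult[of "adj n A" "2*n" A] SO_adj_left[OF assms] by simp
  then show ?thesis using 1 assms by (simp add: SO_def)
qed

lemma one_SO: "1\<^sub>m (2*n) \<in> SO n"
  by (simp add: SO_def left_mult_one_mat[OF form_mat_carrier] right_mult_one_mat[OF form_mat_carrier])

lemma adj_lower_unipotent:
  assumes "A \<in> sqmats n" "lower_unipotent A"
  shows "lower_unipotent (adj n A)"
  by (rule lower_unipotentI[OF adj_carrier])
     (use assms in \<open>auto simp: adj_index lower_unipotent_def opp_def\<close>)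

lemma adj_upper_unipotent:
  assumes "A \<in> sqmats n" "upper_unipotent A"
  shows "upper_unipotent (adj n A)"
proof -
  have "transpose_mat (adj n A) = adj n (transpose_mat A)"
    by (rule eq_matI) (use assms in \<open>auto simp: adj_def\<close>)
  then show ?thesis
    using adj_lower_unipotent[of "transpose_mat A" n] assms by (simp add: upper_unipotent_def)
qed

text \<open>This is \<open>A * adj n A = 1\<close> read entrywise: under the form the rows of
  \<open>A\<close> pair like the standard basis. It gives access to entries that are not computed
  directly.\<close>

lemma SO_rows:
  assumes "A \<in> SO n" "i < 2*n" "j < 2*n"
  shows "(\<Sum>k<2*n. A $$ (i, k) * A $$ (j, opp n k)) = (if j = opp n i then 1 else 0)"
proof -
  note c = SO_carrier[OF assms(1)]
  have "(\<Sum>k<2*n. A $$ (i, k) * A $$ (j, opp n k)) = (A * adj n A) $$ (i, opp n j)"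
    unfolding index_mult_sum[OF c adj_carrier assms(2) opp_less[OF assms(3)]]
    by (rule sum.cong) (use assms in \<open>auto simp: adj_index\<close>)
  then show ?thesis unfolding SO_adj_right[OF assms(1)] using assms by (auto simp: opp_eq_swap)
qed

text \<open>Collecting the lower factors on the left and the upper ones on the right gives
  \<open>M * T = T' * U\<close> with \<open>M\<close> lower and \<open>U\<close> upper unipotent.
  The diagonals yield \<open>T = T'\<close>. Above the diagonal \<open>M\<close> vanishes, hence so
  does \<open>U\<close>, the diagonal entries of \<open>T'\<close> being nonzero.\<close>

lemma LDU_unique:
  fixes Y T X Y' T' X' :: "'a::field mat"
  assumes Y: "Y \<in> SO n" "lower_unipotent Y" "Y' \<in> SO n" "lower_unipotent Y'"
    and T: "T \<in> SO n" "diagonal_mat T" "T' \<in> SO n" "diagonal_mat T'"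
    and X: "X \<in> SO n" "upper_unipotent X" "X' \<in> SO n" "upper_unipotent X'"
    and eq: "Y * T * X = Y' * T' * X'"
  shows "T = T'" "X = X'"
proof -
  note c [simp] = SO_carrier[OF Y(1)] SO_carrier[OF Y(3)] SO_carrier[OF T(1)] SO_carrier[OF T(3)]
    SO_carrier[OF X(1)] SO_carrier[OF X(3)]
  note assoc = square_assoc[where n=n]
  define M U where "M = adj n Y' * Y" and "U = X' * adj n X"
  have Mc: "M \<in> sqmats n" and Uc: "U \<in> sqmats n"
    by (auto simp: M_def U_def intro!: square_mult_carrier)
  have Ml: "lower_unipotent M" unfolding M_def
    by (rule lower_unipotent_mult[OF adj_carrier adj_lower_unipotent]) (use Y in auto)
  have Uu: "upper_unipotent U" unfolding U_def
    by (rule upper_unipotent_mult[OF _ _ adj_carrier adj_upper_unipotent]) (use X in auto)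
  have "M * T = adj n Y' * (Y * T * X) * adj n X"
    by (simp add: M_def assoc SO_adj_right[OF X(1)] right_mult_one_mat[of _ "2*n" "2*n"])
  also have "\<dots> = (adj n Y' * Y') * T' * (X' * adj n X)"
    unfolding eq by (simp add: assoc)
  also have "\<dots> = T' * U" by (simp add: SO_adj_left[OF Y(3)] U_def left_mult_one_mat[of _ "2*n" "2*n"])
  finally have MT: "M * T = T' * U" .
  have entry: "M $$ (i, j) * T $$ (j, j) = T' $$ (i, i) * U $$ (i, j)" if ij: "i < 2*n" "j < 2*n" for i j
  proof -
    have "(M * T) $$ (i, j) = (\<Sum>k<2*n. if k = j then M $$ (i, j) * T $$ (j, j) else 0)"
      unfolding index_mult_sum[OF Mc c(3) ij]
      by (rule sum.cong) (use T ij c in \<open>auto simp: diagonal_mat_def\<close>)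
    moreover have "(T' * U) $$ (i, j) = (\<Sum>k<2*n. if k = i then T' $$ (i, i) * U $$ (i, j) else 0)"
      unfolding index_mult_sum[OF c(4) Uc ij]
      by (rule sum.cong) (use T ij c in \<open>auto simp: diagonal_mat_def\<close>)
    ultimately show ?thesis using MT ij by simp
  qed
  have d: "T $$ (i, i) = T' $$ (i, i)" if "i < 2*n" for i
    using entry[OF that that] Ml Uu Mc Uc that by (auto simp: lower_unipotent_def upper_unipotent_def)
  show TT: "T = T'"
  proof (rule eq_matI)
    fix i j assume "i < dim_row T'" "j < dim_col T'"
    then show "T $$ (i, j) = T' $$ (i, j)"
      using d T c by (cases "i = j") (auto simp: diagonal_mat_def)
  qed (use carrier_matD[OF c(3)] carrier_matD[OF c(4)] in simp_all)
  \<comment> \<open>A zero on the diagonal would make a whole row of \<open>T'\<close> vanish, but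
    that row pairs to 1 with the opposite one.\<close>
  have T0: "T' $$ (i, i) \<noteq> 0" if i: "i < 2*n" for i
  proof
    assume 0: "T' $$ (i, i) = 0"
    have "(\<Sum>k<2*n. T' $$ (i, k) * T' $$ (opp n i, opp n k)) = 0"
    proof (rule sum.neutral, rule ballI)
      fix k assume "k \<in> {..<2*n}"
      then show "T' $$ (i, k) * T' $$ (opp n i, opp n k) = 0"
        using 0 T(4) i carrier_matD[OF c(4)] by (cases "k = i") (auto simp: diagonal_mat_def)
    qed
    then show False using SO_rows[OF T(3) i, of "opp n i"] i by simp
  qed
  have "U = 1\<^sub>m (2*n)"
  proof (rule eq_matI)
    fix i j assume "i < dim_row (1\<^sub>m (2*n) :: 'a mat)" "j < dim_col (1\<^sub>m (2*n) :: 'a mat)"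
    then have ij: "i < 2*n" "j < 2*n" by auto
    show "U $$ (i, j) = 1\<^sub>m (2*n) $$ (i, j)"
    proof (cases i j rule: linorder_cases)
      case less
      then have "M $$ (i, j) = 0" using Ml Mc ij by (auto simp: lower_unipotent_def)
      then show ?thesis using entry[OF ij] T0[OF ij(1)] less ij by simp
    next
      case greater
      then show ?thesis using Uu Uc ij by (auto simp: upper_unipotent_def lower_unipotent_def)
    qed (use Uu Uc ij in \<open>auto simp: upper_unipotent_def lower_unipotent_def\<close>)
  qed (use Uc in auto)
  then have "X' * (adj n X * X) = 1\<^sub>m (2*n) * X"
    unfolding U_def by (simp add: assoc_mult_mat[OF c(6) adj_carrier c(5), symmetric])
  then show "X = X'"
    by (simp add: SO_adj_left[OF X(1)] left_mult_one_mat[OF c(5)] right_mult_one_mat[OF c(6)])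
qed

lemma transpose_root_mat: "transpose_mat (root_mat n a b c) = root_mat n b a c"
proof (rule eq_matI)
  fix i j assume "i < dim_row (root_mat n b a c)" "j < dim_col (root_mat n b a c)"
  then show "transpose_mat (root_mat n a b c) $$ (i, j) = root_mat n b a c $$ (i, j)"
    by (simp add: root_mat_index conj_commute eq_commute[of i j])
qed auto

lemma root_mat_upper_unipotent:
  assumes "a < b" "b < 2*n"
  shows "upper_unipotent (root_mat n a b c)"
  unfolding upper_unipotent_def transpose_root_mat
  by (rule lower_unipotentI[OF root_mat_carrier])
     (use assms in \<open>auto simp: root_mat_def opp_def\<close>)

lemma root_mat_inverse:
  fixes c :: "'a::field"
  assumes ab: "a < 2*n" "b < 2*n" "a \<noteq> b" "a \<noteq> opp n b"
  shows "root_mat n a b (-c) * root_mat n a b c = 1\<^sub>m (2*n)"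
proof (rule eq_matI)
  fix i j assume "i < dim_row (1\<^sub>m (2*n) :: 'a mat)" "j < dim_col (1\<^sub>m (2*n) :: 'a mat)"
  then have ij: "i < 2*n" "j < 2*n" by auto
  have "root_mat n a b (-c) $$ (i, a) = (if i = a then 1 else 0)"
    using ab ij by (auto simp: root_mat_index)
  moreover have "root_mat n a b (-c) $$ (i, opp n b) = (if i = opp n b then 1 else 0)"
    using ab ij by (auto simp: root_mat_index)
  ultimately show "(root_mat n a b (-c) * root_mat n a b c) $$ (i, j) = 1\<^sub>m (2*n) $$ (i, j)"
    unfolding mult_root_mat_index[OF root_mat_carrier ab(1,2) ij]
    using ij ab opp_eq_swap[OF ab(1,2)] by (simp add: root_mat_index)
qed auto

text \<open>The form intertwines the transpose \<open>root_mat n b a c\<close> with the inverse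
  \<open>root_mat n a b (-c)\<close>. The determinant is 1 because the matrix or its transpose is
  upper unipotent.\<close>

lemma root_mat_SO:
  assumes ab: "a < 2*n" "b < 2*n" "a \<noteq> b" "a \<noteq> opp n b"
  shows "root_mat n a b c \<in> SO n"
proof -
  have "root_mat n b a c * form_mat n = form_mat n * root_mat n a b (-c)" (is "?L = ?R")
  proof (rule eq_matI)
    fix i j assume "i < dim_row ?R" "j < dim_col ?R"
    then have ij: "i < 2*n" "j < 2*n" by (auto simp: form_mat_def)
    have e: "i = opp n j \<longleftrightarrow> opp n i = j"
      by (rule trans[OF opp_eq_swap[OF ij] eq_commute])
    have e': "i = b \<and> opp n j = a \<longleftrightarrow> opp n i = opp n b \<and> j = opp n a"
      unfolding opp_eq_iff[OF ij(1) ab(2)] eq_commute[of "opp n j" a] opp_eq_swap[OF ab(1) ij(2)] ..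
    have e'': "i = opp n a \<and> opp n j = opp n b \<longleftrightarrow> opp n i = a \<and> j = b"
      unfolding opp_eq_iff[OF ij(2) ab(2)] opp_eq_swap[OF ij(1) ab(1)] eq_commute[of a "opp n i"] ..
    have if_swap: "(if P then 1 else 0) + (if Q then c else 0) - (if R then c else 0)
      = (if P then 1 else 0) + (if R then - c else 0) - (if Q then - c else 0)" for P Q R
      by simp
    show "?L $$ (i, j) = ?R $$ (i, j)"
      unfolding mult_form_mat_index[OF root_mat_carrier ij] form_mat_mult_index[OF root_mat_carrier ij]
        root_mat_index[OF ij(1) opp_less[OF ij(2)]] root_mat_index[OF opp_less[OF ij(1)] ij(2)] e e' e''
      by (rule if_swap)
  qed (auto simp: form_mat_def)
  then have "transpose_mat (root_mat n a b c) * form_mat n * root_mat n a b c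
    = form_mat n * (root_mat n a b (-c) * root_mat n a b c)"
    by (simp add: transpose_root_mat square_assoc[where n=n])
  then have "transpose_mat (root_mat n a b c) * form_mat n * root_mat n a b c = form_mat n"
    by (simp add: root_mat_inverse[OF ab] right_mult_one_mat[OF form_mat_carrier])
  moreover have "Determinant.det (root_mat n a b c) = 1"
  proof (cases "a < b")
    case True
    then show ?thesis
      using upper_unipotent_det[OF root_mat_carrier root_mat_upper_unipotent] ab by blast
  next
    case False
    then have "upper_unipotent (root_mat n b a c)" using ab by (intro root_mat_upper_unipotent) auto
    from upper_unipotent_det[OF root_mat_carrier this]
    show ?thesis using det_transpose[OF root_mat_carrier[of n b a c]] by (simp add: transpose_root_mat)
  qed
  ultimately show ?thesis by (simp add: SO_def)
qed

section \<open>The products of exponentials\<close>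

definition nil_mat :: "nat \<Rightarrow> nat \<Rightarrow> nat \<Rightarrow> 'a::field \<Rightarrow> 'a mat" where
  "nil_mat n a b c = Matrix.mat (2*n) (2*n) (\<lambda>(i, j).
     (if i = a \<and> j = b then c else 0) - (if i = opp n b \<and> j = opp n a then c else 0))"

lemma nil_mat_carrier [simp]: "nil_mat n a b c \<in> sqmats n"
  by (simp add: nil_mat_def)

lemma nil_mat_square:
  assumes "a < 2*n" "b < 2*n" "a \<noteq> b" "a \<noteq> opp n b"
  shows "nil_mat n a b c * nil_mat n a b c = 0\<^sub>m (2*n) (2*n)"
proof (rule eq_matI)
  fix i j assume "i < dim_row (0\<^sub>m (2*n) (2*n) :: 'a mat)" "j < dim_col (0\<^sub>m (2*n) (2*n) :: 'a mat)"
  then have ij: "i < 2*n" "j < 2*n" by auto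
  have "opp n a \<noteq> opp n b" "opp n a \<noteq> a" "opp n b \<noteq> b" "opp n a \<noteq> b"
    using assms opp_eq_swap[OF assms(1,2)] by auto
  then have "nil_mat n a b c $$ (i, k) * nil_mat n a b c $$ (k, j) = 0" if "k < 2*n" for k
    using that ij assms by (cases "k = b \<or> k = opp n a") (auto simp: nil_mat_def)
  then show "(nil_mat n a b c * nil_mat n a b c) $$ (i, j) = 0\<^sub>m (2*n) (2*n) $$ (i, j)"
    unfolding index_mult_sum[OF nil_mat_carrier nil_mat_carrier ij] using ij
    by (auto intro!: sum.neutral)
qed (auto simp: nil_mat_def)

text \<open>Only the terms \<open>k = 0\<close> and \<open>k = 1\<close> survive, and
  \<open>N \<ge> 2\<close> ensures that the truncated series contains both.\<close>

lemma nilp_exp_square_zero: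
  assumes A: "A \<in> carrier_mat N N" "N \<ge> 2" "A * A = 0\<^sub>m N N"
  shows "nilp_exp A = 1\<^sub>m N + A"
proof -
  have z: "A ^\<^sub>m (k + 2) = 0\<^sub>m N N" for k
  proof (induction k)
    case 0
    then show ?case using A by (simp add: numeral_2_eq_2 left_mult_one_mat[of A N N])
  next
    case (Suc k)
    then show ?case using A(1) by simp
  qed
  show ?thesis
  proof (rule eq_matI)
    fix i j assume "i < dim_row (1\<^sub>m N + A)" "j < dim_col (1\<^sub>m N + A)"
    then have ij: "i < N" "j < N" using A by auto
    have "nilp_exp A $$ (i, j) = (\<Sum>k<N. (A ^\<^sub>m k) $$ (i, j) / of_nat (fact k))"
      using A ij by (simp add: nilp_exp_def)
    also have "\<dots> = (\<Sum>k<2. (A ^\<^sub>m k) $$ (i, j) / of_nat (fact k))"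
    proof (rule sum.mono_neutral_right)
      show "\<forall>k\<in>{..<N} - {..<2}. (A ^\<^sub>m k) $$ (i, j) / of_nat (fact k) = 0"
      proof
        fix k assume "k \<in> {..<N} - {..<2}"
        then have "k = (k - 2) + 2" by auto
        then show "(A ^\<^sub>m k) $$ (i, j) / of_nat (fact k) = 0" using z[of "k - 2"] ij by simp
      qed
    qed (use A in auto)
    also have "\<dots> = (1\<^sub>m N + A) $$ (i, j)"
      using A ij by (simp add: numeral_2_eq_2 left_mult_one_mat[of A N N])
    finally show "nilp_exp A $$ (i, j) = (1\<^sub>m N + A) $$ (i, j)" .
  qed (use A in \<open>auto simp: nilp_exp_def\<close>)
qed

lemma nilp_exp_nil_mat:
  assumes "a < 2*n" "b < 2*n" "a \<noteq> b" "a \<noteq> opp n b"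
  shows "nilp_exp (nil_mat n a b c) = root_mat n a b c"
  unfolding nilp_exp_square_zero[OF nil_mat_carrier _ nil_mat_square[OF assms]]
  using assms
  by (subst nilp_exp_square_zero[OF nil_mat_carrier _ nil_mat_square[OF assms]])
     (auto simp: root_mat_def nil_mat_def intro!: eq_matI)

text \<open>With \<open>dst\<close>, the row and column, counted from 0, of the first matrix unit of
  \<open>gen_e\<close>; applying \<open>opp\<close> to both and exchanging them gives the second
  unit.\<close>

fun src :: "nat \<Rightarrow> gen \<Rightarrow> nat" where
  "src n (Simple m) = m - 1"
| "src n (Spin \<sigma>) = n - 2"

fun dst :: "nat \<Rightarrow> gen \<Rightarrow> nat" where
  "dst n (Simple m) = m"
| "dst n (Spin \<sigma>) = (if \<sigma> = 1 then n - 1 else n)"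

fun valid_gen :: "nat \<Rightarrow> gen \<Rightarrow> bool" where
  "valid_gen n (Simple m) \<longleftrightarrow> 1 \<le> m \<and> m + 2 \<le> n"
| "valid_gen n (Spin \<sigma>) \<longleftrightarrow> n \<ge> 2"

lemma valid_gen_src_dst:
  assumes "valid_gen n g"
  shows "src n g < dst n g" "src n g < 2*n" "dst n g < 2*n" "src n g \<noteq> dst n g"
    "dst n g \<noteq> src n g" "src n g \<noteq> opp n (dst n g)" "dst n g \<noteq> opp n (src n g)" "n \<ge> 2"
  using assms by (cases g; auto simp: opp_def)+

lemma if_diff: "c * ((if P then 1 else 0) - (if Q then 1 else 0)) = (if P then c else 0) - (if Q then c else (0::'a::ring_1))"
  by simp

lemma nil_mat_munit:
  fixes c :: "'a::field"
  shows
  "nil_mat n a b c = c \<cdot>\<^sub>m (munit n (Suc a) (Suc b) - munit n (Suc (opp n b)) (Suc (opp n a)))"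
proof (rule eq_matI)
  let ?R = "c \<cdot>\<^sub>m (munit n (Suc a) (Suc b) - munit n (Suc (opp n b)) (Suc (opp n a)))"
  fix i j assume "i < dim_row ?R" "j < dim_col ?R"
  then have ij: "i < 2*n" "j < 2*n" by (simp_all add: munit_def)
  have m: "munit n (Suc x) (Suc y) $$ (i, j) = (if i = x \<and> j = y then 1 else (0::'a))" for x y
    using ij by (simp add: munit_def)
  have "?R $$ (i, j) = c * (munit n (Suc a) (Suc b) $$ (i, j) - munit n (Suc (opp n b)) (Suc (opp n a)) $$ (i, j))"
    using ij by (simp add: munit_def)
  also have "\<dots> = (if i = a \<and> j = b then c else 0) - (if i = opp n b \<and> j = opp n a then c else 0)"
    unfolding m by (rule if_diff)
  finally show "nil_mat n a b c $$ (i, j) = ?R $$ (i, j)"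
    using ij by (simp only: nil_mat_def index_mat split)
qed (simp_all add: nil_mat_def munit_def)

lemma gen_eq_munit:
  assumes "valid_gen n g"
  shows "gen_e n g = munit n (Suc (src n g)) (Suc (dst n g))
      - munit n (Suc (opp n (dst n g))) (Suc (opp n (src n g))) \<and>
    gen_f n g = munit n (Suc (dst n g)) (Suc (src n g))
      - munit n (Suc (opp n (src n g))) (Suc (opp n (dst n g)))"
proof (cases g)
  case (Simple m)
  then have "Suc (m - 1) = m" "Suc (opp n m) = 2*n - m" "Suc (opp n (m - 1)) = 2*n + 1 - m"
    using assms by (auto simp: opp_def)
  with Simple show ?thesis
    by (simp only: gen_e.simps gen_f.simps src.simps dst.simps Suc_eq_plus1)
next
  case (Spin \<sigma>)
  then have "Suc (n - 2) = n - 1" "Suc (n - 1) = n" "Suc (opp n (n - 1)) = n + 1" "Suc (opp n n) = n"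
    "Suc (opp n (n - 2)) = n + 2" "Suc n = n + 1"
    using assms by (auto simp: opp_def)
  with Spin show ?thesis
    by (cases "\<sigma> = 1") (simp_all only: gen_e.simps gen_f.simps src.simps dst.simps if_True if_False simp_thms)
qed

lemma gen_e_eq:
  assumes "valid_gen n g"
  shows "c \<cdot>\<^sub>m gen_e n g = nil_mat n (src n g) (dst n g) c"
  unfolding nil_mat_munit gen_eq_munit[OF assms, THEN conjunct1] ..

lemma gen_e_eq1:
  assumes "valid_gen n g"
  shows "gen_e n g = nil_mat n (src n g) (dst n g) 1"
  unfolding nil_mat_munit gen_eq_munit[OF assms, THEN conjunct1] by (rule eq_matI) (simp_all add: munit_def)

lemma gen_f_eq:
  assumes "valid_gen n g"
  shows "- gen_f n g = nil_mat n (dst n g) (src n g) (-1)"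
  unfolding nil_mat_munit gen_eq_munit[OF assms, THEN conjunct2] by (rule eq_matI) (simp_all add: munit_def)

lemma nilp_exp_gen_e:
  assumes "valid_gen n g"
  shows "nilp_exp (c \<cdot>\<^sub>m gen_e n g) = root_mat n (src n g) (dst n g) c"
  unfolding gen_e_eq[OF assms] by (rule nilp_exp_nil_mat) (use valid_gen_src_dst[OF assms] in auto)

text \<open>The lift of a simple reflection to the group. It acts on columns as a signed
  permutation, see \<open>ent_mult_weyl\<close>.\<close>

definition weyl_mat :: "nat \<Rightarrow> nat \<Rightarrow> nat \<Rightarrow> 'a::field mat" where
  "weyl_mat n a b = root_mat n a b 1 * root_mat n b a (-1) * root_mat n a b 1"

lemma nilp_exp_gen_w:
  assumes "valid_gen n g"
  shows "nilp_exp (gen_e n g) * nilp_exp (- gen_f n g) * nilp_exp (gen_e n g)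
    = weyl_mat n (src n g) (dst n g)"
  unfolding gen_e_eq1[OF assms] gen_f_eq[OF assms] weyl_mat_def
  using valid_gen_src_dst[OF assms] by (simp add: nilp_exp_nil_mat)

section \<open>The factors \<open>R_i\<close> and the partial products of \<open>X\<close> and of
  the Weyl element\<close>

definition R_mat :: "nat \<Rightarrow> (nat \<Rightarrow> nat \<Rightarrow> 'a::field) \<Rightarrow> (nat \<Rightarrow> nat \<Rightarrow> 'a) \<Rightarrow> nat \<Rightarrow> 'a mat" where
  "R_mat n t s i =
     mat_prod n (map (\<lambda>(c, g). root_mat n (src n g) (dst n g) c) (R_word n t s i))"

definition wR_mat :: "nat \<Rightarrow> nat \<Rightarrow> 'a::field mat" where
  "wR_mat n i = mat_prod n (map (\<lambda>(c, g). weyl_mat n (src n g) (dst n g))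
     (R_word n (\<lambda>i j. 0 :: 'a) (\<lambda>i j. 0) i))"

definition X_part :: "nat \<Rightarrow> (nat \<Rightarrow> nat \<Rightarrow> 'a::field) \<Rightarrow> (nat \<Rightarrow> nat \<Rightarrow> 'a) \<Rightarrow> nat \<Rightarrow> 'a mat" where
  "X_part n t s i = mat_prod n (map (R_mat n t s) (rev [i..<n]))"

definition w_part :: "nat \<Rightarrow> nat \<Rightarrow> 'a::field mat" where
  "w_part n i = mat_prod n (map (wR_mat n) (rev [i..<n]))"

lemma mat_prod_simps [simp]:
  "mat_prod n [] = 1\<^sub>m (2*n)" "mat_prod n (A # As) = A * mat_prod n As"
  by (simp_all add: mat_prod_def)

lemma mat_prod_carrier:
  assumes "set As \<subseteq> sqmats n"
  shows "mat_prod n As \<in> sqmats n"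
  using assms by (induction As) (auto intro!: square_mult_carrier)

lemma mat_prod_append:
  assumes "set As \<subseteq> sqmats n" "set Bs \<subseteq> sqmats n"
  shows "mat_prod n (As @ Bs) = mat_prod n As * mat_prod n Bs"
  using assms
proof (induction As)
  case Nil
  then show ?case
    using mat_prod_carrier[of Bs n] by (simp add: left_mult_one_mat[of _ "2*n" "2*n"])
next
  case (Cons A As)
  then have "mat_prod n (A # As @ Bs) = A * (mat_prod n As * mat_prod n Bs)"
    by simp
  also have "\<dots> = A * mat_prod n As * mat_prod n Bs"
    using Cons.prems mat_prod_carrier[of As n] mat_prod_carrier[of Bs n]
    by (intro assoc_mult_mat[symmetric, of _ "2*n" "2*n" _ "2*n" _ "2*n"]) auto
  finally show ?case by simp
qed

lemma mat_prod_single: "A \<in> sqmats n \<Longrightarrow> mat_prod n [A] = A"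
  by (simp add: right_mult_one_mat[of _ "2*n" "2*n"])

lemma mat_prod_concat:
  assumes "\<And>As. As \<in> set Ass \<Longrightarrow> set As \<subseteq> sqmats n"
  shows "mat_prod n (concat Ass) = mat_prod n (map (mat_prod n) Ass)"
  using assms
proof (induction Ass)
  case (Cons As Ass)
  have "set As \<subseteq> sqmats n" "set (concat Ass) \<subseteq> sqmats n"
    using Cons.prems by fastforce+
  then have "mat_prod n (concat (As # Ass)) = mat_prod n As * mat_prod n (concat Ass)"
    by (simp add: mat_prod_append)
  also have "mat_prod n (concat Ass) = mat_prod n (map (mat_prod n) Ass)"
    using Cons by auto
  finally show ?case by simp
qed simp

lemma mat_prod_closed:
  assumes "set As \<subseteq> SO n"
  shows "mat_prod n As \<in> SO n"
  using assms by (induction As) (auto intro: SO_mult one_SO)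

lemma upper_unipotent_one: "upper_unipotent (1\<^sub>m N)"
  by (simp add: upper_unipotent_def lower_unipotent_def)

lemma mat_prod_upper:
  assumes "\<And>A. A \<in> set As \<Longrightarrow> A \<in> SO n \<and> upper_unipotent A"
  shows "upper_unipotent (mat_prod n As)"
  using assms
proof (induction As)
  case (Cons A As)
  then show ?case
    using upper_unipotent_mult[of A "2*n" "mat_prod n As"] mat_prod_closed[of As n]
    by (auto intro: SO_carrier)
qed (simp add: upper_unipotent_one)

lemma R_word_valid:
  assumes "1 \<le> i" "i < n" "(c, g) \<in> set (R_word n t s i)"
  shows "valid_gen n g"
  using assms by (auto simp: R_word_def)

lemma weyl_mat_SO:
  assumes "a < 2*n" "b < 2*n" "a \<noteq> b" "a \<noteq> opp n b"
  shows "weyl_mat n a b \<in> SO n"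
  unfolding weyl_mat_def using assms opp_eq_swap[OF assms(1,2)]
  by (intro SO_mult root_mat_SO) auto

lemma R_mat_SO:
  assumes "1 \<le> i" "i < n"
  shows "R_mat n t s i \<in> SO n"
  unfolding R_mat_def
  using R_word_valid[OF assms] valid_gen_src_dst by (intro mat_prod_closed) (fastforce intro!: root_mat_SO)

lemma R_mat_upper:
  assumes "1 \<le> i" "i < n"
  shows "upper_unipotent (R_mat n t s i)"
  unfolding R_mat_def
  using R_word_valid[OF assms] valid_gen_src_dst
  by (intro mat_prod_upper) (fastforce intro!: root_mat_SO root_mat_upper_unipotent)

lemma wR_mat_SO:
  assumes "1 \<le> i" "i < n"
  shows "wR_mat n i \<in> SO n"
  unfolding wR_mat_def
  using R_word_valid[OF assms] valid_gen_src_dst by (intro mat_prod_closed) (fastforce intro!: weyl_mat_SO)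

lemma X_part_SO: "1 \<le> i \<Longrightarrow> X_part n t s i \<in> SO n"
  unfolding X_part_def by (rule mat_prod_closed) (auto intro: R_mat_SO)

lemma X_part_upper: "1 \<le> i \<Longrightarrow> upper_unipotent (X_part n t s i)"
  unfolding X_part_def by (rule mat_prod_upper) (auto intro: R_mat_SO R_mat_upper)

lemma w_part_SO: "1 \<le> i \<Longrightarrow> w_part n i \<in> SO n"
  unfolding w_part_def by (rule mat_prod_closed) (auto intro: wR_mat_SO)

lemma X_part_rec:
  assumes "1 \<le> i" "i < n"
  shows "X_part n t s i = X_part n t s (Suc i) * R_mat n t s i"
proof -
  have "rev [i..<n] = rev [Suc i..<n] @ [i]" using assms by (simp add: upt_conv_Cons)
  then have "X_part n t s i = mat_prod n (map (R_mat n t s) (rev [Suc i..<n]) @ [R_mat n t s i])"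
    by (simp add: X_part_def)
  also have "\<dots> = X_part n t s (Suc i) * mat_prod n [R_mat n t s i]"
    unfolding X_part_def by (rule mat_prod_append) (use assms in \<open>auto intro!: SO_carrier R_mat_SO\<close>)
  finally show ?thesis using mat_prod_single[OF SO_carrier[OF R_mat_SO[OF assms, of t s]]] by simp
qed

lemma w_part_rec:
  assumes "1 \<le> i" "i < n"
  shows "w_part n i = w_part n (Suc i) * wR_mat n i"
proof -
  have "rev [i..<n] = rev [Suc i..<n] @ [i]" using assms by (simp add: upt_conv_Cons)
  then have "w_part n i = mat_prod n (map (wR_mat n) (rev [Suc i..<n]) @ [wR_mat n i])"
    by (simp add: w_part_def)
  also have "\<dots> = w_part n (Suc i) * mat_prod n [wR_mat n i]"
    unfolding w_part_def by (rule mat_prod_append) (use assms in \<open>auto intro!: SO_carrier wR_mat_SO\<close>)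
  finally show ?thesis by (simp only: mat_prod_single[OF SO_carrier[OF wR_mat_SO[OF assms]]])
qed

lemma X_part_top: "X_part n t s n = 1\<^sub>m (2*n)"
  by (simp add: X_part_def mat_prod_def)

lemma w_part_top: "w_part n n = 1\<^sub>m (2*n)"
  by (simp add: w_part_def mat_prod_def)

lemma X_mat_eq: "X_mat n t s = X_part n t s 1"
proof -
  have v: "valid_gen n g" if "(c, g) \<in> set (R_word n t s i)" "Suc 0 \<le> i" "i < n" for c g i
    using R_word_valid[of i n c g t s] that by simp
  have "map (\<lambda>(c, g). nilp_exp (c \<cdot>\<^sub>m gen_e n g)) (X_word n t s)
    = concat (map (\<lambda>i. map (\<lambda>(c, g). root_mat n (src n g) (dst n g) c) (R_word n t s i)) (rev [1..<n]))"
    by (auto simp: X_word_def map_concat comp_def intro!: arg_cong[where f=concat] nilp_exp_gen_e v)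
  then show ?thesis
    unfolding X_mat_def by (simp only:, subst mat_prod_concat)
      (auto simp: X_part_def R_mat_def[abs_def] comp_def)
qed

lemma w0_mat_eq: "w0_mat n = (w_part n 1 :: 'a::field mat)"
proof -
  have v: "valid_gen n g" if "(c :: 'a, g) \<in> set (R_word n (\<lambda>i j. 0) (\<lambda>i j. 0) i)" "Suc 0 \<le> i" "i < n" for c g i
    using R_word_valid[of i n c g "\<lambda>i j. 0" "\<lambda>i j. 0"] that by simp
  have "map (\<lambda>(c, g). nilp_exp (gen_e n g) * nilp_exp (- gen_f n g) * nilp_exp (gen_e n g))
      (X_word n (\<lambda>i j. 0 :: 'a) (\<lambda>i j. 0))
    = concat (map (\<lambda>i. map (\<lambda>(c, g). weyl_mat n (src n g) (dst n g) :: 'a mat)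
        (R_word n (\<lambda>i j. 0 :: 'a) (\<lambda>i j. 0) i)) (rev [1..<n]))"
    by (auto simp: X_word_def map_concat comp_def intro!: arg_cong[where f=concat] nilp_exp_gen_w v)
  moreover have "weyl_mat n a b \<in> sqmats n" for a b
    by (auto simp: weyl_mat_def intro!: square_mult_carrier)
  ultimately show ?thesis
    unfolding w0_mat_def by (simp only:, subst mat_prod_concat)
      (auto simp: w_part_def wR_mat_def[abs_def] comp_def)
qed

section \<open>Labels for the rows and columns\<close>

text \<open>With \<open>n = N + 1\<close>, \<open>Up k\<close> and \<open>Dn k\<close> stand for the
  indices \<open>k\<close> and \<open>hat n k\<close>, \<open>k \<le> N\<close>. Which of the two
  central indices is called \<open>Ca\<close> depends on a flag \<open>e\<close>; tying
  \<open>e\<close> to the parity of \<open>n - i\<close> gives the entries of \<open>R_i\<close> by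
  one formula for both parities.\<close>

datatype lab = Up nat | Ca | Cb | Dn nat

fun lopp :: "lab \<Rightarrow> lab" where
  "lopp (Up k) = Dn k" | "lopp Ca = Cb" | "lopp Cb = Ca" | "lopp (Dn k) = Up k"

fun lab_pos :: "nat \<Rightarrow> bool \<Rightarrow> lab \<Rightarrow> nat" where
  "lab_pos N e (Up k) = k - 1"
| "lab_pos N e Ca = (if e then N else Suc N)"
| "lab_pos N e Cb = (if e then Suc N else N)"
| "lab_pos N e (Dn k) = 2 * N + 2 - k"

fun vlab :: "nat \<Rightarrow> lab \<Rightarrow> bool" where
  "vlab N (Up k) \<longleftrightarrow> 1 \<le> k \<and> k \<le> N" | "vlab N Ca \<longleftrightarrow> True" | "vlab N Cb \<longleftrightarrow> True"
| "vlab N (Dn k) \<longleftrightarrow> 1 \<le> k \<and> k \<le> N"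

lemma lopp_lopp [simp]: "lopp (lopp x) = x"
  by (cases x) auto

lemma vlab_lopp [simp]: "vlab N (lopp x) = vlab N x"
  by (cases x) auto

lemma pos_less: "vlab N x \<Longrightarrow> lab_pos N e x < 2 * Suc N"
  by (cases x) auto

lemma pos_lopp: "vlab N x \<Longrightarrow> lab_pos N e (lopp x) = opp (Suc N) (lab_pos N e x)"
  by (cases x) (auto simp: opp_def)

lemma pos_eq_iff: "vlab N x \<Longrightarrow> vlab N y \<Longrightarrow> lab_pos N e x = lab_pos N e y \<longleftrightarrow> x = y"
  by (cases x; cases y) auto

lemma pos_surj:
  assumes "a < 2 * Suc N"
  obtains x where "vlab N x" "lab_pos N e x = a"
proof -
  consider "a < N" | "a = N" | "a = Suc N" | "a > Suc N" by linarith
  then show ?thesis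
  proof cases
    case 1 then show ?thesis by (intro that[of "Up (Suc a)"]) auto
  next
    case 2 then show ?thesis by (intro that[of "if e then Ca else Cb"]) auto
  next
    case 3 then show ?thesis by (intro that[of "if e then Cb else Ca"]) auto
  next
    case 4 then show ?thesis using assms by (intro that[of "Dn (2 * N + 2 - a)"]) auto
  qed
qed

definition ent :: "nat \<Rightarrow> bool \<Rightarrow> 'a mat \<Rightarrow> lab \<Rightarrow> lab \<Rightarrow> 'a" where
  "ent N e M x y = M $$ (lab_pos N e x, lab_pos N e y)"

lemma ent_mult_root:
  assumes "M \<in> sqmats (Suc N)" "vlab N a" "vlab N b" "vlab N x" "vlab N y"
  shows "ent N e (M * root_mat (Suc N) (lab_pos N e a) (lab_pos N e b) c) x y =
    ent N e M x y + (if y = b then c * ent N e M x a else 0)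
      - (if y = lopp a then c * ent N e M x (lopp b) else 0)"
  unfolding ent_def
  by (subst mult_root_mat_index)
     (use assms in \<open>auto simp: pos_less pos_lopp[symmetric] pos_eq_iff simp del: mult_Suc_right\<close>)

lemma ent_mult_weyl:
  assumes "M \<in> sqmats (Suc N)" "vlab N a" "vlab N b" "vlab N x" "vlab N y"
    and ab: "a \<noteq> b" "a \<noteq> lopp b"
  shows "ent N e (M * weyl_mat (Suc N) (lab_pos N e a) (lab_pos N e b)) x y =
    (if y = b then ent N e M x a else if y = a then - ent N e M x b
     else if y = lopp a then - ent N e M x (lopp b) else if y = lopp b then ent N e M x (lopp a)
     else ent N e M x y)"
proof -
  let ?p = "lab_pos N e"
  have ne: "lopp a \<noteq> a" "lopp b \<noteq> b" "lopp a \<noteq> b" "lopp b \<noteq> a" "lopp a \<noteq> lopp b" "b \<noteq> a" "b \<noteq> lopp a"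
    "a \<noteq> lopp a" "b \<noteq> lopp b" "lopp b \<noteq> lopp a"
    using ab by (cases a; cases b; auto)+
  have c: "M * root_mat (Suc N) (?p a) (?p b) 1 \<in> sqmats (Suc N)"
    "M * root_mat (Suc N) (?p a) (?p b) 1 * root_mat (Suc N) (?p b) (?p a) (-1)
      \<in> sqmats (Suc N)"
    by (intro square_mult_carrier assms root_mat_carrier)+
  have "M * weyl_mat (Suc N) (?p a) (?p b) = M * root_mat (Suc N) (?p a) (?p b) 1
      * root_mat (Suc N) (?p b) (?p a) (-1) * root_mat (Suc N) (?p a) (?p b) 1"
    unfolding weyl_mat_def using assms(1) by (simp add: square_assoc[where n="Suc N"] del: mult_Suc_right)
  then show ?thesis
    using assms ne ab by (simp add: ent_mult_root c del: mult_Suc_right)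
qed

definition lab_prod :: "nat \<Rightarrow> bool \<Rightarrow> ('a::field \<times> lab \<times> lab) list \<Rightarrow> 'a mat" where
  "lab_prod N e w =
    mat_prod (Suc N) (map (\<lambda>(c, a, b). root_mat (Suc N) (lab_pos N e a) (lab_pos N e b) c) w)"

lemma lab_prod_carrier: "lab_prod N e w \<in> sqmats (Suc N)"
  unfolding lab_prod_def by (rule mat_prod_carrier) auto

lemma ent_lab_prod_snoc:
  assumes "vlab N a" "vlab N b" "vlab N x" "vlab N y"
  shows "ent N e (lab_prod N e (w @ [(c, a, b)])) x y = ent N e (lab_prod N e w) x y
     + (if y = b then c * ent N e (lab_prod N e w) x a else 0)
     - (if y = lopp a then c * ent N e (lab_prod N e w) x (lopp b) else 0)"
proof -
  have "lab_prod N e (w @ [(c, a, b)]) = lab_prod N e w * root_mat (Suc N) (lab_pos N e a) (lab_pos N e b) c"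
    unfolding lab_prod_def map_append
    by (subst mat_prod_append)
       (auto simp: right_mult_one_mat[OF root_mat_carrier] simp del: mult_Suc_right)
  then show ?thesis by (simp only: ent_mult_root[OF lab_prod_carrier assms])
qed

lemma ent_one:
  assumes "vlab N x" "vlab N y"
  shows "ent N e (1\<^sub>m (2 * Suc N)) x y = (if x = y then 1 else 0)"
  using assms pos_less[of N x e] pos_less[of N y e] by (simp add: ent_def pos_eq_iff del: mult_Suc_right)

definition lab_wprod :: "nat \<Rightarrow> bool \<Rightarrow> (lab \<times> lab) list \<Rightarrow> 'a::field mat" where
  "lab_wprod N e w = mat_prod (Suc N) (map (\<lambda>(a, b). weyl_mat (Suc N) (lab_pos N e a) (lab_pos N e b)) w)"

lemma weyl_mat_carrier: "weyl_mat n a b \<in> sqmats n"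
  by (auto simp: weyl_mat_def intro!: square_mult_carrier)

lemma lab_wprod_carrier: "lab_wprod N e w \<in> sqmats (Suc N)"
  unfolding lab_wprod_def by (rule mat_prod_carrier) (auto intro: weyl_mat_carrier simp del: mult_Suc_right)

lemma ent_lab_wprod_snoc:
  assumes "M \<in> sqmats (Suc N)" "vlab N a" "vlab N b" "vlab N x" "vlab N y"
    and ab: "a \<noteq> b" "a \<noteq> lopp b"
  shows "ent N e (M * lab_wprod N e (w @ [(a, b)])) x y =
    (let h = ent N e (M * lab_wprod N e w) x in
     if y = b then h a else if y = a then - h b
     else if y = lopp a then - h (lopp b) else if y = lopp b then h (lopp a) else h y)"
proof -
  have "lab_wprod N e (w @ [(a, b)]) = (lab_wprod N e w * weyl_mat (Suc N) (lab_pos N e a) (lab_pos N e b) :: 'a mat)"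
    unfolding lab_wprod_def map_append
    by (subst mat_prod_append)
       (auto simp: right_mult_one_mat[OF weyl_mat_carrier] intro: weyl_mat_carrier simp del: mult_Suc_right)
  then have "M * lab_wprod N e (w @ [(a, b)]) = M * lab_wprod N e w * weyl_mat (Suc N) (lab_pos N e a) (lab_pos N e b)"
    using assoc_mult_mat[OF assms(1) lab_wprod_carrier weyl_mat_carrier, of e w "lab_pos N e a" "lab_pos N e b"] by simp
  then show ?thesis
    using ent_mult_weyl[OF square_mult_carrier[OF assms(1) lab_wprod_carrier] assms(2-7), of e e w]
    by (simp add: Let_def)
qed

text \<open>With \<open>e = even (n - i)\<close> and \<open>n = N + 1\<close>, the label \<open>Ca\<close> is the column reached by the factor with
  parameter \<open>s\<^sub>i\<^sub>,\<^sub>n\<close> of \<open>R\<^sub>i\<close>, and \<open>Cb\<close> the one reached by the factor with parameter \<open>t\<^sub>i\<^sub>,\<^sub>n\<close>.\<close>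

definition R_lab :: "nat \<Rightarrow> (nat \<Rightarrow> 'a) \<Rightarrow> (nat \<Rightarrow> 'a) \<Rightarrow> nat \<Rightarrow> ('a \<times> lab \<times> lab) list" where
  "R_lab N t s i = map (\<lambda>j. (s (Suc j), Up j, Up (Suc j))) [i..<N]
     @ [(s (Suc N), Up N, Ca), (t (Suc N), Up N, Cb)]
     @ map (\<lambda>j. (t (Suc j), Up j, Up (Suc j))) (rev [i..<N])"

lemma eps_eq_1_iff: "eps k = 1 \<longleftrightarrow> even k"
  by (cases "even k") (simp_all add: eps_def)

text \<open>The exponents of the spin generators are absorbed into the labels here:
  \<open>eps (n - i) = 1\<close> exactly if \<open>Ca\<close> sits at position
  \<open>N\<close>.\<close>

lemma R_word_lab:
  assumes "1 \<le> i" "i \<le> N"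
  shows "map (\<lambda>(c, g). (c, src (Suc N) g, dst (Suc N) g)) (R_word (Suc N) t s i) =
    map (\<lambda>(c, a, b). (c, lab_pos N (even (Suc N - i)) a, lab_pos N (even (Suc N - i)) b)) (R_lab N (t i) (s i) i)"
proof -
  have u: "[i + 1..<Suc N] = map Suc [i..<N]" by (simp add: map_Suc_upt)
  show ?thesis
    unfolding R_word_def u R_lab_def rev_map[symmetric]
    using assms by (auto simp: eps_eq_1_iff Suc_diff_le rev_map)
qed

lemma R_mat_lab:
  assumes "1 \<le> i" "i \<le> N"
  shows "R_mat (Suc N) t s i = lab_prod N (even (Suc N - i)) (R_lab N (t i) (s i) i)"
proof -
  have "map (\<lambda>(c, g). root_mat (Suc N) (src (Suc N) g) (dst (Suc N) g) c) (R_word (Suc N) t s i)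
    = map (\<lambda>(c, a, b). root_mat (Suc N) a b c)
       (map (\<lambda>(c, g). (c, src (Suc N) g, dst (Suc N) g)) (R_word (Suc N) t s i))"
    by (simp add: comp_def case_prod_unfold)
  then show ?thesis
    unfolding R_word_lab[OF assms] R_mat_def lab_prod_def
    by (simp add: comp_def case_prod_unfold)
qed

lemma wR_mat_lab:
  assumes "1 \<le> i" "i \<le> N"
  shows "wR_mat (Suc N) i
    = (lab_wprod N (even (Suc N - i)) (map snd (R_lab N (\<lambda>_. 0 :: 'a) (\<lambda>_. 0) i)) :: 'a::field mat)"
proof -
  have "map (\<lambda>(c, g). weyl_mat (Suc N) (src (Suc N) g) (dst (Suc N) g) :: 'a mat)
      (R_word (Suc N) (\<lambda>i j. 0 :: 'a) (\<lambda>i j. 0) i)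
    = map (\<lambda>(c, a, b). weyl_mat (Suc N) a b)
       (map (\<lambda>(c, g). (c, src (Suc N) g, dst (Suc N) g)) (R_word (Suc N) (\<lambda>i j. 0 :: 'a) (\<lambda>i j. 0) i))"
    by (simp add: comp_def case_prod_unfold)
  then show ?thesis
    unfolding R_word_lab[OF assms] wR_mat_def lab_wprod_def
    by (simp add: comp_def case_prod_unfold)
qed

section \<open>The entries of \<open>R\<^sub>i\<close>\<close>

text \<open>With the half-open range \<open>{k<..l}\<close>, products over adjacent ranges multiply
  and telescoping starts from an empty product.\<close>

definition iprod :: "(nat \<Rightarrow> 'a::comm_monoid_mult) \<Rightarrow> nat \<Rightarrow> nat \<Rightarrow> 'a" where
  "iprod f k l = prod f {k<..l}"

lemma iprod_self [simp]: "l \<le> k \<Longrightarrow> iprod f k l = 1"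
  by (simp add: iprod_def)

lemma iprod_Suc: "k \<le> l \<Longrightarrow> iprod f k (Suc l) = iprod f k l * f (Suc l)"
proof -
  assume "k \<le> l"
  then have "{k<..Suc l} = insert (Suc l) {k<..l}" by auto
  then show ?thesis by (simp add: iprod_def mult.commute)
qed

lemma iprod_head: "k < l \<Longrightarrow> iprod f k l = f (Suc k) * iprod f (Suc k) l"
proof -
  assume "k < l"
  then have "{k<..l} = insert (Suc k) {Suc k<..l}" by auto
  then show ?thesis by (simp add: iprod_def)
qed

lemma iprod_split: "k \<le> l \<Longrightarrow> l \<le> m \<Longrightarrow> iprod f k m = iprod f k l * iprod f l m"
proof -
  assume "k \<le> l" "l \<le> m"
  then have "{k<..m} = {k<..l} \<union> {l<..m}" by auto
  then show ?thesis by (simp add: iprod_def prod.union_disjoint)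
qed

text \<open>The entries of the product of the first \<open>m - i\<close> factors of \<open>R\<^sub>i\<close>, and of the product of all of its
  factors except the last \<open>m - i\<close>.\<close>

fun ent_up :: "nat \<Rightarrow> (nat \<Rightarrow> 'a::field) \<Rightarrow> nat \<Rightarrow> nat \<Rightarrow> lab \<Rightarrow> lab \<Rightarrow> 'a" where
  "ent_up N s i m (Up k) (Up l) =
    (if k = l then 1 else if i \<le> k \<and> k < l \<and> l \<le> m then iprod s k l else 0)"
| "ent_up N s i m (Dn k) (Dn l) =
    (if k = l then 1 else if i \<le> l \<and> l < m \<and> k = Suc l then - s k else 0)"
| "ent_up N s i m Ca Ca = 1"
| "ent_up N s i m Cb Cb = 1"
| "ent_up N s i m _ _ = 0"

fun ent_down :: "nat \<Rightarrow> (nat \<Rightarrow> 'a::field) \<Rightarrow> (nat \<Rightarrow> 'a) \<Rightarrow> nat \<Rightarrow> nat \<Rightarrow> lab \<Rightarrow> lab \<Rightarrow> 'a" where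
  "ent_down N t s i m (Up k) (Up l) =
    (if k = l then 1 else if i \<le> k \<and> k < l then
       (if l \<le> m then iprod s k l else iprod s k (l - 1) * (s l + t l)) else 0)"
| "ent_down N t s i m (Up k) Ca = (if i \<le> k then iprod s k (Suc N) else 0)"
| "ent_down N t s i m (Up k) Cb = (if i \<le> k then iprod s k N * t (Suc N) else 0)"
| "ent_down N t s i m (Up k) (Dn l) =
    (if i \<le> k \<and> m \<le> l then (-1) ^ (Suc N - l) * iprod s k (Suc N) * iprod t l (Suc N) else 0)"
| "ent_down N t s i m Ca Ca = 1"
| "ent_down N t s i m Ca (Dn l) = (if m \<le> l then (-1) ^ (Suc N - l) * iprod t l (Suc N) else 0)"
| "ent_down N t s i m Cb Cb = 1"
| "ent_down N t s i m Cb (Dn l) = (if m \<le> l then (-1) ^ (Suc N - l) * s (Suc N) * iprod t l N else 0)"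
| "ent_down N t s i m (Dn k) (Dn l) =
    (if k = l then 1 else if l < k \<and> i \<le> l then
       (if m \<le> l then (-1) ^ (k - l) * (s k + t k) * iprod t l (k - 1)
        else if k = Suc l then - s k else 0) else 0)"
| "ent_down N t s i m _ _ = 0"

text \<open>Appending the factor with index \<open>m\<close> changes only the columns
  \<open>Up (Suc m)\<close> and \<open>Dn m\<close>.\<close>

lemma ent_lab_prod_up:
  assumes "1 \<le> i" "i \<le> m" "m \<le> N" "vlab N x" "vlab N y"
  shows "ent N e (lab_prod N e (map (\<lambda>j. (s (Suc j), Up j, Up (Suc j))) [i..<m])) x y
    = ent_up N s i m x y"
  using assms(2,1,3-)
proof (induction m arbitrary: y rule: dec_induct)
  case base
  have "ent N e (lab_prod N e []) x y = (if x = y then 1 else 0)"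
    by (simp add: lab_prod_def ent_one[OF base(3,4)] del: mult_Suc_right)
  then show ?case by (cases x; cases y) auto
next
  case (step m)
  have v: "vlab N (Up m)" "vlab N (Up (Suc m))" "vlab N (Dn (Suc m))" using step by auto
  have IH: "ent N e (lab_prod N e (map (\<lambda>j. (s (Suc j), Up j, Up (Suc j))) [i..<m])) x y = ent_up N s i m x y"
    if "vlab N y" for y using step that by auto
  show ?case
    using step.hyps step.prems v unfolding upt_Suc_append[OF step.hyps(1)] map_append list.map
    by (simp only: ent_lab_prod_snoc lopp.simps IH, cases x; cases y) (auto simp: iprod_Suc)
qed

lemma ent_lab_prod_spin:
  assumes "1 \<le> i" "i \<le> N" "vlab N x" "vlab N y"
  shows "ent N e (lab_prod N e (map (\<lambda>j. (s (Suc j), Up j, Up (Suc j))) [i..<N]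
     @ [(s (Suc N), Up N, Ca), (t (Suc N), Up N, Cb)])) x y = ent_down N t s i N x y"
proof -
  let ?w = "map (\<lambda>j. (s (Suc j), Up j, Up (Suc j))) [i..<N]"
  have w: "?w @ [(s (Suc N), Up N, Ca), (t (Suc N), Up N, Cb)]
    = (?w @ [(s (Suc N), Up N, Ca)]) @ [(t (Suc N), Up N, Cb)]" by simp
  have v: "vlab N (Up N)" "vlab N Ca" "vlab N Cb" "vlab N (Dn N)" "lopp Ca = Cb" "lopp Cb = Ca" using assms by auto
  have IH: "ent N e (lab_prod N e ?w) x y = ent_up N s i N x y"
    if "vlab N y" for y using assms that by (intro ent_lab_prod_up) auto
  show ?thesis
    unfolding w using assms v
    by (simp only: ent_lab_prod_snoc lopp.simps IH, cases x; cases y) (auto simp: iprod_Suc)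
qed

text \<open>The final factors come in descending order, hence the induction downwards from
  \<open>N\<close>; again each step affects only the columns \<open>Up (Suc m)\<close> and
  \<open>Dn m\<close>.\<close>

lemma ent_lab_prod_down:
  assumes "1 \<le> i" "i \<le> m" "m \<le> N" "vlab N x" "vlab N y"
  shows "ent N e (lab_prod N e (map (\<lambda>j. (s (Suc j), Up j, Up (Suc j))) [i..<N]
     @ [(s (Suc N), Up N, Ca), (t (Suc N), Up N, Cb)]
     @ map (\<lambda>j. (t (Suc j), Up j, Up (Suc j))) (rev [m..<N]))) x y = ent_down N t s i m x y"
  using assms(3,1,2,4,5)
proof (induction m arbitrary: y rule: inc_induct)
  case base
  then show ?case using ent_lab_prod_spin[of i N x y e s t] by simp
next
  case (step m)
  let ?w = "map (\<lambda>j. (s (Suc j), Up j, Up (Suc j))) [i..<N] @ [(s (Suc N), Up N, Ca), (t (Suc N), Up N, Cb)]"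
  have w: "?w @ map (\<lambda>j. (t (Suc j), Up j, Up (Suc j))) (rev [m..<N])
    = (?w @ map (\<lambda>j. (t (Suc j), Up j, Up (Suc j))) (rev [Suc m..<N])) @ [(t (Suc m), Up m, Up (Suc m))]"
    using step.hyps by (simp add: upt_conv_Cons)
  have v: "vlab N (Up m)" "vlab N (Up (Suc m))" "vlab N (Dn (Suc m))" using step by auto
  have IH: "ent N e (lab_prod N e (?w @ map (\<lambda>j. (t (Suc j), Up j, Up (Suc j))) (rev [Suc m..<N]))) x y
    = ent_down N t s i (Suc m) x y" if "vlab N y" for y
    using step that by (simp only: append_assoc)
  have sg: "(-1 :: 'a) ^ (Suc N - m) = - ((-1) ^ (N - m))" if "m \<le> N" for m
    using that by (simp add: Suc_diff_le)
  have sg': "(-1 :: 'a) ^ (k - m) = - ((-1) ^ (k - Suc m))" if "m < k" for k m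
    using that by (simp add: Suc_diff_Suc[symmetric])
  have le_m: "m \<le> l \<longleftrightarrow> m = l \<or> Suc m \<le> l" for l by auto
  show ?case
    using step.hyps step.prems v w
    apply (simp only: append_assoc[symmetric])
    apply (simp only: ent_lab_prod_snoc lopp.simps IH)
    apply (cases x; cases y)
    apply (auto simp: iprod_Suc iprod_head[of m] sg sg' algebra_simps less_Suc_eq le_m)
    done
qed

section \<open>Signed permutations\<close>

text \<open>The row \<open>h\<close> of a matrix after multiplication by the corresponding partial products of simple
  reflections from the right.\<close>

fun weyl_up :: "nat \<Rightarrow> nat \<Rightarrow> (lab \<Rightarrow> 'a::field) \<Rightarrow> lab \<Rightarrow> 'a" where
  "weyl_up i m h (Up l) =
    (if i \<le> l \<and> l < m then - h (Up (Suc l)) else if l = m then h (Up i) else h (Up l))"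
| "weyl_up i m h (Dn l) =
    (if i \<le> l \<and> l < m then - h (Dn (Suc l)) else if l = m then h (Dn i) else h (Dn l))"
| "weyl_up i m h Ca = h Ca"
| "weyl_up i m h Cb = h Cb"

fun weyl_down :: "nat \<Rightarrow> nat \<Rightarrow> nat \<Rightarrow> (lab \<Rightarrow> 'a::field) \<Rightarrow> lab \<Rightarrow> 'a" where
  "weyl_down N i m h (Up l) =
    (if m < l then - h (Up l) else if l = m then (-1) ^ (Suc N - m) * h (Dn i)
     else if i \<le> l then - h (Up (Suc l)) else h (Up l))"
| "weyl_down N i m h (Dn l) =
    (if m < l then - h (Dn l) else if l = m then (-1) ^ (Suc N - m) * h (Up i)
     else if i \<le> l then - h (Dn (Suc l)) else h (Dn l))"
| "weyl_down N i m h Ca = - h Cb"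
| "weyl_down N i m h Cb = - h Ca"

context
  fixes N :: nat and e :: bool and M :: "'a::field mat" and x :: lab
  assumes M: "M \<in> sqmats (Suc N)" and x: "vlab N x"
begin

lemma ent_lab_wprod_up:
  assumes "1 \<le> i" "i \<le> m" "m \<le> N" "vlab N y"
  shows "ent N e (M * lab_wprod N e (map (\<lambda>j. (Up j, Up (Suc j))) [i..<m])) x y
    = weyl_up i m (ent N e M x) y"
  using assms(2,1,3-)
proof (induction m arbitrary: y rule: dec_induct)
  case base
  show ?case
    by (cases y) (auto simp: lab_wprod_def right_mult_one_mat[OF M] simp del: mult_Suc_right)
next
  case (step m)
  have v: "vlab N (Up m)" "vlab N (Up (Suc m))" "vlab N (Dn (Suc m))" "vlab N (Dn m)" "Up m \<noteq> Up (Suc m)"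
    "Up m \<noteq> lopp (Up (Suc m))" using step by auto
  have IH: "ent N e (M * lab_wprod N e (map (\<lambda>j. (Up j, Up (Suc j))) [i..<m])) x y
      = weyl_up i m (ent N e M x) y"
    if "vlab N y" for y using step that by auto
  have "ent N e (M * lab_wprod N e (map (\<lambda>j. (Up j, Up (Suc j))) [i..<m] @ [(Up m, Up (Suc m))])) x y
    = (let h = weyl_up i m (ent N e M x) in
     if y = Up (Suc m) then h (Up m) else if y = Up m then - h (Up (Suc m))
     else if y = Dn m then - h (Dn (Suc m)) else if y = Dn (Suc m) then h (Dn m) else h y)"
    unfolding ent_lab_wprod_snoc[OF M v(1,2) x step.prems(3) v(5,6)] Let_def lopp.simps
    by (simp only: IH v step.prems)
  also have "\<dots> = weyl_up i (Suc m) (ent N e M x) y"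
    using step.hyps step.prems by (cases y) (auto simp: Let_def)
  finally show ?case using step.hyps by simp
qed

lemma ent_lab_wprod_spin:
  assumes "1 \<le> i" "i \<le> N" "vlab N y"
  shows "ent N e (M * lab_wprod N e (map (\<lambda>j. (Up j, Up (Suc j))) [i..<N] @ [(Up N, Ca), (Up N, Cb)])) x y
    = weyl_down N i N (ent N e M x) y"
proof -
  let ?w = "map (\<lambda>j. (Up j, Up (Suc j))) [i..<N]"
  let ?h = "weyl_up i N (ent N e M x)"
  have w: "?w @ [(Up N, Ca), (Up N, Cb)] = (?w @ [(Up N, Ca)]) @ [(Up N, Cb)]" by simp
  have v: "vlab N (Up N)" "vlab N Ca" "vlab N Cb" "vlab N (Dn N)" "Up N \<noteq> Ca" "Up N \<noteq> Cb" "Up N \<noteq> lopp Ca"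
    "Up N \<noteq> lopp Cb" using assms by auto
  have IH: "ent N e (M * lab_wprod N e ?w) x y = weyl_up i N (ent N e M x) y"
    if "vlab N y" for y using assms that by (intro ent_lab_wprod_up) auto
  have 1: "ent N e (M * lab_wprod N e (?w @ [(Up N, Ca)])) x y
    = (if y = Ca then ?h (Up N) else if y = Up N then - ?h Ca
       else if y = Dn N then - ?h Cb else if y = Cb then ?h (Dn N) else ?h y)" if "vlab N y" for y
    unfolding ent_lab_wprod_snoc[OF M v(1,2) x that v(5,7)] Let_def lopp.simps
    by (simp only: IH v that)
  have "ent N e (M * lab_wprod N e (?w @ [(Up N, Ca), (Up N, Cb)])) x y
    = (let h = (\<lambda>y. if y = Ca then ?h (Up N) else if y = Up N then - ?h Ca
       else if y = Dn N then - ?h Cb else if y = Cb then ?h (Dn N) else ?h y) in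
      if y = Cb then h (Up N) else if y = Up N then - h Cb
       else if y = Dn N then - h Ca else if y = Ca then h (Dn N) else h y)"
    unfolding w ent_lab_wprod_snoc[OF M v(1,3) x assms(3) v(6,8)] Let_def lopp.simps
    by (simp only: 1 v assms)
  also have "\<dots> = weyl_down N i N (ent N e M x) y"
    using assms by (cases y) (auto simp: Let_def)
  finally show ?thesis .
qed

lemma ent_lab_wprod_down:
  assumes "1 \<le> i" "i \<le> m" "m \<le> N" "vlab N y"
  shows "ent N e (M * lab_wprod N e (map (\<lambda>j. (Up j, Up (Suc j))) [i..<N] @ [(Up N, Ca), (Up N, Cb)]
      @ map (\<lambda>j. (Up j, Up (Suc j))) (rev [m..<N]))) x y = weyl_down N i m (ent N e M x) y"
  using assms(3,1,2,4)
proof (induction m arbitrary: y rule: inc_induct)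
  case base
  then show ?case using ent_lab_wprod_spin[of i y] by simp
next
  case (step m)
  let ?w = "map (\<lambda>j. (Up j, Up (Suc j))) [i..<N] @ [(Up N, Ca), (Up N, Cb)]
    @ map (\<lambda>j. (Up j, Up (Suc j))) (rev [Suc m..<N])"
  have w: "map (\<lambda>j. (Up j, Up (Suc j))) [i..<N] @ [(Up N, Ca), (Up N, Cb)]
    @ map (\<lambda>j. (Up j, Up (Suc j))) (rev [m..<N]) = ?w @ [(Up m, Up (Suc m))]"
    using step.hyps by (simp add: upt_conv_Cons)
  have v: "vlab N (Up m)" "vlab N (Up (Suc m))" "vlab N (Dn (Suc m))" "vlab N (Dn m)" "Up m \<noteq> Up (Suc m)"
    "Up m \<noteq> lopp (Up (Suc m))" using step by auto
  have IH: "ent N e (M * lab_wprod N e ?w) x y = weyl_down N i (Suc m) (ent N e M x) y"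
    if "vlab N y" for y using step that by auto
  have sg: "(-1 :: 'a) ^ (Suc N - m) = - ((-1) ^ (N - m))"
    using step.hyps by (simp add: Suc_diff_le)
  have "ent N e (M * lab_wprod N e (?w @ [(Up m, Up (Suc m))])) x y
    = (let h = weyl_down N i (Suc m) (ent N e M x) in
     if y = Up (Suc m) then h (Up m) else if y = Up m then - h (Up (Suc m))
     else if y = Dn m then - h (Dn (Suc m)) else if y = Dn (Suc m) then h (Dn m) else h y)"
    unfolding ent_lab_wprod_snoc[OF M v(1,2) x step.prems(3) v(5,6)] Let_def lopp.simps
    by (simp only: IH v step.prems)
  also have "\<dots> = weyl_down N i m (ent N e M x) y"
    using step.hyps step.prems by (cases y) (auto simp: Let_def sg)
  finally show ?case unfolding w .
qed

end

lemma ent_mult_wR: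
  fixes M :: "'a::field mat"
  assumes M: "M \<in> sqmats (Suc N)" and "vlab N x" "vlab N y" "1 \<le> i" "i \<le> N"
    and e: "e = even (Suc N - i)"
  shows "ent N e (M * wR_mat (Suc N) i) x y = weyl_down N i i (ent N e M x) y"
proof -
  have "map snd (R_lab N (\<lambda>_. 0 :: 'a) (\<lambda>_. 0) i) = map (\<lambda>j. (Up j, Up (Suc j))) [i..<N] @ [(Up N, Ca), (Up N, Cb)]
      @ map (\<lambda>j. (Up j, Up (Suc j))) (rev [i..<N])"
    by (simp add: R_lab_def comp_def)
  then show ?thesis
    unfolding wR_mat_lab[OF assms(4,5)] e using assms(4,5) ent_lab_wprod_down[OF assms(1,2,4) order_refl _ assms(3)]
    by simp
qed

text \<open>If \<open>f\<close> is a row of a matrix \<open>M\<close>, this is the same row of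
  \<open>M * w_part (Suc N) i\<close>. The block occupies the positions
  \<open>i - 1, ..., 2 * N + 2 - i\<close> counted from 0.\<close>

definition wcol :: "nat \<Rightarrow> nat \<Rightarrow> (nat \<Rightarrow> 'a::field) \<Rightarrow> nat \<Rightarrow> 'a" where
  "wcol N i f b = (if b < i - 1 \<or> b > 2 * N + 2 - i then f b else (-1) ^ (Suc N - i) *
     f (if (b = N \<or> b = Suc N) \<and> even (Suc N - i) then b else opp (Suc N) b))"

lemma wcol_lab:
  assumes "1 \<le> i" "i \<le> Suc N"
  shows "1 \<le> l \<Longrightarrow> l \<le> N \<Longrightarrow> wcol N i f (lab_pos N e (Up l)) =
      (if l < i then f (lab_pos N e (Up l)) else (-1) ^ (Suc N - i) * f (lab_pos N e (Dn l)))"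
    and "1 \<le> l \<Longrightarrow> l \<le> N \<Longrightarrow> wcol N i f (lab_pos N e (Dn l)) =
      (if l < i then f (lab_pos N e (Dn l)) else (-1) ^ (Suc N - i) * f (lab_pos N e (Up l)))"
    and "wcol N i f (lab_pos N e Ca) =
      (-1) ^ (Suc N - i) * f (lab_pos N e (if even (Suc N - i) then Ca else Cb))"
    and "wcol N i f (lab_pos N e Cb) =
      (-1) ^ (Suc N - i) * f (lab_pos N e (if even (Suc N - i) then Cb else Ca))"
proof -
  assume l: "1 \<le> l" "l \<le> N"
  have "l - 1 \<noteq> N" "l - 1 \<noteq> Suc N" "l - 1 < i - 1 \<longleftrightarrow> l < i" "\<not> 2 * N + 2 - i < l - 1"
    "opp (Suc N) (l - 1) = 2 * N + 2 - l"
    using l assms by (auto simp: opp_def)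
  then show "wcol N i f (lab_pos N e (Up l)) =
      (if l < i then f (lab_pos N e (Up l)) else (-1) ^ (Suc N - i) * f (lab_pos N e (Dn l)))"
    by (simp only: wcol_def lab_pos.simps simp_thms if_False)
  have "2 * N + 2 - l \<noteq> N" "2 * N + 2 - l \<noteq> Suc N" "\<not> 2 * N + 2 - l < i - 1"
    "2 * N + 2 - i < 2 * N + 2 - l \<longleftrightarrow> l < i" "opp (Suc N) (2 * N + 2 - l) = l - 1"
    using l assms by (auto simp: opp_def)
  then show "wcol N i f (lab_pos N e (Dn l)) =
      (if l < i then f (lab_pos N e (Dn l)) else (-1) ^ (Suc N - i) * f (lab_pos N e (Up l)))"
    by (simp only: wcol_def lab_pos.simps simp_thms if_False)
next
  have *: "\<not> N < i - 1" "\<not> Suc N < i - 1" "\<not> 2 * N + 2 - i < N" "\<not> 2 * N + 2 - i < Suc N"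
    "opp (Suc N) N = Suc N" "opp (Suc N) (Suc N) = N"
    using assms by (auto simp: opp_def)
  show "wcol N i f (lab_pos N e Ca) =
      (-1) ^ (Suc N - i) * f (lab_pos N e (if even (Suc N - i) then Ca else Cb))"
    by (cases e; cases "even (Suc N - i)") (simp_all only: wcol_def lab_pos.simps simp_thms if_False if_True *)
  show "wcol N i f (lab_pos N e Cb) =
      (-1) ^ (Suc N - i) * f (lab_pos N e (if even (Suc N - i) then Cb else Ca))"
    by (cases e; cases "even (Suc N - i)") (simp_all only: wcol_def lab_pos.simps simp_thms if_False if_True *)
qed

text \<open>By \<open>weyl_down\<close>, \<open>wR_mat\<close> exchanges the outer pair of its block
  up to the sign \<open>(-1) ^ (n - i)\<close>, negates the inner columns and exchanges the two
  central ones. Composed with the reversal of the inner block this is the reversal of the larger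
  block.\<close>

lemma mult_w_part_index:
  fixes M :: "'a::field mat"
  assumes "1 \<le> i" "i \<le> Suc N"
    and "M \<in> sqmats (Suc N)" "a < 2 * Suc N" "b < 2 * Suc N"
  shows "(M * w_part (Suc N) i) $$ (a, b) = wcol N i (\<lambda>b. M $$ (a, b)) b"
  using assms(2,1,3-)
proof (induction i arbitrary: b rule: inc_induct)
  case base
  then show ?case
    by (auto simp: w_part_top right_mult_one_mat[OF base(2)] wcol_def simp del: mult_Suc_right)
next
  case (step i)
  let ?e = "even (Suc N - i)"
  have i: "1 \<le> i" "i \<le> N" "i < Suc N" using step by auto
  have c: "w_part (Suc N) (Suc i) \<in> sqmats (Suc N)"
    "wR_mat (Suc N) i \<in> sqmats (Suc N)"
    by (rule SO_carrier[OF w_part_SO], simp) (rule SO_carrier[OF wR_mat_SO[OF i(1,3)]])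
  obtain x where x: "vlab N x" "lab_pos N ?e x = a" using pos_surj[OF step.prems(3)] .
  obtain y where y: "vlab N y" "lab_pos N ?e y = b" using pos_surj[OF step.prems(4)] .
  let ?h = "\<lambda>z. wcol N (Suc i) (\<lambda>b. M $$ (a, b)) (lab_pos N ?e z)"
  have IH: "ent N ?e (M * w_part (Suc N) (Suc i)) x z = ?h z" if "vlab N z" for z
    unfolding ent_def x using step that pos_less[OF that, of ?e] by auto
  have v: "vlab N (Up i)" "vlab N (Dn i)" using i by auto
  have wd: "weyl_down N i i h y = weyl_down N i i h' y"
    if "\<And>z. vlab N z \<Longrightarrow> h z = h' z" for h h' :: "lab \<Rightarrow> 'a"
    using y(1) v by (cases y) (auto simp: that)
  have par: "even (N - i) \<longleftrightarrow> \<not> even (Suc N - i)" using i by (simp add: Suc_diff_le)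
  have sg: "(-1 :: 'a) ^ (Suc N - i) = - ((-1) ^ (N - i))"
    using i by (simp add: Suc_diff_le)
  have "(M * w_part (Suc N) i) $$ (a, b) = ent N ?e (M * w_part (Suc N) (Suc i) * wR_mat (Suc N) i) x y"
    unfolding w_part_rec[OF i(1,3)] ent_def x y assoc_mult_mat[OF step.prems(2) c] ..
  also have "\<dots> = weyl_down N i i (ent N ?e (M * w_part (Suc N) (Suc i)) x) y"
    by (rule ent_mult_wR[OF square_mult_carrier[OF step.prems(2) c(1)] x(1) y(1) i(1,2) refl])
  also have "\<dots> = weyl_down N i i ?h y" by (rule wd) (rule IH)
  also have "\<dots> = wcol N i (\<lambda>b. M $$ (a, b)) b"
  proof (cases y)
    case [simp]: (Up l)
    then have l: "1 \<le> l" "l \<le> N" using y(1) by auto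
    show ?thesis unfolding y(2)[symmetric] using l i
      by (cases l i rule: linorder_cases) (simp_all add: wcol_lab sg del: lab_pos.simps)
  next
    case [simp]: (Dn l)
    then have l: "1 \<le> l" "l \<le> N" using y(1) by auto
    show ?thesis unfolding y(2)[symmetric] using l i
      by (cases l i rule: linorder_cases) (simp_all add: wcol_lab sg del: lab_pos.simps)
  qed (unfold y(2)[symmetric], use i in \<open>simp_all add: wcol_lab sg par del: lab_pos.simps even_diff_nat\<close>)
  finally show ?case .
qed

text \<open>The signed permutation matrix \<open>w_i\<close> is symmetric and an involution, so its
  inverse acts on rows by the rule by which \<open>w_i\<close> acts on columns.\<close>

lemma adj_w_part_mult_index:
  fixes V :: "'a::field mat"
  assumes i: "1 \<le> i" "i \<le> Suc N"
    and V: "V \<in> sqmats (Suc N)" and ab: "a < 2 * Suc N" "b < 2 * Suc N"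
  shows "(adj (Suc N) (w_part (Suc N) i) * V) $$ (a, b) = wcol N i (\<lambda>c. V $$ (c, b)) a"
proof -
  let ?W = "w_part (Suc N) i :: 'a mat"
  have W: "?W \<in> sqmats (Suc N)"
    by (rule SO_carrier[OF w_part_SO[OF i(1)]])
  have entry: "?W $$ (x, y) = wcol N i (\<lambda>b. if x = b then 1 else 0) y"
    if "x < 2 * Suc N" "y < 2 * Suc N" for x y
  proof -
    have "?W $$ (x, y) = wcol N i (\<lambda>b. 1\<^sub>m (2 * Suc N) $$ (x, b)) y"
      using mult_w_part_index[where 'a='a, OF i one_carrier_mat that] by (simp only: left_mult_one_mat[OF W])
    also have "\<dots> = wcol N i (\<lambda>b. if x = b then 1 else 0) y"
      using that by (auto simp: wcol_def opp_def)
    finally show ?thesis .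
  qed
  obtain x where x: "vlab N x" "lab_pos N True x = a" using pos_surj[OF ab(1)] .
  let ?z = "\<lambda>y. lab_pos N True y"
  have swap: "opp (Suc N) z = ?z y \<longleftrightarrow> z = ?z (lopp y)" if "vlab N y" "z < 2 * Suc N" for y z
    using that opp_eq_swap[of "?z y" "Suc N" z] pos_less[OF that(1), of True]
    by (auto simp: pos_lopp)
  have "(adj (Suc N) ?W * V) $$ (a, b)
    = (\<Sum>z<2 * Suc N. adj (Suc N) ?W $$ (a, z) * V $$ (z, b))"
    by (rule index_mult_sum[OF adj_carrier V ab])
  also have "\<dots> = (\<Sum>z<2 * Suc N. wcol N i (\<lambda>b. if opp (Suc N) z = b then 1 else 0) (?z (lopp x)) * V $$ (z, b))"
  proof (rule sum.cong)
    fix z assume z: "z \<in> {..<2 * Suc N}"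
    then have "adj (Suc N) ?W $$ (a, z) = ?W $$ (opp (Suc N) z, opp (Suc N) a)"
      using ab by (intro adj_index) auto
    also have "\<dots> = wcol N i (\<lambda>b. if opp (Suc N) z = b then 1 else 0) (opp (Suc N) a)"
      by (rule entry) (use z ab in \<open>auto intro!: opp_less simp del: mult_Suc_right\<close>)
    finally show "adj (Suc N) ?W $$ (a, z) * V $$ (z, b)
      = wcol N i (\<lambda>b. if opp (Suc N) z = b then 1 else 0) (?z (lopp x)) * V $$ (z, b)"
      using x by (simp add: pos_lopp)
  qed simp
  also have "\<dots> = wcol N i (\<lambda>c. V $$ (c, b)) (?z x)"
  proof -
    have pick: "(\<Sum>z<2 * Suc N. (c * (if opp (Suc N) z = ?z y then 1 else 0)) * V $$ (z, b))
      = c * V $$ (?z (lopp y), b)" if y: "vlab N y" for c y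
    proof -
      have "(\<Sum>z<2 * Suc N. (c * (if opp (Suc N) z = ?z y then 1 else 0)) * V $$ (z, b))
        = (\<Sum>z<2 * Suc N. if z = ?z (lopp y) then c * V $$ (?z (lopp y), b) else 0)"
        by (rule sum.cong) (use swap[OF y] in auto)
      also have "\<dots> = c * V $$ (?z (lopp y), b)"
        using pos_less[of N "lopp y" True] y by (simp del: mult_Suc_right)
      finally show ?thesis .
    qed
    show ?thesis
    proof (cases x)
      case [simp]: (Up k)
      then have k: "1 \<le> k" "k \<le> N" using x by auto
      show ?thesis
        using pick[of "Dn k" 1] pick[of "Up k" "(-1) ^ (Suc N - i)"] k
        by (simp add: wcol_lab[OF i] del: lab_pos.simps mult_Suc_right)
    next
      case [simp]: (Dn k)
      then have k: "1 \<le> k" "k \<le> N" using x by auto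
      show ?thesis
        using pick[of "Up k" 1] pick[of "Dn k" "(-1) ^ (Suc N - i)"] k
        by (simp add: wcol_lab[OF i] del: lab_pos.simps mult_Suc_right)
    next
      case [simp]: Ca
      show ?thesis
        using pick[of Ca 1] pick[of Cb 1] pick[of Ca "-1"] pick[of Cb "-1"]
        by (cases "even (Suc N - i)") (simp_all add: wcol_lab[OF i] del: lab_pos.simps mult_Suc_right even_diff_nat)
    next
      case [simp]: Cb
      show ?thesis
        using pick[of Ca 1] pick[of Cb 1] pick[of Ca "-1"] pick[of Cb "-1"]
        by (cases "even (Suc N - i)") (simp_all add: wcol_lab[OF i] del: lab_pos.simps mult_Suc_right even_diff_nat)
    qed
  qed
  finally show ?thesis using x by simp
qed

lemma iprod_uminus: "iprod (\<lambda>j. - f j :: 'a::field) k l = (-1) ^ (l - k) * iprod f k l"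
  by (cases "k \<le> l") (simp_all add: iprod_def prod_uminus)

lemma iprod_nonzero:
  "(\<And>j. k < j \<Longrightarrow> j \<le> l \<Longrightarrow> f j \<noteq> (0::'a::field)) \<Longrightarrow> iprod f k l \<noteq> 0"
  by (simp add: iprod_def)

section \<open>The rows of \<open>Z\<close>\<close>

text \<open>A single row \<open>i\<close>, so that only the second index remains. Setting
  \<open>u\<close> and \<open>v\<close> to 1 at \<open>j = i\<close> implements the convention that
  \<open>s\<close> and \<open>u\<close> are 1 on the diagonal.\<close>

locale row_params =
  fixes N i :: nat and t s p q u v :: "nat \<Rightarrow> 'a::field" and e :: bool
  assumes i: "1 \<le> i" "i \<le> N"
    and s0: "\<And>j. i < j \<Longrightarrow> j \<le> Suc N \<Longrightarrow> s j \<noteq> 0"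
    and t0: "\<And>j. i < j \<Longrightarrow> j \<le> Suc N \<Longrightarrow> t j \<noteq> 0"
    and u0: "\<And>j. i < j \<Longrightarrow> j \<le> N \<Longrightarrow> t j + s j \<noteq> 0"
    and u: "\<And>j. u j = (if j = i then 1 else t j + s j)"
    and v: "\<And>j. v j = (if j = i then 1 else s j)"
    and e: "e = even (Suc N - i)"
    and p: "\<And>j. i < j \<Longrightarrow> j \<le> N \<Longrightarrow> p j = u (j - 1) / (u j * v (j - 1))"
    and q: "\<And>j. i < j \<Longrightarrow> j \<le> N \<Longrightarrow> q j = p j * s j / t j"
    and pn: "p (Suc N) = u N / v N / (if e then s (Suc N) else t (Suc N))"
    and qn: "q (Suc N) = u N / v N / (if e then t (Suc N) else s (Suc N))"
begin

definition "S l = iprod s i l"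
definition "T l = iprod t i l"
definition "g l = u l / v l"

lemma uv0: "i \<le> l \<Longrightarrow> l \<le> N \<Longrightarrow> u l \<noteq> 0" "i \<le> l \<Longrightarrow> l \<le> N \<Longrightarrow> v l \<noteq> 0"
  using u0[of l] s0[of l] by (auto simp: u v)

lemma g0: "i \<le> l \<Longrightarrow> l \<le> N \<Longrightarrow> g l \<noteq> 0"
  using uv0 by (simp add: g_def)

lemma ST0: "l \<le> Suc N \<Longrightarrow> S l \<noteq> 0" "l \<le> Suc N \<Longrightarrow> T l \<noteq> 0"
  using s0 t0 by (auto simp: S_def T_def intro!: iprod_nonzero)

lemma ST_Suc: "i \<le> l \<Longrightarrow> S (Suc l) = S l * s (Suc l)" "i \<le> l \<Longrightarrow> T (Suc l) = T l * t (Suc l)"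
  by (simp_all add: S_def T_def iprod_Suc)

lemma ST_base: "S i = 1" "T i = 1"
  by (simp_all add: S_def T_def)

lemma v_g: "g i = 1" "i < l \<Longrightarrow> l \<le> N \<Longrightarrow> u l = g l * s l"
  using s0[of l] by (auto simp: g_def u v)

lemma p_g: "i < j \<Longrightarrow> j \<le> N \<Longrightarrow> p j = g (j - 1) / (g j * s j)"
  using v_g(2)[of j] by (simp add: p g_def)

lemma q_g: "i < j \<Longrightarrow> j \<le> N \<Longrightarrow> q j = g (j - 1) / (g j * t j)"
  using s0[of j] by (simp add: q p_g)

text \<open>Each \<open>q j\<close> is the quotient of consecutive values of
  \<open>1 / (g l * T l)\<close>, so the product telescopes.\<close>

lemma iprod_q: "i \<le> l \<Longrightarrow> l \<le> N \<Longrightarrow> iprod q i l = 1 / (g l * T l)"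
proof (induction l rule: dec_induct)
  case base
  show ?case by (simp add: v_g ST_base)
next
  case (step l)
  then show ?case using g0[of l] g0[of "Suc l"] t0[of "Suc l"] by (simp add: iprod_Suc ST_Suc q_g)
qed

lemma iprod_p: "i \<le> l \<Longrightarrow> l \<le> N \<Longrightarrow> iprod p i l = 1 / (g l * S l)"
proof (induction l rule: dec_induct)
  case base
  show ?case by (simp add: v_g ST_base)
next
  case (step l)
  then show ?case using g0[of l] g0[of "Suc l"] s0[of "Suc l"] by (simp add: iprod_Suc ST_Suc p_g)
qed

lemma iprod_ratio:
  fixes f :: "nat \<Rightarrow> 'a"
  assumes "i \<le> k" "k \<le> l" "iprod f i k \<noteq> 0"
  shows "iprod f k l = iprod f i l / iprod f i k"
  using iprod_split[OF assms(1,2), of f] assms(3) by simp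

lemma iprod_s: "i \<le> k \<Longrightarrow> k \<le> l \<Longrightarrow> k \<le> Suc N \<Longrightarrow> iprod s k l = S l / S k"
  and iprod_t: "i \<le> k \<Longrightarrow> k \<le> l \<Longrightarrow> k \<le> Suc N \<Longrightarrow> iprod t k l = T l / T k"
  using ST0 by (auto simp: S_def T_def intro: iprod_ratio)

lemma iprod_q': "i \<le> k \<Longrightarrow> k \<le> l \<Longrightarrow> l \<le> N \<Longrightarrow> iprod q k l = g k * T k / (g l * T l)"
  and iprod_p': "i \<le> k \<Longrightarrow> k \<le> l \<Longrightarrow> l \<le> N \<Longrightarrow> iprod p k l = g k * S k / (g l * S l)"
  using iprod_ratio[of k l q] iprod_ratio[of k l p] iprod_q[of k] iprod_q[of l] iprod_p[of k] iprod_p[of l]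
    g0[of k] g0[of l] ST0[of k] ST0[of l] by auto

definition "R x y = ent_down N p q i i x y"
definition "Rm x y = ent_down N (\<lambda>j. - t j) (\<lambda>j. - s j) i i x y"

text \<open>This is the parameter of the last column that the theorem calls \<open>u\<close> at
  \<open>(i, n)\<close>; \<open>bn\<close> is the other one of the two.\<close>

definition "an = (if e then s (Suc N) else t (Suc N))"
definition "bn = (if e then t (Suc N) else s (Suc N))"

lemma ab0: "an \<noteq> 0" "bn \<noteq> 0" "an * bn = s (Suc N) * t (Suc N)"
  using s0[of "Suc N"] t0[of "Suc N"] i by (auto simp: an_def bn_def)

lemma p_an: "p (Suc N) = g N / an" and q_bn: "q (Suc N) = g N / bn"
  by (simp_all add: pn qn an_def bn_def g_def)

lemma qn': "i \<le> k \<Longrightarrow> k \<le> N \<Longrightarrow> iprod q k (Suc N) = g k * T k / (T N * bn)"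
  using g0[of N] ab0 by (simp add: iprod_Suc iprod_q' q_bn)

lemma pn': "i \<le> k \<Longrightarrow> k \<le> N \<Longrightarrow> iprod p k (Suc N) = g k * S k / (S N * an)"
  using g0[of N] ab0 by (simp add: iprod_Suc iprod_p' p_an)

text \<open>The entry is a product of parameters \<open>q\<close> times \<open>q l + p l\<close>,
  and this sum is a monomial in \<open>g\<close> and \<open>t\<close>. The result splits into a part
  in \<open>k\<close> and a part in \<open>l\<close>, which is what makes the rows
  proportional.\<close>

lemma R_UU: "i \<le> k \<Longrightarrow> k < l \<Longrightarrow> l \<le> N \<Longrightarrow> R (Up k) (Up l) = g k * T k / T l"
proof -
  assume a: "i \<le> k" "k < l" "l \<le> N"
  then obtain l' where l': "l = Suc l'" by (cases l) auto
  have "q l + p l = g l' / (t l * s l) * ((t l + s l) / g l)"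
    using a l' g0[of l] s0[of l] t0[of l] by (simp add: q_g p_g field_simps)
  also have "t l + s l = g l * s l" using a v_g(2)[of l] by (simp add: u)
  also have "g l' / (t l * s l) * (g l * s l / g l) = g l' / t l"
    using a g0[of l] s0[of l] by simp
  finally show ?thesis
    using a l' g0[of l'] ST0[of l'] t0[of l] by (simp add: R_def iprod_q' iprod_Suc ST_Suc)
qed

lemma R_UA: "i \<le> k \<Longrightarrow> k \<le> N \<Longrightarrow> R (Up k) Ca = g k * T k / (T N * bn)"
  by (simp add: R_def qn')

lemma R_UB: "i \<le> k \<Longrightarrow> k \<le> N \<Longrightarrow> R (Up k) Cb = g k * T k / (T N * an)"
  using g0[of N] by (simp add: R_def iprod_q' p_an)

lemma R_UD: "i \<le> k \<Longrightarrow> k \<le> N \<Longrightarrow> i \<le> l \<Longrightarrow> l \<le> N \<Longrightarrow>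
    R (Up k) (Dn l) = (-1) ^ (Suc N - l) * (g k * T k) * (g l * S l) / (T N * S N * (an * bn))"
  by (simp add: R_def qn' pn')

lemma R_AD: "i \<le> l \<Longrightarrow> l \<le> N \<Longrightarrow> R Ca (Dn l) = (-1) ^ (Suc N - l) * (g l * S l) / (S N * an)"
  by (simp add: R_def pn')

lemma R_BD: "i \<le> l \<Longrightarrow> l \<le> N \<Longrightarrow> R Cb (Dn l) = (-1) ^ (Suc N - l) * (g l * S l) / (S N * bn)"
  using g0[of N] by (simp add: R_def iprod_p' q_bn)

lemma R_DD: "i \<le> l \<Longrightarrow> l < k \<Longrightarrow> k \<le> N \<Longrightarrow>
    R (Dn k) (Dn l) = (-1) ^ (k - l) * (g l * S l) * s k / (t k * S k)"
proof -
  assume a: "i \<le> l" "l < k" "k \<le> N"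
  then obtain k' where k': "k = Suc k'" by (cases k) auto
  have "q k + p k = g k' / (t k * s k) * ((t k + s k) / g k)"
    using a k' g0[of k] s0[of k] t0[of k] by (simp add: q_g p_g field_simps)
  also have "t k + s k = g k * s k" using a v_g(2)[of k] by (simp add: u)
  also have "g k' / (t k * s k) * (g k * s k / g k) = g k' / t k"
    using a g0[of k] s0[of k] by simp
  finally show ?thesis
    using a k' g0[of k'] s0[of k] by (simp add: R_def iprod_p' iprod_Suc ST_Suc)
qed

lemma sign_mult: "(-1 :: 'a) ^ a * ((-1) ^ a * x) = x"
  by (simp add: mult.assoc[symmetric] power_add[symmetric])

lemma Rm_UU: "i \<le> k \<Longrightarrow> k < l \<Longrightarrow> l \<le> N \<Longrightarrow> Rm (Up k) (Up l) = (-1) ^ (l - k) * g l * S l / S k"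
proof -
  assume a: "i \<le> k" "k < l" "l \<le> N"
  then obtain l' where l': "l = Suc l'" by (cases l) auto
  have "Rm (Up k) (Up l) = iprod (\<lambda>j. - s j) k l' * - (t l + s l)"
    using a l' by (simp add: Rm_def)
  also have "t l + s l = g l * s l" using a v_g(2)[of l] by (simp add: u)
  finally show ?thesis
    using a l' by (simp add: iprod_uminus iprod_s iprod_Suc ST_Suc Suc_diff_le)
qed

lemma Rm_UA: "i \<le> k \<Longrightarrow> k \<le> N \<Longrightarrow> Rm (Up k) Ca = (-1) ^ (Suc N - k) * S N * s (Suc N) / S k"
  by (simp add: Rm_def iprod_uminus iprod_s iprod_Suc ST_Suc)

lemma Rm_UB: "i \<le> k \<Longrightarrow> k \<le> N \<Longrightarrow> Rm (Up k) Cb = (-1) ^ (Suc N - k) * S N * t (Suc N) / S k"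
  by (simp add: Rm_def iprod_uminus iprod_s iprod_Suc ST_Suc Suc_diff_le)

lemma Rm_UD: "i \<le> k \<Longrightarrow> k \<le> N \<Longrightarrow> i \<le> l \<Longrightarrow> l \<le> N \<Longrightarrow>
    Rm (Up k) (Dn l) = (-1) ^ (Suc N - k) * (S N * T N * (s (Suc N) * t (Suc N))) / (S k * T l)"
  by (simp add: Rm_def iprod_uminus iprod_s iprod_t iprod_Suc ST_Suc sign_mult mult_ac)

lemma Rm_AD: "i \<le> l \<Longrightarrow> l \<le> N \<Longrightarrow> Rm Ca (Dn l) = T N * t (Suc N) / T l"
  by (simp add: Rm_def iprod_uminus iprod_t iprod_Suc ST_Suc sign_mult mult_ac)

lemma Rm_BD: "i \<le> l \<Longrightarrow> l \<le> N \<Longrightarrow> Rm Cb (Dn l) = T N * s (Suc N) / T l"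
  by (simp add: Rm_def iprod_uminus iprod_t iprod_Suc ST_Suc sign_mult mult_ac Suc_diff_le)

lemma Rm_DD: "i \<le> l \<Longrightarrow> l < k \<Longrightarrow> k \<le> N \<Longrightarrow> Rm (Dn k) (Dn l) = g k * s k * T k / (t k * T l)"
proof -
  assume a: "i \<le> l" "l < k" "k \<le> N"
  then obtain k' where k': "k = Suc k'" by (cases k) auto
  have "Rm (Dn k) (Dn l) = (-1) ^ (k - l) * - (t k + s k) * iprod (\<lambda>j. - t j) l k'"
    using a k' by (simp add: Rm_def)
  also have "t k + s k = g k * s k" using a v_g(2)[of k] by (simp add: u)
  finally show ?thesis
    using a k' t0[of k] by (simp add: iprod_uminus iprod_t iprod_Suc ST_Suc Suc_diff_le sign_mult mult_ac)
qed

end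

text \<open>The signed permutation \<open>wcol\<close> expressed in labels, irrespective of how
  \<open>Ca\<close> and \<open>Cb\<close> are placed.\<close>

fun wlab :: "nat \<Rightarrow> nat \<Rightarrow> (lab \<Rightarrow> 'a::field) \<Rightarrow> lab \<Rightarrow> 'a" where
  "wlab N i f (Up l) = (if l < i then f (Up l) else (-1) ^ (Suc N - i) * f (Dn l))"
| "wlab N i f (Dn l) = (if l < i then f (Dn l) else (-1) ^ (Suc N - i) * f (Up l))"
| "wlab N i f Ca = (-1) ^ (Suc N - i) * f (if even (Suc N - i) then Ca else Cb)"
| "wlab N i f Cb = (-1) ^ (Suc N - i) * f (if even (Suc N - i) then Cb else Ca)"

lemma wcol_wlab:
  "1 \<le> i \<Longrightarrow> i \<le> Suc N \<Longrightarrow> vlab N y \<Longrightarrow> wcol N i f (lab_pos N e y) = wlab N i (\<lambda>z. f (lab_pos N e z)) y"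
  by (cases y) (simp_all add: wcol_lab del: lab_pos.simps)

lemma wlab_cong: "vlab N y \<Longrightarrow> (\<And>z. vlab N z \<Longrightarrow> f z = h z) \<Longrightarrow> wlab N i f y = wlab N i h y"
  by (cases y) auto

context row_params
begin

lemma R_simps:
  "k \<le> N \<Longrightarrow> l \<le> N \<Longrightarrow> R (Up k) (Up l) = (if k = l then 1 else if i \<le> k \<and> k < l then g k * T k / T l else 0)"
  "k \<le> N \<Longrightarrow> R (Up k) Ca = (if i \<le> k then g k * T k / (T N * bn) else 0)"
  "k \<le> N \<Longrightarrow> R (Up k) Cb = (if i \<le> k then g k * T k / (T N * an) else 0)"
  "k \<le> N \<Longrightarrow> l \<le> N \<Longrightarrow> R (Up k) (Dn l) = (if i \<le> k \<and> i \<le> l then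
     (-1) ^ (Suc N - l) * (g k * T k) * (g l * S l) / (T N * S N * (an * bn)) else 0)"
  "R Ca (Up l) = 0" "R Ca Ca = 1" "R Ca Cb = 0"
  "l \<le> N \<Longrightarrow> R Ca (Dn l) = (if i \<le> l then (-1) ^ (Suc N - l) * (g l * S l) / (S N * an) else 0)"
  "R Cb (Up l) = 0" "R Cb Ca = 0" "R Cb Cb = 1"
  "l \<le> N \<Longrightarrow> R Cb (Dn l) = (if i \<le> l then (-1) ^ (Suc N - l) * (g l * S l) / (S N * bn) else 0)"
  "R (Dn k) (Up l) = 0" "R (Dn k) Ca = 0" "R (Dn k) Cb = 0"
  "k \<le> N \<Longrightarrow> R (Dn k) (Dn l) = (if k = l then 1 else if i \<le> l \<and> l < k then
     (-1) ^ (k - l) * (g l * S l) * s k / (t k * S k) else 0)"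
  using R_UU[of k l] R_UA[of k] R_UB[of k] R_UD[of k l] R_AD[of l] R_BD[of l] R_DD[of l k]
  by (simp_all add: R_def)

lemma Rm_simps:
  "k \<le> N \<Longrightarrow> l \<le> N \<Longrightarrow> Rm (Up k) (Up l) = (if k = l then 1 else if i \<le> k \<and> k < l
     then (-1) ^ (l - k) * g l * S l / S k else 0)"
  "k \<le> N \<Longrightarrow> Rm (Up k) Ca = (if i \<le> k then (-1) ^ (Suc N - k) * S N * s (Suc N) / S k else 0)"
  "k \<le> N \<Longrightarrow> Rm (Up k) Cb = (if i \<le> k then (-1) ^ (Suc N - k) * S N * t (Suc N) / S k else 0)"
  "k \<le> N \<Longrightarrow> l \<le> N \<Longrightarrow> Rm (Up k) (Dn l) = (if i \<le> k \<and> i \<le> l then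
     (-1) ^ (Suc N - k) * (S N * T N * (s (Suc N) * t (Suc N))) / (S k * T l) else 0)"
  "Rm Ca (Up l) = 0" "Rm Ca Ca = 1" "Rm Ca Cb = 0"
  "l \<le> N \<Longrightarrow> Rm Ca (Dn l) = (if i \<le> l then T N * t (Suc N) / T l else 0)"
  "Rm Cb (Up l) = 0" "Rm Cb Ca = 0" "Rm Cb Cb = 1"
  "l \<le> N \<Longrightarrow> Rm Cb (Dn l) = (if i \<le> l then T N * s (Suc N) / T l else 0)"
  "Rm (Dn k) (Up l) = 0" "Rm (Dn k) Ca = 0" "Rm (Dn k) Cb = 0"
  "k \<le> N \<Longrightarrow> Rm (Dn k) (Dn l) = (if k = l then 1 else if i \<le> l \<and> l < k then
     g k * s k * T k / (t k * T l) else 0)"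
  using Rm_UU[of k l] Rm_UA[of k] Rm_UB[of k] Rm_UD[of k l] Rm_AD[of l] Rm_BD[of l] Rm_DD[of l k]
  by (simp_all add: Rm_def)

text \<open>The inner \<open>wlab\<close> permutes the columns of \<open>R_i(-t,-s)\<close> by
  \<open>w_i\<close>; the outer one permutes the rows by the inverse of
  \<open>w_{i+1}\<close>.\<close>

definition "Z x y = wlab N (Suc i) (\<lambda>x'. wlab N i (Rm x') y) x"

text \<open>The value at \<open>k = i\<close> is, up to sign, the corner entry of
  \<open>R_i(-t,-s)\<close> in row \<open>i\<close> and column \<open>hat n i\<close>, which
  \<open>w_i\<close> brings to the diagonal.\<close>

definition "d k = (if k < i then 1 else if k = i then S (Suc N) * T (Suc N) else s k / t k)"

fun dg :: "lab \<Rightarrow> 'a" where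
  "dg (Up k) = d k"
| "dg (Dn k) = inverse (d k)"
| "dg Ca = (if e then d (Suc N) else inverse (d (Suc N)))"
| "dg Cb = (if e then inverse (d (Suc N)) else d (Suc N))"

text \<open>The labels whose rows of \<open>Z\<close> need a correction by row \<open>i\<close>. The
  row \<open>Dn i\<close> is excluded from the comparison and is governed by orthogonality
  instead.\<close>

fun mid :: "lab \<Rightarrow> bool" where
  "mid (Up k) \<longleftrightarrow> i < k" | "mid (Dn k) \<longleftrightarrow> i < k" | "mid Ca \<longleftrightarrow> True" | "mid Cb \<longleftrightarrow> True"

lemma sign_diff: "a \<le> b \<Longrightarrow> (-1 :: 'a) ^ (b - a) = (-1) ^ b * (-1) ^ a"
proof -
  assume "a \<le> b"
  then have "(-1 :: 'a) ^ b * (-1) ^ a = (-1) ^ (b - a) * ((-1) ^ a * (-1) ^ a)"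
    by (metis le_add_diff_inverse2 mult.assoc power_add)
  then show ?thesis by (simp add: power_add[symmetric])
qed

lemma sign_square: "(-1 :: 'a) ^ a * (-1) ^ a = 1" "(-1 :: 'a) ^ a * ((-1) ^ a * x) = x"
  by (simp_all add: power_add[symmetric] mult.assoc[symmetric])

lemma e_parity: "even (N - i) \<longleftrightarrow> \<not> e" "even (Suc N - i) \<longleftrightarrow> e"
  using i by (simp_all add: e Suc_diff_le)

lemma nz: "S N \<noteq> 0" "T N \<noteq> 0" "s (Suc N) \<noteq> 0" "t (Suc N) \<noteq> 0"
  using i ST0[of N] s0[of "Suc N"] t0[of "Suc N"] by auto

lemmas Z_simps = Z_def d_def R_simps Rm_simps e_parity sign_square ST_Suc ST_base v_g
  an_def bn_def

text \<open>For \<open>k < i\<close> all matrices involved have unit vectors as rows. Row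
  \<open>i\<close> of \<open>Z\<close> is exactly \<open>d i\<close> times that of
  \<open>R_i\<close>, so a correction occurs only for \<open>k > i\<close>.\<close>

lemma Z_row_U:
  assumes "1 \<le> k" "k \<le> N" "vlab N y"
  shows "Z (Up k) y = d k * R (Up k) y + (if i < k then Z (Up k) (Up i) * R (Up i) y else 0)"
proof (cases k i rule: linorder_cases)
  case less
  then show ?thesis using assms i
    by (cases y) (auto simp: Z_def d_def R_simps Rm_simps e_parity simp del: even_diff_nat)
next
  case equal
  have sg: "(-1 :: 'a) ^ (Suc N - i) * ((-1) ^ (l - i) * x) = (-1) ^ (Suc N - l) * x" if "i \<le> l" "l \<le> N" for l x
    using that by (simp add: sign_diff sign_square mult_ac del: power_Suc)
  show ?thesis using assms i equal nz ST0[of "case y of Up l \<Rightarrow> l | Dn l \<Rightarrow> l"]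
    apply (cases y)
    apply (auto simp: Z_simps sg mult.assoc simp del: power_Suc even_diff_nat)
    done
next
  case greater
  have gs: "s k * g k = s k + t k"
    using v_g(2)[of k] greater assms by (simp add: u mult.commute add.commute)
  show ?thesis using assms i greater nz ST0[of "case y of Up l \<Rightarrow> l | Dn l \<Rightarrow> l"] ST0[of k] s0[of k] t0[of k] g0[of k]
    apply (cases y)
    apply (auto simp: Z_simps Suc_diff_le mult.assoc simp del: power_Suc even_diff_nat)
    apply (auto simp: field_simps gs)
    done
qed

lemma Z_row_AB:
  assumes "vlab N y"
  shows "Z Ca y = dg Ca * R Ca y + Z Ca (Up i) * R (Up i) y \<and>
    Z Cb y = dg Cb * R Cb y + Z Cb (Up i) * R (Up i) y"
  using assms i nz ST0[of "case y of Up l \<Rightarrow> l | Dn l \<Rightarrow> l"] g0[of "case y of Up l \<Rightarrow> l | Dn l \<Rightarrow> l"]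
  apply (cases y)
  apply (auto simp: Z_simps Suc_diff_le mult.assoc simp del: power_Suc even_diff_nat)
  done

lemma Z_row_D:
  assumes "1 \<le> k" "k \<le> N" "vlab N y" "k \<noteq> i"
  shows "Z (Dn k) y = inverse (d k) * R (Dn k) y + (if i < k then Z (Dn k) (Up i) * R (Up i) y else 0)"
proof (cases "k < i")
  case True
  then show ?thesis using assms i
    by (cases y) (auto simp: Z_def d_def R_simps Rm_simps e_parity simp del: even_diff_nat)
next
  case False
  then have k: "i < k" using assms by auto
  have gs: "s k * g k = s k + t k"
    using v_g(2)[of k] k assms by (simp add: u mult.commute add.commute)
  have sg1: "(-1 :: 'a) ^ (k - l) = (-1) ^ (N - l) * (-1) ^ (N - k)" if "l \<le> k" for l
    using that k assms by (simp add: sign_diff sign_square mult_ac)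
  have sg2: "(-1 :: 'a) ^ (l - k) = (-1) ^ (N - l) * (-1) ^ (N - k)" if "k \<le> l" "l \<le> N" for l
    using that k assms by (simp add: sign_diff sign_square mult_ac)
  show ?thesis using assms i k nz ST0[of "case y of Up l \<Rightarrow> l | Dn l \<Rightarrow> l"] ST0[of k] s0[of k] t0[of k] g0[of k]
    g0[of "case y of Up l \<Rightarrow> l | Dn l \<Rightarrow> l"]
    apply (cases y)
    apply (auto simp: Z_simps Suc_diff_le mult.assoc simp del: power_Suc even_diff_nat)
    apply (auto simp: field_simps gs sg1)
    apply (rule sg2; simp)
    done
qed

text \<open>A row of \<open>Z\<close> in the block differs from that of \<open>D R\<^sub>i\<close> by a multiple of the \<open>i\<close>-th row only, because
  from the diagonal on, the \<open>k\<close>-th row of \<open>R\<^sub>i\<close> is proportional to the \<open>i\<close>-th one.\<close>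

lemma Z_row:
  assumes "vlab N x" "vlab N y" "x \<noteq> Dn i"
  shows "Z x y = dg x * R x y + (if mid x then Z x (Up i) * R (Up i) y else 0)"
  using assms Z_row_U[of _ y] Z_row_D[of _ y] Z_row_AB[of y] by (cases x) auto

end

section \<open>Diagonal matrices\<close>

text \<open>A position \<open>a \<ge> n\<close>, counted from 0, is the index
  \<open>hat n (2 * n - a)\<close>, counted from 1.\<close>

definition tdiag :: "nat \<Rightarrow> (nat \<Rightarrow> 'a::field) \<Rightarrow> nat \<Rightarrow> 'a" where
  "tdiag n d a = (if a < n then d (Suc a) else inverse (d (2 * n - a)))"

lemma torus_mat_carrier [simp]: "torus_mat n d \<in> sqmats n"
  by (simp add: torus_mat_def)

lemma torus_mat_dim [simp]: "dim_row (torus_mat n d) = 2*n" "dim_col (torus_mat n d) = 2*n"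
  by (simp_all add: torus_mat_def)

lemma torus_mat_index:
  assumes "a < 2*n" "b < 2*n"
  shows "torus_mat n d $$ (a, b) = (if a = b then tdiag n d a else 0)"
proof -
  have "torus_mat n d $$ (a, b) = (\<Sum>k\<in>{1..n}. (if k = Suc a then (if a = b then d k else 0) else 0)
      + (if k = 2 * n - a then (if a = b then inverse (d k) else 0) else 0))"
    unfolding torus_mat_def using assms by (auto simp: munit_def hat_def intro!: sum.cong)
  also have "\<dots> = (if a = b then tdiag n d a else 0)"
    using assms by (auto simp: sum.distrib tdiag_def)
  finally show ?thesis .
qed

lemma tdiag_opp:
  assumes "a < 2*n" "\<And>k. d k \<noteq> 0"
  shows "tdiag n d (opp n a) = inverse (tdiag n d a)"
  using assms by (auto simp: tdiag_def opp_def Suc_diff_Suc)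

lemma tdiag_nonzero: "(\<And>k. d k \<noteq> 0) \<Longrightarrow> tdiag n d a \<noteq> 0"
  by (simp add: tdiag_def)

lemma mult_torus_index:
  assumes "M \<in> sqmats n" "a < 2*n" "b < 2*n"
  shows "(M * torus_mat n d) $$ (a, b) = M $$ (a, b) * tdiag n d b"
proof -
  have "(M * torus_mat n d) $$ (a, b) = (\<Sum>k<2*n. if k = b then M $$ (a, b) * tdiag n d b else 0)"
    unfolding index_mult_sum[OF assms(1) torus_mat_carrier assms(2,3)]
    by (rule sum.cong) (use assms in \<open>auto simp: torus_mat_index\<close>)
  then show ?thesis using assms by simp
qed

lemma torus_mult_index:
  assumes "M \<in> sqmats n" "a < 2*n" "b < 2*n"
  shows "(torus_mat n d * M) $$ (a, b) = tdiag n d a * M $$ (a, b)"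
proof -
  have "(torus_mat n d * M) $$ (a, b) = (\<Sum>k<2*n. if k = a then tdiag n d a * M $$ (a, b) else 0)"
    unfolding index_mult_sum[OF torus_mat_carrier assms]
    by (rule sum.cong) (use assms in \<open>auto simp: torus_mat_index\<close>)
  then show ?thesis using assms by simp
qed

lemma torus_mat_mult: "torus_mat n d * torus_mat n d' = torus_mat n (\<lambda>k. d k * d' k)"
proof (rule eq_matI)
  let ?R = "torus_mat n (\<lambda>k. d k * d' k)"
  fix a b assume "a < dim_row ?R" "b < dim_col ?R"
  then have ab: "a < 2*n" "b < 2*n" by (simp_all add: torus_mat_def)
  show "(torus_mat n d * torus_mat n d') $$ (a, b) = ?R $$ (a, b)"
    unfolding mult_torus_index[OF torus_mat_carrier ab] using ab
    by (simp add: torus_mat_index tdiag_def)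
qed (simp_all add: torus_mat_def)

lemma torus_mat_cong: "(\<And>k. 1 \<le> k \<Longrightarrow> k \<le> n \<Longrightarrow> d k = d' k) \<Longrightarrow> torus_mat n d = torus_mat n d'"
  by (rule eq_matI) (auto simp: torus_mat_def munit_def intro!: sum.cong)

lemma torus_mat_diagonal: "diagonal_mat (torus_mat n d)"
  by (auto simp: diagonal_mat_def torus_mat_index)

text \<open>Entries at opposite positions are inverse to each other, which gives both the invariance
  of the form and the determinant 1.\<close>

lemma torus_mat_SO:
  fixes d :: "nat \<Rightarrow> 'a::field"
  assumes d: "\<And>k. d k \<noteq> 0"
  shows "torus_mat n d \<in> SO n"
proof -
  let ?T = "torus_mat n d"
  have tr: "transpose_mat ?T = ?T"
    by (rule eq_matI) (auto simp: torus_mat_index)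
  have c: "?T * form_mat n \<in> sqmats n"
    by (rule square_mult_carrier) auto
  have "transpose_mat ?T * form_mat n * ?T = form_mat n"
  proof (rule eq_matI)
    fix a b assume "a < dim_row (form_mat n :: 'a mat)" "b < dim_col (form_mat n :: 'a mat)"
    then have ab: "a < 2*n" "b < 2*n" by (auto simp: form_mat_def)
    show "(transpose_mat ?T * form_mat n * ?T) $$ (a, b) = form_mat n $$ (a, b)"
      unfolding tr mult_torus_index[OF c ab] torus_mult_index[OF form_mat_carrier ab]
      using ab tdiag_opp[of a n d] tdiag_nonzero[of d n a] d by (auto simp: form_mat_index)
  qed (auto simp: form_mat_def torus_mat_def)
  moreover have "Determinant.det ?T = 1"
  proof -
    have "Determinant.det ?T = prod_list (diag_mat ?T)"
      by (rule det_upper_triangular[OF _ torus_mat_carrier])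
         (auto simp: upper_triangular_def torus_mat_index)
    also have "\<dots> = (\<Prod>a<2*n. ?T $$ (a, a))"
      by (simp add: diag_mat_def prod.list_conv_set_nth lessThan_atLeast0)
    also have "\<dots> = (\<Prod>a<2*n. tdiag n d a)"
      by (rule prod.cong) (auto simp: torus_mat_index)
    also have "{..<2*n} = {..<n} \<union> opp n ` {..<n}"
    proof -
      have "x \<in> opp n ` {..<n}" if "x < 2*n" "\<not> x < n" for x
        using that by (intro image_eqI[of _ _ "opp n x"]) (auto simp: opp_def)
      then show ?thesis by (auto simp: opp_def)
    qed
    also have "(\<Prod>a\<in>{..<n} \<union> opp n ` {..<n}. tdiag n d a)
      = (\<Prod>a<n. tdiag n d a) * (\<Prod>a<n. tdiag n d (opp n a))"
    proof -
      have "{..<n} \<inter> opp n ` {..<n} = {}" "inj_on (opp n) {..<n}"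
        by (auto simp: inj_on_def opp_def)
      then show ?thesis by (simp add: prod.union_disjoint prod.reindex comp_def)
    qed
    also have "\<dots> = (\<Prod>a<n. tdiag n d a * tdiag n d (opp n a))"
      by (rule prod.distrib[symmetric])
    also have "\<dots> = (\<Prod>a<n. 1)"
      by (rule prod.cong) (use d in \<open>auto simp: tdiag_opp tdiag_nonzero\<close>)
    finally show ?thesis by simp
  qed
  ultimately show ?thesis by (simp add: SO_def)
qed

text \<open>The torus acts on a root subgroup through a character; both matrix units scale alike
  because opposite diagonal entries are inverse.\<close>

lemma root_mat_mult_torus:
  fixes c :: "'a::field"
  assumes ab: "a < 2*n" "b < 2*n" and d: "\<And>k. d k \<noteq> 0"
  shows "root_mat n a b c * torus_mat n d
    = torus_mat n d * root_mat n a b (c * tdiag n d b / tdiag n d a)"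
proof (rule eq_matI)
  let ?R = "torus_mat n d * root_mat n a b (c * tdiag n d b / tdiag n d a)"
  fix i j assume "i < dim_row ?R" "j < dim_col ?R"
  then have ij: "i < 2*n" "j < 2*n" by (simp_all add: torus_mat_def)
  have nz: "tdiag n d k \<noteq> 0" for k using d by (simp add: tdiag_def)
  let ?c = "c * tdiag n d b / tdiag n d a"
  have opps: "tdiag n d (opp n a) = inverse (tdiag n d a)" "tdiag n d (opp n b) = inverse (tdiag n d b)"
    using tdiag_opp[of _ n d] ab d by auto
  have h: "(if i = j then 1 else 0) * tdiag n d j = tdiag n d i * (if i = j then 1 else 0)"
    "(if i = a \<and> j = b then c else 0) * tdiag n d j = tdiag n d i * (if i = a \<and> j = b then ?c else 0)"
    "(if i = opp n b \<and> j = opp n a then c else 0) * tdiag n d j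
      = tdiag n d i * (if i = opp n b \<and> j = opp n a then ?c else 0)"
    using nz[of a] nz[of b] by (simp_all add: opps field_simps)
  show "(root_mat n a b c * torus_mat n d) $$ (i, j) = ?R $$ (i, j)"
    unfolding mult_torus_index[OF root_mat_carrier ij] torus_mult_index[OF root_mat_carrier ij]
      root_mat_index[OF ij]
      distrib_left distrib_right left_diff_distrib right_diff_distrib h ..
qed (simp_all add: torus_mat_def)

definition rescale :: "nat \<Rightarrow> (nat \<Rightarrow> 'a::field) \<Rightarrow> 'a \<times> gen \<Rightarrow> 'a \<times> gen" where
  "rescale n d = (\<lambda>(c, g). (c * tdiag n d (dst n g) / tdiag n d (src n g), g))"

lemma mat_prod_rescale:
  assumes "\<And>c g. (c, g) \<in> set w \<Longrightarrow> valid_gen n g" and d: "\<And>k. d k \<noteq> 0"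
  shows "mat_prod n (map (\<lambda>(c, g). root_mat n (src n g) (dst n g) c) w) * torus_mat n d
    = torus_mat n d * mat_prod n (map (\<lambda>(c, g). root_mat n (src n g) (dst n g) c) (map (rescale n d) w))"
  using assms(1)
proof (induction w)
  case Nil
  show ?case
    by (simp add: left_mult_one_mat[OF torus_mat_carrier] right_mult_one_mat[OF torus_mat_carrier])
next
  case (Cons cg w)
  obtain c g where cg: "cg = (c, g)" by (cases cg)
  let ?f = "\<lambda>(c, g). root_mat n (src n g) (dst n g) c"
  let ?P = "mat_prod n (map ?f w)" and ?Q = "mat_prod n (map ?f (map (rescale n d) w))"
  let ?c = "c * tdiag n d (dst n g) / tdiag n d (src n g)"
  have P: "?P \<in> sqmats n" "?Q \<in> sqmats n"
    by (rule mat_prod_carrier, auto simp: rescale_def)+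
  have g: "valid_gen n g" using Cons.prems cg by auto
  have IH: "?P * torus_mat n d = torus_mat n d * ?Q"
    by (rule Cons.IH) (use Cons.prems in auto)
  have "root_mat n (src n g) (dst n g) c * ?P * torus_mat n d
    = root_mat n (src n g) (dst n g) c * (torus_mat n d * ?Q)"
    unfolding assoc_mult_mat[OF root_mat_carrier P(1) torus_mat_carrier] IH ..
  also have "\<dots> = root_mat n (src n g) (dst n g) c * torus_mat n d * ?Q"
    by (rule assoc_mult_mat[OF root_mat_carrier torus_mat_carrier P(2), symmetric])
  also have "\<dots> = torus_mat n d * root_mat n (src n g) (dst n g) ?c * ?Q"
    using root_mat_mult_torus[OF valid_gen_src_dst(2,3)[OF g], of d c] d by simp
  also have "\<dots> = torus_mat n d * (root_mat n (src n g) (dst n g) ?c * ?Q)"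
    by (rule assoc_mult_mat[OF torus_mat_carrier root_mat_carrier P(2)])
  finally show ?case by (simp add: cg rescale_def)
qed

text \<open>The factor acquired by the parameter of \<open>Spin 1\<close> (if \<open>b\<close>) or
  of \<open>Spin (-1)\<close> when the torus element moves to its left.\<close>

definition spin_scale :: "nat \<Rightarrow> (nat \<Rightarrow> 'a::field) \<Rightarrow> bool \<Rightarrow> 'a" where
  "spin_scale n d b = (if b then d n else inverse (d n)) / d (n - 1)"

text \<open>The parities in the last column are opposite because \<open>p k n\<close> belongs to the
  exponent \<open>eps (n - k + 1)\<close> and \<open>q k n\<close> to
  \<open>eps (n - k)\<close>.\<close>

lemma R_mat_mult_torus:
  assumes k: "1 \<le> k" "k < n" and d: "\<And>k. d k \<noteq> 0"
    and p': "\<And>j. k < j \<Longrightarrow> j < n \<Longrightarrow> p' k j = p k j * (d j / d (j - 1))"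
    and q': "\<And>j. k < j \<Longrightarrow> j < n \<Longrightarrow> q' k j = q k j * (d j / d (j - 1))"
    and pn: "p' k n = p k n * spin_scale n d (odd (n - k))"
    and qn: "q' k n = q k n * spin_scale n d (even (n - k))"
  shows "R_mat n p q k * torus_mat n d = torus_mat n d * R_mat n p' q' k"
proof -
  have "eps (n - k) = 1 \<longleftrightarrow> even (n - k)" "eps (n - k + 1) = 1 \<longleftrightarrow> odd (n - k)"
    unfolding eps_eq_1_iff by simp_all
  moreover have "tdiag n d (n - 1) = d n" "tdiag n d n = inverse (d n)" "tdiag n d (n - 2) = d (n - 1)"
    using k by (auto simp: tdiag_def Suc_diff_Suc numeral_2_eq_2)
  moreover have "tdiag n d (j - Suc 0) = d j" "tdiag n d (j - Suc (Suc 0)) = d (j - Suc 0)"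
    if "k < j" "j < n" for j
    using k that by (auto simp: tdiag_def Suc_diff_Suc)
  ultimately have w: "map (rescale n d) (R_word n p q k) = R_word n p' q' k"
    unfolding R_word_def rescale_def by (auto simp: p' q' pn qn spin_scale_def)
  show ?thesis
    unfolding R_mat_def w[symmetric]
    by (rule mat_prod_rescale) (use d R_word_valid[OF k] in auto)
qed

lemma X_part_mult_torus:
  assumes i: "1 \<le> i" "i \<le> n" and d: "\<And>k. d k \<noteq> 0"
    and "\<And>k j. i \<le> k \<Longrightarrow> k < j \<Longrightarrow> j < n \<Longrightarrow> p' k j = p k j * (d j / d (j - 1))"
    and "\<And>k j. i \<le> k \<Longrightarrow> k < j \<Longrightarrow> j < n \<Longrightarrow> q' k j = q k j * (d j / d (j - 1))"
    and "\<And>k. i \<le> k \<Longrightarrow> k < n \<Longrightarrow> p' k n = p k n * spin_scale n d (odd (n - k))"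
    and "\<And>k. i \<le> k \<Longrightarrow> k < n \<Longrightarrow> q' k n = q k n * spin_scale n d (even (n - k))"
  shows "X_part n p q i * torus_mat n d = torus_mat n d * X_part n p' q' i"
  using i(2,1) assms(4-)
proof (induction i rule: inc_induct)
  case base
  then show ?case
    by (simp add: X_part_top left_mult_one_mat[OF torus_mat_carrier] right_mult_one_mat[OF torus_mat_carrier])
next
  case (step i)
  have i: "1 \<le> i" "i < n" using step by auto
  have R: "R_mat n p q i * torus_mat n d = torus_mat n d * R_mat n p' q' i"
    using i d step.prems by (intro R_mat_mult_torus) auto
  have IH: "X_part n p q (Suc i) * torus_mat n d = torus_mat n d * X_part n p' q' (Suc i)"
    by (rule step.IH) (use step.prems in auto)
  have c [simp]: "R_mat n p q i \<in> sqmats n" "R_mat n p' q' i \<in> sqmats n"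
    "X_part n p q (Suc i) \<in> sqmats n" "X_part n p' q' (Suc i) \<in> sqmats n"
    using i by (auto intro!: SO_carrier R_mat_SO X_part_SO)
  have "X_part n p q i * torus_mat n d = X_part n p q (Suc i) * (R_mat n p q i * torus_mat n d)"
    unfolding X_part_rec[OF i] by (simp add: square_assoc[where n=n])
  also have "\<dots> = X_part n p q (Suc i) * torus_mat n d * R_mat n p' q' i"
    unfolding R by (simp add: square_assoc[where n=n])
  also have "\<dots> = torus_mat n d * X_part n p' q' i"
    unfolding IH X_part_rec[OF i] by (simp add: square_assoc[where n=n])
  finally show ?case .
qed

section \<open>Existence of the factorization\<close>

definition block_id :: "nat \<Rightarrow> nat \<Rightarrow> 'a::field mat \<Rightarrow> bool" where
  "block_id n m M \<longleftrightarrow> M \<in> sqmats n \<and>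
     (\<forall>a<2*n. \<forall>b<2*n. a < m \<or> 2*n - m \<le> a \<or> b < m \<or> 2*n - m \<le> b \<longrightarrow>
        M $$ (a, b) = (if a = b then 1 else 0))"

lemma block_id_mult:
  assumes "block_id n m M" "block_id n m M'"
  shows "block_id n m (M * M')"
proof -
  have c: "M \<in> sqmats n" "M' \<in> sqmats n"
    using assms by (auto simp: block_id_def)
  have "(M * M') $$ (a, b) = (if a = b then 1 else 0)"
    if ab: "a < 2*n" "b < 2*n" and out: "a < m \<or> 2*n - m \<le> a \<or> b < m \<or> 2*n - m \<le> b" for a b
  proof (cases "a < m \<or> 2*n - m \<le> a")
    case True
    have "(M * M') $$ (a, b) = (\<Sum>k<2*n. if k = a then M' $$ (a, b) else 0)"
      unfolding index_mult_sum[OF c ab]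
      by (rule sum.cong) (use assms(1) True ab in \<open>auto simp: block_id_def\<close>)
    then show ?thesis using assms(2) True ab by (auto simp: block_id_def)
  next
    case False
    then have b: "b < m \<or> 2*n - m \<le> b" using out by auto
    have "(M * M') $$ (a, b) = (\<Sum>k<2*n. if k = b then M $$ (a, b) else 0)"
      unfolding index_mult_sum[OF c ab]
      by (rule sum.cong) (use assms(2) b ab in \<open>auto simp: block_id_def\<close>)
    then show ?thesis using assms(1) b ab by (auto simp: block_id_def)
  qed
  then show ?thesis using c by (auto simp: block_id_def intro: square_mult_carrier)
qed

lemma block_id_one: "block_id n m (1\<^sub>m (2*n))"
  by (auto simp: block_id_def)

lemma block_id_mat_prod:
  "(\<And>M. M \<in> set Ms \<Longrightarrow> block_id n m M) \<Longrightarrow> block_id n m (mat_prod n Ms)"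
  by (induction Ms) (auto intro: block_id_mult block_id_one)

lemma block_id_root_mat:
  assumes "m \<le> a" "a < 2*n - m" "m \<le> b" "b < 2*n - m"
  shows "block_id n m (root_mat n a b c)"
proof -
  have "m \<le> opp n a" "opp n a < 2*n - m" "m \<le> opp n b" "opp n b < 2*n - m"
    using assms by (auto simp: opp_def)
  then show ?thesis using assms by (auto simp: block_id_def root_mat_index)
qed

lemma block_id_X_part:
  assumes "1 \<le> i" "i \<le> n"
  shows "block_id n (i - 1) (X_part n p q i)"
  unfolding X_part_def R_mat_def
proof (rule block_id_mat_prod, clarsimp, rule block_id_mat_prod, clarsimp)
  fix k c g assume k: "i \<le> k" "k < n" and g: "(c, g) \<in> set (R_word n p q k)"
  have "i - 1 \<le> src n g \<and> src n g < 2*n - (i - 1) \<and> i - 1 \<le> dst n g \<and> dst n g < 2*n - (i - 1)"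
    using g k assms by (auto simp: R_word_def)
  then show "block_id n (i - Suc 0) (root_mat n (src n g) (dst n g) c)"
    by (intro block_id_root_mat) auto
qed

text \<open>The outer \<open>m\<close> rows and columns of \<open>X\<close> are trivial, so in the
  first \<open>2 * n - m\<close> rows conjugation merely replaces the column \<open>c\<close> by its
  image \<gamma> under \<open>X\<close>, which still vanishes in the first \<open>m\<close> rows.
  For the remaining rows, everything above the diagonal lies in the last \<open>m\<close> columns,
  and these are forced by orthogonality.\<close>

lemma lower_unipotent_conj:
  fixes L X :: "'a::field mat"
  assumes L: "L \<in> SO n" and X: "X \<in> SO n" "block_id n m X" and m: "1 \<le> m" "m \<le> n"
    and Lrow: "\<And>a b. a < 2*n - m \<Longrightarrow> b < 2*n \<Longrightarrow>
      L $$ (a, b) = (if a = b then 1 else 0) + (if b = m - 1 then c a else 0)"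
    and c0: "\<And>a. a < m \<Longrightarrow> c a = 0"
  shows "lower_unipotent (X * L * adj n X)"
proof -
  let ?M = "X * L * adj n X"
  define \<gamma> where "\<gamma> a = (\<Sum>k<2*n - m. X $$ (a, k) * c k)" for a
  have cL: "L \<in> sqmats n" and cX: "X \<in> sqmats n"
    using L X by (auto intro: SO_carrier)
  have M: "?M \<in> SO n" by (intro SO_mult SO_adj L X)
  have Xz: "X $$ (a, b) = (if a = b then 1 else 0)"
    if "a < 2*n" "b < 2*n" "a < m \<or> 2*n - m \<le> a \<or> b < m \<or> 2*n - m \<le> b" for a b
    using X(2) that by (auto simp: block_id_def)
  have XL: "(X * L) $$ (a, b) = X $$ (a, b) + (if b = m - 1 then \<gamma> a else 0)"
    if a: "a < 2*n - m" and b: "b < 2*n" for a b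
  proof -
    have a': "a < 2*n" using a by simp
    have "(X * L) $$ (a, b) = (\<Sum>k<2*n. X $$ (a, k) * L $$ (k, b))"
      by (rule index_mult_sum[OF cX cL a' b])
    also have "\<dots> = (\<Sum>k<2*n - m. X $$ (a, k) * L $$ (k, b))"
      by (rule sum.mono_neutral_right) (use a Xz in auto)
    also have "\<dots> = (\<Sum>k<2*n - m. (if k = b then X $$ (a, b) else 0)
      + (if b = m - 1 then X $$ (a, k) * c k else 0))"
      by (rule sum.cong) (use b in \<open>auto simp: Lrow algebra_simps\<close>)
    also have "\<dots> = (if b < 2*n - m then X $$ (a, b) else 0) + (if b = m - 1 then \<gamma> a else 0)"
      by (simp add: sum.distrib \<gamma>_def)
    also have "(if b < 2*n - m then X $$ (a, b) else 0) = X $$ (a, b)"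
      using Xz[of a b] a b by auto
    finally show ?thesis .
  qed
  have \<gamma>0: "\<gamma> a = 0" if "a < m" for a
    unfolding \<gamma>_def using that Xz[of a] c0 m by (intro sum.neutral) auto
  have row: "?M $$ (a, b) = (if a = b then 1 else 0) + (if b = m - 1 then \<gamma> a else 0)"
    if a: "a < 2*n - m" and b: "b < 2*n" for a b
  proof -
    have a': "a < 2*n" using a by simp
    have XX: "(\<Sum>k<2*n. X $$ (a, k) * adj n X $$ (k, b)) = (if a = b then 1 else 0)"
      if "a < 2*n" for a
      using SO_adj_right[OF X(1)] index_mult_sum[OF cX adj_carrier that b, of X] that b by simp
    have "?M $$ (a, b) = (\<Sum>k<2*n. (X * L) $$ (a, k) * adj n X $$ (k, b))"
      by (rule index_mult_sum[OF square_mult_carrier[OF cX cL] adj_carrier a' b])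
    also have "\<dots> = (\<Sum>k<2*n. X $$ (a, k) * adj n X $$ (k, b)
        + (if k = m - 1 then \<gamma> a * adj n X $$ (m - 1, b) else 0))"
      by (rule sum.cong) (use a in \<open>auto simp: XL algebra_simps simp del: index_mult_mat\<close>)
    also have "\<dots> = (if a = b then 1 else 0) + \<gamma> a * adj n X $$ (m - 1, b)"
      using m by (simp add: sum.distrib XX[OF a'])
    also have "adj n X $$ (m - 1, b) = (if b = m - 1 then 1 else 0)"
    proof -
      have "adj n X $$ (m - 1, b) = X $$ (opp n b, opp n (m - 1))"
        using m b by (intro adj_index) auto
      also have "\<dots> = (if opp n b = opp n (m - 1) then 1 else 0)"
        using m b by (intro Xz) (auto simp: opp_def)
      finally show ?thesis using m b by simp
    qed
    finally show ?thesis by simp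
  qed
  \<comment> \<open>Row \<open>opp n b\<close> is a unit vector, so its pairing with row
    \<open>a\<close> reduces to the single entry \<open>(a, b)\<close>.\<close>
  have col: "?M $$ (a, b) = (if a = b then 1 else 0)" if a: "a < 2*n" and b: "2*n - m \<le> b" "b < 2*n" for a b
  proof -
    have ob: "opp n b < m" "opp n b < 2*n - m" "opp n b < 2*n" using b m by (auto simp: opp_def)
    have "(\<Sum>k<2*n. ?M $$ (opp n b, k) * ?M $$ (a, opp n k)) = (\<Sum>k<2*n. if k = opp n b then ?M $$ (a, b) else 0)"
      by (rule sum.cong) (use ob b in \<open>auto simp: row \<gamma>0 simp del: index_mult_mat\<close>)
    then have "?M $$ (a, b) = (if a = opp n (opp n b) then 1 else 0)"
      using SO_rows[OF M ob(3) a] ob by (simp del: index_mult_mat)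
    then show ?thesis using b by simp
  qed
  show ?thesis
  proof (rule lower_unipotentI[OF SO_carrier[OF M]])
    fix a assume a: "a < 2*n"
    show "?M $$ (a, a) = 1"
    proof (cases "a < 2*n - m")
      case True
      moreover have "\<gamma> a = 0" if "a = m - 1" using that m by (intro \<gamma>0) auto
      ultimately show ?thesis using row[OF True a] by auto
    next
      case False
      then show ?thesis using col[of a a] a by auto
    qed
  next
    fix a b assume ab: "a < b" "b < 2*n"
    show "?M $$ (a, b) = 0"
    proof (cases "a < 2*n - m")
      case True
      moreover have "\<gamma> a = 0" if "b = m - 1" using that ab m by (intro \<gamma>0) auto
      ultimately show ?thesis using row[OF True ab(2)] ab by auto
    next
      case False
      then show ?thesis using col[of a b] ab by auto
    qed
  qed
qed

lemma lower_unipotent_torus_conj: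
  fixes M :: "'a::field mat"
  assumes M: "M \<in> SO n" "lower_unipotent M" and d: "\<And>k. d k \<noteq> 0"
  shows "lower_unipotent (torus_mat n d * M * adj n (torus_mat n d))"
proof -
  have c: "M \<in> sqmats n" using M SO_carrier by blast
  have a: "adj n (torus_mat n d) = torus_mat n (\<lambda>k. inverse (d k))"
  proof (rule eq_matI)
    fix i j assume "i < dim_row (torus_mat n (\<lambda>k. inverse (d k)))" "j < dim_col (torus_mat n (\<lambda>k. inverse (d k)))"
    then have "i < 2*n" "j < 2*n" by auto
    then show "adj n (torus_mat n d) $$ (i, j) = torus_mat n (\<lambda>k. inverse (d k)) $$ (i, j)"
      using tdiag_opp[of i n d] d by (auto simp: adj_index torus_mat_index tdiag_def)
  qed (auto simp: adj_def)
  have entry: "(torus_mat n d * M * adj n (torus_mat n d)) $$ (i, j)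
    = tdiag n d i * M $$ (i, j) * inverse (tdiag n d j)" if ij: "i < 2*n" "j < 2*n" for i j
    unfolding a mult_torus_index[OF square_mult_carrier[OF torus_mat_carrier c] ij] torus_mult_index[OF c ij]
    by (simp add: tdiag_def)
  show ?thesis
    by (rule lower_unipotentI[of _ "2*n"])
       (use M(2) c d entry tdiag_nonzero[of d n] in
         \<open>auto simp: lower_unipotent_def intro!: square_mult_carrier simp del: index_mult_mat\<close>)
qed

lemma ent_R_mat:
  assumes "1 \<le> i" "i \<le> N" "vlab N x" "vlab N y"
  shows "ent N (even (Suc N - i)) (R_mat (Suc N) p q i) x y = ent_down N (p i) (q i) i i x y"
  unfolding R_mat_lab[OF assms(1,2)] R_lab_def
  by (rule ent_lab_prod_down) (use assms in auto)

lemma SO_conj_swap: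
  assumes "X \<in> SO n" "L \<in> sqmats n" "M \<in> sqmats n"
  shows "X * (L * M) = X * L * adj n X * (X * M)"
proof -
  note c = SO_carrier[OF assms(1)]
  have "X * L * adj n X * (X * M) = X * (L * (adj n X * (X * M)))"
    using assms c by (simp only: square_assoc[where n=n] adj_carrier)
  also have "adj n X * (X * M) = (adj n X * X) * M"
    by (rule assoc_mult_mat[OF adj_carrier c assms(3), symmetric])
  also have "\<dots> = M"
    by (simp only: SO_adj_left[OF assms(1)] left_mult_one_mat[OF assms(3)])
  finally show ?thesis ..
qed

text \<open>The locale constants \<open>pp i\<close> and \<open>qq i\<close> below are the parameters of the factorization of
  \<open>X\<^sub>i(-t,-s) w\<^sub>i\<close>: the formulas of the theorem with products over \<open>i \<le> l < k\<close>. Without these products they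
  are \<open>pb\<close> and \<open>qb\<close>, and \<open>dd l\<close> is the diagonal matrix \<open>D\<close> belonging to the row \<open>l\<close>.\<close>

locale params =
  fixes N :: nat and t s :: "nat \<Rightarrow> nat \<Rightarrow> 'a::field"
  assumes N: "1 \<le> N"
    and s0: "\<And>i j. 1 \<le> i \<Longrightarrow> i < j \<Longrightarrow> j \<le> Suc N \<Longrightarrow> s i j \<noteq> 0"
    and t0: "\<And>i j. 1 \<le> i \<Longrightarrow> i < j \<Longrightarrow> j \<le> Suc N \<Longrightarrow> t i j \<noteq> 0"
    and ts0: "\<And>i j. 1 \<le> i \<Longrightarrow> i < j \<Longrightarrow> j \<le> N \<Longrightarrow> t i j + s i j \<noteq> 0"
begin

definition ur :: "nat \<Rightarrow> nat \<Rightarrow> 'a" where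
  "ur i j = (if j = i then 1 else t i j + s i j)"

definition vr :: "nat \<Rightarrow> nat \<Rightarrow> 'a" where
  "vr i j = (if j = i then 1 else s i j)"

definition pb :: "nat \<Rightarrow> nat \<Rightarrow> 'a" where
  "pb i j = (if j \<le> N then ur i (j - 1) / (ur i j * vr i (j - 1))
    else ur i N / vr i N / (if even (Suc N - i) then s i (Suc N) else t i (Suc N)))"

definition qb :: "nat \<Rightarrow> nat \<Rightarrow> 'a" where
  "qb i j = (if j \<le> N then pb i j * s i j / t i j
    else ur i N / vr i N / (if even (Suc N - i) then t i (Suc N) else s i (Suc N)))"

text \<open>The value 1 beyond \<open>Suc N\<close> keeps \<open>dd i k\<close> nonzero for every
  \<open>k\<close>, as the lemmas on \<open>torus_mat\<close> demand.\<close>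

definition dd :: "nat \<Rightarrow> nat \<Rightarrow> 'a" where
  "dd i k = (if i < k \<and> k \<le> Suc N then s i k / t i k
    else if k = i then iprod (s i) i (Suc N) * iprod (t i) i (Suc N) else 1)"

abbreviation dd_mat :: "nat \<Rightarrow> 'a mat" where
  "dd_mat i \<equiv> torus_mat (Suc N) (\<lambda>k. \<Prod>l\<in>{i..<Suc N}. dd l k)"

lemma dd_nonzero: "1 \<le> i \<Longrightarrow> dd i k \<noteq> 0"
  using s0 t0 by (auto simp: dd_def intro!: iprod_nonzero)

lemma row_params_row:
  assumes "1 \<le> i" "i \<le> N"
  shows "row_params N i (t i) (s i) (pb i) (qb i) (ur i) (vr i) (even (Suc N - i))"
  by unfold_locales (use assms s0 t0 ts0 in \<open>auto simp: ur_def vr_def pb_def qb_def\<close>)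

text \<open>\<open>L\<close> is defined as the quotient of \<open>Z\<close> by
  \<open>E = D R_i\<close>, so the factorization is automatic and the content is the shape of
  \<open>L\<close>. By \<open>Zrow\<close>, a row of \<open>Z\<close> is the row of \<open>E\<close>
  plus a multiple of row \<open>i\<close> of \<open>E\<close>; multiplication by the inverse of
  \<open>E\<close> turns rows of \<open>E\<close> into unit vectors.\<close>

lemma row_step:
  assumes i: "1 \<le> i" "i \<le> N"
  obtains L c where "L \<in> SO (Suc N)"
    "\<And>a b. a < 2 * Suc N - i \<Longrightarrow> b < 2 * Suc N \<Longrightarrow>
       L $$ (a, b) = (if a = b then 1 else 0) + (if b = i - 1 then c a else 0)"
    "\<And>a. a < i \<Longrightarrow> c a = 0"
    "R_mat (Suc N) (\<lambda>i j. - t i j) (\<lambda>i j. - s i j) i * w_part (Suc N) i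
      = w_part (Suc N) (Suc i) * (L * (torus_mat (Suc N) (dd i) * R_mat (Suc N) pb qb i))"
proof -
  interpret row_params N i "t i" "s i" "pb i" "qb i" "ur i" "vr i" "even (Suc N - i)"
    by (rule row_params_row[OF i])
  let ?n = "Suc N" and ?e = "even (Suc N - i)"
  let ?Rm = "R_mat ?n (\<lambda>i j. - t i j) (\<lambda>i j. - s i j) i" and ?R = "R_mat ?n pb qb i"
  let ?W = "w_part ?n (Suc i) :: 'a mat"
  define V where "V = ?Rm * w_part ?n i"
  define Zm where "Zm = adj ?n ?W * V"
  define E where "E = torus_mat ?n (dd i) * ?R"
  define L where "L = Zm * adj ?n E"
  have iN: "i < ?n" "i \<le> ?n" "1 \<le> Suc i" "Suc i \<le> ?n" using i by auto
  have Rm: "?Rm \<in> SO ?n" and Rp: "?R \<in> SO ?n" by (rule R_mat_SO[OF i(1) iN(1)])+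
  have W: "?W \<in> SO ?n" by (rule w_part_SO) simp
  have V: "V \<in> SO ?n" unfolding V_def by (intro SO_mult Rm w_part_SO i)
  have Zm: "Zm \<in> SO ?n" unfolding Zm_def by (intro SO_mult SO_adj W V)
  have E: "E \<in> SO ?n" unfolding E_def by (intro SO_mult Rp torus_mat_SO dd_nonzero i)
  have L: "L \<in> SO ?n" unfolding L_def by (intro SO_mult SO_adj Zm E)
  have LE: "L * E = Zm"
  proof -
    have "L * E = Zm * (adj ?n E * E)"
      unfolding L_def by (rule assoc_mult_mat[OF SO_carrier[OF Zm] adj_carrier SO_carrier[OF E]])
    then show ?thesis
      by (simp add: SO_adj_left[OF E] right_mult_one_mat[OF SO_carrier[OF Zm]] del: mult_Suc_right)
  qed
  have WZ: "?W * Zm = V"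
  proof -
    have "?W * Zm = ?W * adj ?n ?W * V"
      unfolding Zm_def by (rule assoc_mult_mat[OF SO_carrier[OF W] adj_carrier SO_carrier[OF V], symmetric])
    then show ?thesis
      by (simp add: SO_adj_right[OF W] left_mult_one_mat[OF SO_carrier[OF V]] del: mult_Suc_right)
  qed
  have dd_d: "dd i k = d k" if "k \<le> ?n" for k
    using that by (cases k i rule: linorder_cases) (simp_all add: dd_def d_def S_def T_def)
  have dgs: "tdiag ?n (dd i) (lab_pos N ?e x) = dg x" if x: "vlab N x" for x
  proof (cases x)
    case (Up k)
    then have "k - 1 < ?n" "Suc (k - 1) = k" "k \<le> ?n" using x by auto
    then show ?thesis by (simp only: Up lab_pos.simps tdiag_def if_True dd_d dg.simps)
  next
    case (Dn k)
    then have "\<not> 2 * N + 2 - k < ?n" "2 * ?n - (2 * N + 2 - k) = k" "k \<le> ?n" using x by auto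
    then show ?thesis by (simp only: Dn lab_pos.simps tdiag_def if_False dd_d dg.simps)
  next
    case Ca
    show ?thesis unfolding Ca lab_pos.simps dg.simps by (simp add: tdiag_def dd_d del: even_diff_nat)
  next
    case Cb
    show ?thesis unfolding Cb lab_pos.simps dg.simps by (simp add: tdiag_def dd_d del: even_diff_nat)
  qed
  have Eent: "E $$ (lab_pos N ?e x, lab_pos N ?e y) = dg x * R x y" if "vlab N x" "vlab N y" for x y
    unfolding E_def torus_mult_index[OF SO_carrier[OF Rp] pos_less[OF that(1)] pos_less[OF that(2)]]
      dgs[OF that(1)] using ent_R_mat[OF i that, of pb qb] by (simp add: ent_def R_def)
  have Zent: "Zm $$ (lab_pos N ?e x, lab_pos N ?e y) = Z x y" if v: "vlab N x" "vlab N y" for x y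
  proof -
    note pl = pos_less[OF v(1), of ?e] pos_less[OF v(2), of ?e]
    have "Zm $$ (lab_pos N ?e x, lab_pos N ?e y) = wcol N (Suc i) (\<lambda>c. V $$ (c, lab_pos N ?e y)) (lab_pos N ?e x)"
      unfolding Zm_def by (rule adj_w_part_mult_index[OF iN(3,4) SO_carrier[OF V] pl])
    also have "\<dots> = wlab N (Suc i) (\<lambda>z. V $$ (lab_pos N ?e z, lab_pos N ?e y)) x"
      by (rule wcol_wlab) (use iN v in auto)
    also have "\<dots> = wlab N (Suc i) (\<lambda>z. wlab N i (Rm z) y) x"
    proof (rule wlab_cong[OF v(1)])
      fix z assume z: "vlab N z"
      have "V $$ (lab_pos N ?e z, lab_pos N ?e y) = wcol N i (\<lambda>b. ?Rm $$ (lab_pos N ?e z, b)) (lab_pos N ?e y)"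
        unfolding V_def by (rule mult_w_part_index[OF i(1) iN(2) SO_carrier[OF Rm] pos_less[OF z] pl(2)])
      also have "\<dots> = wlab N i (\<lambda>b. ?Rm $$ (lab_pos N ?e z, lab_pos N ?e b)) y"
        by (rule wcol_wlab) (use i v in auto)
      also have "\<dots> = wlab N i (Rm z) y"
        by (rule wlab_cong[OF v(2)])
          (use ent_R_mat[OF i z, of _ "\<lambda>i j. - t i j" "\<lambda>i j. - s i j"] in \<open>simp add: ent_def Rm_def\<close>)
      finally show "V $$ (lab_pos N ?e z, lab_pos N ?e y) = wlab N i (Rm z) y" .
    qed
    finally show ?thesis by (simp add: Z_def)
  qed
  \<comment> \<open>The coefficient refers to row \<open>i\<close> of \<open>E\<close>, which is
    \<open>d i\<close> times that of \<open>R_i\<close>; hence the division. The label at a valid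
    position is unique, so the choice is determined there.\<close>
  define c where "c a = (let x = SOME x. vlab N x \<and> lab_pos N ?e x = a in
     if mid x then Z x (Up i) / d i else 0)" for a
  have c_pos: "c (lab_pos N ?e x) = (if mid x then Z x (Up i) / d i else 0)" if "vlab N x" for x
  proof -
    have "(SOME x'. vlab N x' \<and> lab_pos N ?e x' = lab_pos N ?e x) = x"
      by (rule some_equality) (use that pos_eq_iff[of N] in auto)
    then show ?thesis by (simp add: c_def Let_def)
  qed
  have d0: "d i \<noteq> 0" using dd_nonzero[of i i] i by (simp add: d_def dd_def S_def T_def)
  have vi: "vlab N (Up i)" "lab_pos N ?e (Up i) = i - 1" using i by auto
  have Zrow: "Zm $$ (a, b) = E $$ (a, b) + c a * E $$ (i - 1, b)"
    if a: "a < 2 * ?n" "a \<noteq> 2 * ?n - i" and b: "b < 2 * ?n" for a b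
  proof -
    obtain x where x: "vlab N x" "lab_pos N ?e x = a" using pos_surj[OF a(1)] .
    obtain y where y: "vlab N y" "lab_pos N ?e y = b" using pos_surj[OF b] .
    have "x \<noteq> Dn i" using x a by auto
    then have "Z x y = dg x * R x y + (if mid x then Z x (Up i) * R (Up i) y else 0)"
      by (rule Z_row[OF x(1) y(1)])
    then have "Z x y = dg x * R x y + c a * (dg (Up i) * R (Up i) y)"
      unfolding x(2)[symmetric] using d0 by (simp add: c_pos[OF x(1)] del: even_diff_nat)
    then show ?thesis
      using Zent[OF x(1) y(1)] Eent[OF x(1) y(1)] Eent[OF vi(1) y(1)] by (simp only: x y vi)
  qed
  have Lrow: "L $$ (a, b) = (if a = b then 1 else 0) + (if b = i - 1 then c a else 0)"
    if a: "a < 2 * ?n - i" and b: "b < 2 * ?n" for a b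
  proof -
    have a': "a < 2 * ?n" "a \<noteq> 2 * ?n - i" "i - 1 < 2 * ?n" using a i by auto
    have EE: "(\<Sum>k<2 * ?n. E $$ (a, k) * adj ?n E $$ (k, b)) = (if a = b then 1 else 0)"
      if "a < 2 * ?n" for a
      using SO_adj_right[OF E] index_mult_sum[OF SO_carrier[OF E] adj_carrier that b, of E] that b
      by (simp del: mult_Suc_right)
    have "L $$ (a, b) = (\<Sum>k<2 * ?n. Zm $$ (a, k) * adj ?n E $$ (k, b))"
      unfolding L_def by (rule index_mult_sum[OF SO_carrier[OF Zm] adj_carrier a'(1) b])
    also have "\<dots> = (\<Sum>k<2 * ?n. E $$ (a, k) * adj ?n E $$ (k, b)
        + c a * (E $$ (i - 1, k) * adj ?n E $$ (k, b)))"
      by (rule sum.cong) (simp_all add: Zrow[OF a'(1,2)] algebra_simps del: mult_Suc_right)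
    also have "\<dots> = (if a = b then 1 else 0) + c a * (if i - 1 = b then 1 else 0)"
      unfolding sum.distrib sum_distrib_left[symmetric] EE[OF a'(1)] EE[OF a'(3)] ..
    finally show ?thesis by auto
  qed
  have c0: "c a = 0" if a: "a < i" for a
    using c_pos[of "Up (Suc a)"] a i by (simp del: even_diff_nat)
  show ?thesis
    by (rule that[OF L Lrow c0]) (use WZ LE in \<open>auto simp: V_def E_def\<close>)
qed

definition pp :: "nat \<Rightarrow> nat \<Rightarrow> nat \<Rightarrow> 'a" where
  "pp i k j = (if j \<le> N then pb k j * (\<Prod>l\<in>{i..<k}. dd l j / dd l (j - 1))
    else pb k j * (\<Prod>l\<in>{i..<k}. spin_scale (Suc N) (dd l) (odd (Suc N - k))))"

definition qq :: "nat \<Rightarrow> nat \<Rightarrow> nat \<Rightarrow> 'a" where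
  "qq i k j = (if j \<le> N then qb k j * (\<Prod>l\<in>{i..<k}. dd l j / dd l (j - 1))
    else qb k j * (\<Prod>l\<in>{i..<k}. spin_scale (Suc N) (dd l) (even (Suc N - k))))"

lemma prod_head: "i < k \<Longrightarrow> (\<Prod>l\<in>{i..<k}. f l) = f i * (\<Prod>l\<in>{Suc i..<k}. f l :: 'a)"
  by (simp add: prod.atLeast_Suc_lessThan)

lemma existence_part:
  assumes "1 \<le> i" "i \<le> Suc N"
  shows "\<exists>Y. Y \<in> SO (Suc N) \<and> lower_unipotent Y \<and>
    X_part (Suc N) (\<lambda>i j. - t i j) (\<lambda>i j. - s i j) i * w_part (Suc N) i
      = Y * dd_mat i * X_part (Suc N) (pp i) (qq i) i"
  using assms(2,1)
proof (induction i rule: inc_induct)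
  case base
  have "torus_mat (Suc N) (\<lambda>k. \<Prod>l\<in>{Suc N..<Suc N}. dd l k) = 1\<^sub>m (2 * Suc N)"
    by (rule eq_matI) (auto simp: torus_mat_index tdiag_def)
  then show ?case
    using one_SO[of "Suc N"] by (intro exI[of _ "1\<^sub>m (2 * Suc N)"])
      (simp add: X_part_top w_part_top lower_unipotent_def del: mult_Suc_right)
next
  case (step i)
  let ?n = "Suc N"
  have i: "1 \<le> i" "i \<le> N" "i < ?n" using step by auto
  let ?Xm = "X_part ?n (\<lambda>i j. - t i j) (\<lambda>i j. - s i j)"
  let ?T' = "torus_mat ?n (\<lambda>k. \<Prod>l\<in>{Suc i..<?n}. dd l k)" and ?Dn = "torus_mat ?n (dd i)"
  let ?T = "torus_mat ?n (\<lambda>k. \<Prod>l\<in>{i..<?n}. dd l k)"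
  let ?X' = "X_part ?n (pp (Suc i)) (qq (Suc i)) (Suc i)"
  let ?R = "R_mat ?n pb qb i" and ?Rm = "R_mat ?n (\<lambda>i j. - t i j) (\<lambda>i j. - s i j) i"
  obtain Y where Y: "Y \<in> SO ?n" "lower_unipotent Y"
    "?Xm (Suc i) * w_part ?n (Suc i) = Y * ?T' * ?X'"
    using step by auto
  obtain L c where L: "L \<in> SO ?n"
    "\<And>a b. a < 2 * ?n - i \<Longrightarrow> b < 2 * ?n \<Longrightarrow>
       L $$ (a, b) = (if a = b then 1 else 0) + (if b = i - 1 then c a else 0)"
    "\<And>a. a < i \<Longrightarrow> c a = 0"
    "?Rm * w_part ?n i = w_part ?n (Suc i) * (L * (?Dn * ?R))"
    by (rule row_step[OF i(1,2)]) blast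
  have d': "(\<Prod>l\<in>{Suc i..<?n}. dd l k) \<noteq> 0" for k using dd_nonzero by simp
  have X': "?X' \<in> SO ?n" by (rule X_part_SO) simp
  have T': "?T' \<in> SO ?n" by (rule torus_mat_SO[OF d'])
  \<comment> \<open>Conjugating by \<open>?X'\<close> and then by \<open>?T'\<close> carries
    \<open>L\<close> to the left, where it is absorbed into \<open>Y\<close>; it stays lower
    unipotent throughout.\<close>
  define L1 where "L1 = ?X' * L * adj ?n ?X'"
  define L2 where "L2 = ?T' * L1 * adj ?n ?T'"
  have L1: "L1 \<in> SO ?n" unfolding L1_def by (intro SO_mult SO_adj X' L)
  have L2: "L2 \<in> SO ?n" unfolding L2_def by (intro SO_mult SO_adj T' L1)
  have "block_id ?n i ?X'" using block_id_X_part[of "Suc i" ?n] i by simp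
  then have "lower_unipotent L1" unfolding L1_def
    by (rule lower_unipotent_conj[OF L(1) X' _ i(1) _ L(2) L(3)]) (use i in auto)
  then have "lower_unipotent L2" unfolding L2_def by (rule lower_unipotent_torus_conj[OF L1 _ d'])
  then have low: "lower_unipotent (Y * L2)"
    by (rule lower_unipotent_mult[OF SO_carrier[OF Y(1)] Y(2) SO_carrier[OF L2]])
  note c [simp] = SO_carrier[OF X'] SO_carrier[OF T'] SO_carrier[OF L1] SO_carrier[OF L2]
    SO_carrier[OF L(1)] SO_carrier[OF Y(1)]
  have c2 [simp]: "?R \<in> sqmats ?n" "?Rm \<in> sqmats ?n"
    "w_part ?n (Suc i) \<in> sqmats ?n" "w_part ?n i \<in> sqmats ?n"
    "?Xm (Suc i) \<in> sqmats ?n"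
    using i by (auto intro!: SO_carrier R_mat_SO w_part_SO X_part_SO simp del: mult_Suc_right)
  note as = square_assoc[where n="?n"]
  have X'L: "?X' * (L * M) = L1 * (?X' * M)" if "M \<in> sqmats ?n" for M
    unfolding L1_def by (rule SO_conj_swap[OF X' c(5) that])
  have T'L: "?T' * (L1 * M) = L2 * (?T' * M)" if "M \<in> sqmats ?n" for M
    unfolding L2_def by (rule SO_conj_swap[OF T' c(3) that])
  have XD: "?X' * ?Dn = ?Dn * X_part ?n (pp i) (qq i) (Suc i)"
  proof (rule X_part_mult_torus)
    fix k j assume kj: "Suc i \<le> k" "k < j" "j < ?n"
    show "pp i k j = pp (Suc i) k j * (dd i j / dd i (j - 1))"
      "qq i k j = qq (Suc i) k j * (dd i j / dd i (j - 1))"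
      using kj by (simp_all add: pp_def qq_def prod_head[of i k])
  next
    fix k assume k: "Suc i \<le> k" "k < ?n"
    show "pp i k ?n = pp (Suc i) k ?n * spin_scale ?n (dd i) (odd (?n - k))"
      "qq i k ?n = qq (Suc i) k ?n * spin_scale ?n (dd i) (even (?n - k))"
      using k by (simp_all add: pp_def qq_def prod_head[of i k])
  qed (use i dd_nonzero in auto)
  \<comment> \<open>For row \<open>i\<close> the products over \<open>i \<le> l < i\<close> are
    empty, so its parameters are still \<open>pb\<close> and \<open>qb\<close>.\<close>
  have "R_word ?n (pp i) (qq i) i = R_word ?n pb qb i"
    unfolding R_word_def using i by (auto simp: pp_def qq_def)
  then have RR: "R_mat ?n (pp i) (qq i) i = ?R" by (simp add: R_mat_def)
  have TT: "?T' * ?Dn = ?T"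
    unfolding torus_mat_mult by (simp only: prod_head[OF i(3)] mult.commute)
  let ?X2 = "X_part ?n (pp i) (qq i) (Suc i)"
  have c3 [simp]: "?X2 \<in> sqmats ?n" by (rule SO_carrier, rule X_part_SO) simp
  have "?Xm i * w_part ?n i = ?Xm (Suc i) * (?Rm * w_part ?n i)"
    unfolding X_part_rec[OF i(1,3)] by (simp only: as c c2)
  also have "\<dots> = ?Xm (Suc i) * w_part ?n (Suc i) * (L * (?Dn * ?R))"
    unfolding L(4) by (simp only: as c c2 torus_mat_carrier)
  also have "\<dots> = Y * (?T' * (?X' * (L * (?Dn * ?R))))"
    unfolding Y(3) by (simp only: as c c2 torus_mat_carrier)
  also have "\<dots> = Y * (L2 * (?T' * (?X' * (?Dn * ?R))))"
    by (simp only: X'L T'L as c c2 torus_mat_carrier)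
  also have "?X' * (?Dn * ?R) = ?X' * ?Dn * ?R" by (simp only: as c c2 torus_mat_carrier)
  also have "\<dots> = ?Dn * (?X2 * ?R)" unfolding XD by (simp only: as c c2 c3 torus_mat_carrier)
  also have "Y * (L2 * (?T' * (?Dn * (?X2 * ?R)))) = Y * L2 * (?T' * ?Dn) * (?X2 * ?R)"
    by (simp only: as c c2 c3 torus_mat_carrier)
  also have "\<dots> = Y * L2 * ?T * X_part ?n (pp i) (qq i) i"
    unfolding TT X_part_rec[OF i(1,3), of "pp i"] RR ..
  finally show ?case using low SO_mult[OF Y(1) L2] by blast
qed

end

section \<open>Uniqueness and the formulas\<close>

text \<open>The cases \<open>j < n\<close> and \<open>j = n\<close> of the formula in one function,
  over any field, so that it serves both for rational functions and for their real values.\<close>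

definition P_form :: "nat \<Rightarrow> (nat \<Rightarrow> nat \<Rightarrow> 'a::field) \<Rightarrow> (nat \<Rightarrow> nat \<Rightarrow> 'a) \<Rightarrow> nat \<Rightarrow> nat \<Rightarrow> 'a" where
  "P_form n t s i j = r_par n t s i j * (\<Prod>k\<in>{1..<i}. t k (j-1) / s k (j-1)) *
     (if j < n then \<Prod>k\<in>{1..<i}. s k j / t k j else \<Prod>k\<in>{1..<i}. (t k n / s k n) powi eps (n-i))"

definition Q_form :: "nat \<Rightarrow> (nat \<Rightarrow> nat \<Rightarrow> 'a::field) \<Rightarrow> (nat \<Rightarrow> nat \<Rightarrow> 'a) \<Rightarrow> nat \<Rightarrow> nat \<Rightarrow> 'a" where
  "Q_form n t s i j = r_par n t s i j * (\<Prod>k\<in>{1..<i}. t k (j-1) / s k (j-1)) *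
     (if j < n then \<Prod>k\<in>{1..i}. s k j / t k j else \<Prod>k\<in>{1..i}. (s k n / t k n) powi eps (n-i))"

text \<open>The entries at consecutive \<open>Dn\<close> labels have quotient \<open>p j\<close> up
  to sign. Knowing \<open>p\<close>, the entries at \<open>Up\<close> labels give \<open>q\<close>
  successively, and those at \<open>Ca\<close> and \<open>Cb\<close> give the last column.
  Nonvanishing of the primed parameters justifies every division.\<close>

lemma R_row_unique:
  fixes p q p' q' :: "nat \<Rightarrow> 'a::field"
  assumes i: "1 \<le> i" "i \<le> N"
    and eq: "\<And>y. vlab N y \<Longrightarrow> ent_down N p q i i (Up i) y = ent_down N p' q' i i (Up i) y"
    and nz: "\<And>j. i < j \<Longrightarrow> j \<le> Suc N \<Longrightarrow> p' j \<noteq> 0 \<and> q' j \<noteq> 0"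
    and j: "i < j" "j \<le> Suc N"
  shows "p j = p' j \<and> q j = q' j"
proof -
  have Dn: "iprod q i (Suc N) * iprod p l (Suc N) = iprod q' i (Suc N) * iprod p' l (Suc N)"
    if "i \<le> l" "l \<le> N" for l
    using eq[of "Dn l"] that i by (simp add: mult.assoc)
  have nz': "iprod q' i (Suc N) * iprod p' l (Suc N) \<noteq> 0" if "i \<le> l" for l
    using nz that by (auto intro!: iprod_nonzero)
  have p: "p j = p' j" if j: "i < j" "j \<le> N" for j
  proof -
    obtain l where l: "j = Suc l" "i \<le> l" using j by (cases j) auto
    have "iprod q i (Suc N) * iprod p l (Suc N) = p j * (iprod q i (Suc N) * iprod p j (Suc N))"
      using l j by (simp add: iprod_head)
    moreover have "iprod q' i (Suc N) * iprod p' l (Suc N) = p' j * (iprod q' i (Suc N) * iprod p' j (Suc N))"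
      using l j by (simp add: iprod_head)
    ultimately show ?thesis using Dn[of l] Dn[of j] nz'[of j] l j by auto
  qed
  have q: "iprod q i m = iprod q' i m \<and> (\<forall>j. i < j \<and> j \<le> m \<longrightarrow> q j = q' j)" if "i \<le> m" "m \<le> N" for m
    using that
  proof (induction m rule: dec_induct)
    case base
    then show ?case by auto
  next
    case (step m)
    have "iprod q' i m \<noteq> 0" using nz step by (auto intro!: iprod_nonzero)
    moreover have "iprod q i m * (q (Suc m) + p (Suc m)) = iprod q' i m * (q' (Suc m) + p' (Suc m))"
      using eq[of "Up (Suc m)"] step i by simp
    ultimately have "q (Suc m) = q' (Suc m)" using step p[of "Suc m"] by simp
    then show ?case using step by (auto simp: iprod_Suc le_Suc_eq)
  qed
  have "iprod q' i N \<noteq> 0" using nz by (auto intro!: iprod_nonzero)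
  then have "p (Suc N) = p' (Suc N)" "q (Suc N) = q' (Suc N)"
    using eq[of Ca] eq[of Cb] q[OF i(2) order_refl] i by (simp_all add: iprod_Suc)
  then show ?thesis using p[of j] q[OF i(2) order_refl] j by (cases "j = Suc N") auto
qed

text \<open>Once row \<open>i\<close> has determined \<open>R_i\<close>, this factor is cancelled
  from the right and the induction continues with \<open>X_{i+1}\<close>.\<close>

lemma X_part_unique:
  fixes p q p' q' :: "nat \<Rightarrow> nat \<Rightarrow> 'a::field"
  assumes "1 \<le> i" "i \<le> Suc N" and "X_part (Suc N) p q i = X_part (Suc N) p' q' i"
    and "\<And>k j. i \<le> k \<Longrightarrow> k < j \<Longrightarrow> j \<le> Suc N \<Longrightarrow> p' k j \<noteq> 0 \<and> q' k j \<noteq> 0"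
    and "i \<le> k" "k < j" "j \<le> Suc N"
  shows "p k j = p' k j \<and> q k j = q' k j"
  using assms(2,1,3-)
proof (induction i rule: inc_induct)
  case (step i)
  let ?n = "Suc N"
  have i: "1 \<le> i" "i \<le> N" "i < ?n" using step by auto
  have Rc: "R_mat ?n p q i \<in> SO ?n" "R_mat ?n p' q' i \<in> SO ?n" by (rule R_mat_SO[OF i(1,3)])+
  have Xc: "X_part ?n p q (Suc i) \<in> SO ?n" "X_part ?n p' q' (Suc i) \<in> SO ?n" by (rule X_part_SO, simp)+
  have row: "X_part ?n p q i $$ (i - 1, b) = R_mat ?n p q i $$ (i - 1, b)" if b: "b < 2 * ?n" for b p q
  proof -
    have a: "i - 1 < 2 * ?n" using i by auto
    have X: "X_part ?n p q (Suc i) \<in> sqmats ?n"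
      and R: "R_mat ?n p q i \<in> sqmats ?n"
      using i by (auto intro!: SO_carrier X_part_SO R_mat_SO simp del: mult_Suc_right)
    have "X_part ?n p q (Suc i) $$ (i - 1, k) = (if i - 1 = k then 1 else 0)" if "k < 2 * ?n" for k
      using block_id_X_part[of "Suc i" ?n p q] i a that unfolding block_id_def by auto
    then have "X_part ?n p q i $$ (i - 1, b)
      = (\<Sum>k<2 * ?n. if k = i - 1 then R_mat ?n p q i $$ (i - 1, b) else 0)"
      unfolding X_part_rec[OF i(1,3)] index_mult_sum[OF X R a b] by (intro sum.cong) auto
    then show ?thesis using a by simp
  qed
  have rows: "p i j = p' i j \<and> q i j = q' i j" if "i < j" "j \<le> ?n" for j
  proof (rule R_row_unique[OF i(1,2)])
    fix y assume y: "vlab N y"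
    have vi: "vlab N (Up i)" "lab_pos N e (Up i) = i - 1" for e using i by auto
    show "ent_down N (p i) (q i) i i (Up i) y = ent_down N (p' i) (q' i) i i (Up i) y"
      unfolding ent_R_mat[OF i(1,2) vi(1) y, symmetric] ent_def vi
      using row[OF pos_less[OF y]] step.prems(2) by metis
  qed (use step.prems(3)[of i] that in auto)
  then have "R_word ?n p q i = R_word ?n p' q' i"
    using i by (auto simp: R_word_def)
  then have R: "R_mat ?n p q i = R_mat ?n p' q' i" by (simp add: R_mat_def)
  have X: "X_part ?n p q (Suc i) = X_part ?n p' q' (Suc i)"
  proof -
    have "X_part ?n p q (Suc i) = X_part ?n p q i * adj ?n (R_mat ?n p q i)" for p q :: "nat \<Rightarrow> nat \<Rightarrow> 'a"
    proof -
      have c: "X_part ?n p q (Suc i) \<in> sqmats ?n"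
        by (rule SO_carrier, rule X_part_SO) simp
      have r: "R_mat ?n p q i \<in> SO ?n" by (rule R_mat_SO[OF i(1,3)])
      show ?thesis
        unfolding X_part_rec[OF i(1,3)] assoc_mult_mat[OF c SO_carrier[OF r] adj_carrier]
          SO_adj_right[OF r] right_mult_one_mat[OF c] ..
    qed
    then show ?thesis using R step.prems(2) by metis
  qed
  show ?case
  proof (cases "k = i")
    case True
    then show ?thesis using rows[of j] step.prems by auto
  next
    case False
    show ?thesis by (rule step.IH) (use False X step.prems in auto)
  qed
qed simp

context params
begin

lemma existence:
  "\<exists>Y. factorization (Suc N) t s Y (dd_mat 1) (pp 1) (qq 1)"
  using existence_part[of 1] torus_mat_SO[of "\<lambda>k. \<Prod>l\<in>{1..<Suc N}. dd l k" "Suc N"] torus_mat_diagonal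
    dd_nonzero N
  by (auto simp: factorization_def X_mat_eq w0_mat_eq)

lemma pq_nonzero:
  assumes "1 \<le> k" "k < j" "j \<le> Suc N"
  shows "pp 1 k j \<noteq> 0 \<and> qq 1 k j \<noteq> 0"
proof -
  have "ur k l \<noteq> 0" "vr k l \<noteq> 0" if "k \<le> l" "l \<le> N" for l
    using that assms s0[of k l] ts0[of k l] by (auto simp: ur_def vr_def)
  then have "pb k j \<noteq> 0 \<and> qb k j \<noteq> 0"
    using assms s0[of k j] t0[of k j] s0[of k "Suc N"] t0[of k "Suc N"] by (auto simp: pb_def qb_def)
  moreover have "spin_scale (Suc N) (dd l) b \<noteq> 0" if "1 \<le> l" for l b
    using dd_nonzero[OF that] by (simp add: spin_scale_def)
  ultimately show ?thesis using dd_nonzero by (auto simp: pp_def qq_def simp del: even_diff_nat)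
qed

lemma uniqueness:
  assumes "factorization (Suc N) t s Y T p q"
  shows "T = dd_mat 1"
    and "1 \<le> i \<Longrightarrow> i < j \<Longrightarrow> j \<le> Suc N \<Longrightarrow> p i j = pp 1 i j \<and> q i j = qq 1 i j"
proof -
  obtain Y' where Y': "factorization (Suc N) t s Y' (dd_mat 1) (pp 1) (qq 1)"
    using existence ..
  have X: "X_mat (Suc N) p q \<in> SO (Suc N)" "upper_unipotent (X_mat (Suc N) p q)" for p q :: "nat \<Rightarrow> nat \<Rightarrow> 'a"
    by (simp_all only: X_mat_eq X_part_SO X_part_upper order_refl)
  have *: "T = dd_mat 1 \<and> X_mat (Suc N) p q = X_mat (Suc N) (pp 1) (qq 1)"
    using LDU_unique[of Y "Suc N" Y' T "dd_mat 1"
        "X_mat (Suc N) p q" "X_mat (Suc N) (pp 1) (qq 1)"] assms Y' X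
    unfolding factorization_def by metis
  then show "T = dd_mat 1" by blast
  show "p i j = pp 1 i j \<and> q i j = qq 1 i j" if "1 \<le> i" "i < j" "j \<le> Suc N"
    by (rule X_part_unique[of 1 N]) (use * that pq_nonzero in \<open>auto simp: X_mat_eq\<close>)
qed

text \<open>At index \<open>k\<close> a row \<open>l < k\<close> contributes
  \<open>s l k / t l k\<close>, the row \<open>l = k\<close> the product of all its parameters, and
  a row \<open>l > k\<close> the factor 1.\<close>

lemma torus_formula:
  "dd_mat 1 = torus_mat (Suc N) (T_par (Suc N) t s)"
proof (rule torus_mat_cong)
  fix k assume k: "1 \<le> k" "k \<le> Suc N"
  have 1: "(\<Prod>l\<in>{1..<k}. dd l k) = (\<Prod>j\<in>{1..<k}. s j k / t j k)"
    using k by (intro prod.cong) (auto simp: dd_def)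
  have 2: "(\<Prod>l\<in>{k..<Suc N}. dd l k) = (\<Prod>j\<in>{k<..Suc N}. s k j * t k j)"
  proof (cases "k = Suc N")
    case False
    have "(\<Prod>l\<in>{k..<Suc N}. dd l k) = dd k k * (\<Prod>l\<in>{Suc k..<Suc N}. dd l k)"
      using k False by (intro prod_head) auto
    also have "(\<Prod>l\<in>{Suc k..<Suc N}. dd l k) = 1"
      by (rule prod.neutral) (auto simp: dd_def)
    finally show ?thesis by (simp add: dd_def iprod_def prod.distrib)
  qed auto
  have "(\<Prod>l\<in>{1..<Suc N}. dd l k) = (\<Prod>l\<in>{1..<k}. dd l k) * (\<Prod>l\<in>{k..<Suc N}. dd l k)"
    using k by (intro prod.atLeastLessThan_concat[symmetric]) auto
  then show "(\<Prod>l\<in>{1..<Suc N}. dd l k) = T_par (Suc N) t s k"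
    unfolding 1 2 T_par_def .
qed

lemma pq_eq_forms:
  assumes ij: "1 \<le> i" "i < j" "j \<le> Suc N"
  shows "pp 1 i j = P_form (Suc N) t s i j" "qq 1 i j = Q_form (Suc N) t s i j"
proof -
  let ?n = "Suc N"
  let ?e = "eps (?n - i)"
  have i: "{1..i} = insert i {1..<i}" using ij by auto
  have r: "pb i j = r_par ?n t s i j"
    using ij by (auto simp: pb_def r_par_def u_par_def ur_def vr_def le_Suc_eq simp del: even_diff_nat)
  have "pp 1 i j = P_form ?n t s i j \<and> qq 1 i j = Q_form ?n t s i j"
  proof (cases "j \<le> N")
    case True
    have d: "(\<Prod>l\<in>{1..<i}. dd l j / dd l (j - 1))
      = (\<Prod>k\<in>{1..<i}. t k (j-1) / s k (j-1)) * (\<Prod>k\<in>{1..<i}. s k j / t k j)"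
      unfolding prod.distrib[symmetric] using ij True
      by (intro prod.cong) (auto simp: dd_def mult.commute)
    show ?thesis
      using True unfolding pp_def qq_def qb_def P_form_def Q_form_def d r i by (simp add: mult_ac)
  next
    case False
    then have [simp]: "j = ?n" using ij by simp
    have p: "(\<Prod>l\<in>{1..<i}. spin_scale ?n (dd l) (odd (?n - i)))
      = (\<Prod>k\<in>{1..<i}. t k N / s k N) * (\<Prod>k\<in>{1..<i}. (t k ?n / s k ?n) powi ?e)"
      unfolding prod.distrib[symmetric] using ij
      by (intro prod.cong) (auto simp: dd_def spin_scale_def powi_eps simp del: even_diff_nat)
    have q: "(\<Prod>l\<in>{1..<i}. spin_scale ?n (dd l) (even (?n - i)))
      = (\<Prod>k\<in>{1..<i}. t k N / s k N) * (\<Prod>k\<in>{1..<i}. (s k ?n / t k ?n) powi ?e)"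
      unfolding prod.distrib[symmetric] using ij
      by (intro prod.cong) (auto simp: dd_def spin_scale_def powi_eps simp del: even_diff_nat)
    \<comment> \<open>This ratio is the factor with \<open>k = i\<close> in \<open>Q_form\<close>,
      whose product runs over \<open>k \<le> i\<close>.\<close>
    have "qb i ?n = pb i ?n * (s i ?n / t i ?n) powi ?e"
      unfolding powi_eps using ij s0[of i ?n] t0[of i ?n] by (simp add: pb_def qb_def del: even_diff_nat)
    then show ?thesis
      using r unfolding pp_def qq_def P_form_def Q_form_def p q i
      by (simp add: mult_ac del: even_diff_nat)
  qed
  then show "pp 1 i j = P_form ?n t s i j" "qq 1 i j = Q_form ?n t s i j" by auto
qed

end

section \<open>Invariance of the measure\<close>

context
  fixes n :: nat and t s :: "nat \<Rightarrow> nat \<Rightarrow> ratfun" and t' s' :: "nat \<Rightarrow> nat \<Rightarrow> real" and x :: "var \<Rightarrow> real"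
  assumes rt: "\<And>i j. regular_value x (t i j) (t' i j)" and rs: "\<And>i j. regular_value x (s i j) (s' i j)"
    and pos: "\<And>i j. 1 \<le> i \<Longrightarrow> i < j \<Longrightarrow> j \<le> n \<Longrightarrow> 0 < t' i j \<and> 0 < s' i j"
begin

lemma regular_value_r_par:
  assumes ij: "1 \<le> i" "i < j" "j \<le> n"
  shows "regular_value x (r_par n t s i j) (r_par n t' s' i j)"
proof -
  have u: "regular_value x (u_par n t s i l) (u_par n t' s' i l)" for l
    unfolding u_par_def by (auto intro!: rt rs regular_value_1 regular_value_add)
  have u0: "u_par n t' s' i j \<noteq> 0"
    using pos[OF ij] pos[of i n] ij by (auto simp: u_par_def)
  have v0: "(if i = j - 1 then 1 else s' i (j - 1)) \<noteq> 0"
  proof (cases "i = j - 1")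
    case False
    then have "i < j - 1" "j - 1 \<le> n" using ij by linarith+
    then show ?thesis using pos[of i "j - 1"] ij by auto
  qed simp
  have v: "regular_value x (if i = j - 1 then 1 else s i (j - 1)) (if i = j - 1 then 1 else s' i (j - 1))"
    by (auto intro: rs regular_value_1)
  show ?thesis unfolding r_par_def
    by (intro regular_value_divide regular_value_mult u v) (use u0 v0 in simp)
qed

text \<open>All denominators are built from positive values by sums, products and quotients, so they
  do not vanish and evaluation commutes with the formulas.\<close>

lemma regular_value_forms:
  assumes ij: "1 \<le> i" "i < j" "j \<le> n"
  shows "regular_value x (P_form n t s i j) (P_form n t' s' i j)"
    and "regular_value x (Q_form n t s i j) (Q_form n t' s' i j)"
proof -
  have nz: "t' k l \<noteq> 0" "s' k l \<noteq> 0" if "1 \<le> k" "k < l" "l \<le> n" for k l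
    using pos[OF that] by auto
  have 1: "regular_value x (\<Prod>k\<in>{1..<i}. t k (j-1) / s k (j-1)) (\<Prod>k\<in>{1..<i}. t' k (j-1) / s' k (j-1))"
    by (intro regular_value_prod regular_value_divide rt rs nz) (use ij in auto)
  have 2: "regular_value x (\<Prod>k\<in>K. s k j / t k j) (\<Prod>k\<in>K. s' k j / t' k j)" if "K \<subseteq> {1..i}" for K
    by (intro regular_value_prod regular_value_divide rt rs nz) (use ij that in auto)
  have 3: "regular_value x (\<Prod>k\<in>K. (t k n / s k n) powi eps (n-i)) (\<Prod>k\<in>K. (t' k n / s' k n) powi eps (n-i))"
    "regular_value x (\<Prod>k\<in>K. (s k n / t k n) powi eps (n-i)) (\<Prod>k\<in>K. (s' k n / t' k n) powi eps (n-i))"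
    if K: "K \<subseteq> {1..i}" for K
  proof -
    have nzK: "t' k n \<noteq> 0 \<and> s' k n \<noteq> 0" if "k \<in> K" for k
      using nz[of k n] that K ij by force
    show "regular_value x (\<Prod>k\<in>K. (t k n / s k n) powi eps (n-i)) (\<Prod>k\<in>K. (t' k n / s' k n) powi eps (n-i))"
      "regular_value x (\<Prod>k\<in>K. (s k n / t k n) powi eps (n-i)) (\<Prod>k\<in>K. (s' k n / t' k n) powi eps (n-i))"
      using nzK by (intro regular_value_prod regular_value_powi_eps regular_value_divide rt rs; simp)+
  qed
  show "regular_value x (P_form n t s i j) (P_form n t' s' i j)"
    "regular_value x (Q_form n t s i j) (Q_form n t' s' i j)"
    unfolding P_form_def Q_form_def
    by (auto intro!: regular_value_mult regular_value_r_par ij 1[unfolded One_nat_def] 2 3)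
qed

end

lemma forms_pos:
  fixes t s :: "nat \<Rightarrow> nat \<Rightarrow> real"
  assumes pos: "\<And>i j. 1 \<le> i \<Longrightarrow> i < j \<Longrightarrow> j \<le> n \<Longrightarrow> 0 < t i j \<and> 0 < s i j"
    and ij: "1 \<le> i" "i < j" "j \<le> n"
  shows "0 < P_form n t s i j" "0 < Q_form n t s i j"
proof -
  have u: "0 < u_par n t s i l" if "i \<le> l" "l \<le> n" for l
    using pos[of i l] pos[of i n] that ij by (auto simp: u_par_def)
  have v: "0 < (if i = j - 1 then 1 else s i (j - 1))"
  proof (cases "i = j - 1")
    case False
    then have "i < j - 1" "j - 1 \<le> n" using ij by linarith+
    then show ?thesis using pos[of i "j - 1"] ij by auto
  qed simp
  have r: "0 < r_par n t s i j"
    unfolding r_par_def by (intro divide_pos_pos mult_pos_pos u v) (use ij in auto)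
  have 1: "0 < (\<Prod>k\<in>{1..<i}. t k (j-1) / s k (j-1))"
    by (intro prod_pos ballI divide_pos_pos) (use pos ij in auto)
  have 2: "0 < (\<Prod>k\<in>K. s k j / t k j)" if "K \<subseteq> {1..i}" for K
    by (intro prod_pos ballI divide_pos_pos) (use pos ij that in force)+
  have 3: "0 < (\<Prod>k\<in>K. (t k n / s k n) powi eps (n-i)) \<and> 0 < (\<Prod>k\<in>K. (s k n / t k n) powi eps (n-i))"
    if K: "K \<subseteq> {1..i}" for K
  proof -
    have "0 < t k n \<and> 0 < s k n" if "k \<in> K" for k
      using pos[of k n] that K ij by force
    then show ?thesis by (auto intro!: prod_pos simp: powi_eps)
  qed
  have sub: "{1..<i} \<subseteq> {1..i}" by auto
  show "0 < P_form n t s i j"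
    unfolding P_form_def by (intro mult_pos_pos r 1) (simp only: 2[OF sub] 3[OF sub] split: if_split, simp)
  show "0 < Q_form n t s i j"
    unfolding Q_form_def by (intro mult_pos_pos r 1) (simp only: 2[OF order_refl] 3[OF order_refl] split: if_split, simp)
qed

text \<open>In terms of \<open>m = s/t\<close> one has \<open>(t + s)/s = (1 + m)/m\<close> and
  \<open>1/(t + s) = 1/((1 + m) t)\<close>. Hence, apart from \<open>m\<close>, only
  \<open>t i j\<close> remains, with exponent -1.\<close>

lemma P_form_eq_p_fac:
  fixes t s m :: "nat \<Rightarrow> nat \<Rightarrow> real"
  assumes pos: "\<And>i j. 1 \<le> i \<Longrightarrow> i < j \<Longrightarrow> j \<le> n \<Longrightarrow> 0 < t i j \<and> 0 < s i j"
    and m: "\<And>i j. 1 \<le> i \<Longrightarrow> i < j \<Longrightarrow> j \<le> n \<Longrightarrow> m i j = s i j / t i j"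
    and ij: "1 \<le> i" "i < j" "j \<le> n"
  shows "P_form n t s i j = p_fac_aux n m i j * inverse (t i j)"
proof -
  have a: "(\<Prod>k\<in>{1..<i}. inverse (m k (j - 1))) = (\<Prod>k\<in>{1..<i}. t k (j-1) / s k (j-1))"
    using ij by (intro prod.cong) (auto simp: m)
  have b: "(\<Prod>k\<in>{1..<i}. m k j) = (\<Prod>k\<in>{1..<i}. s k j / t k j)"
    using ij by (intro prod.cong) (auto simp: m)
  have c: "(\<Prod>k\<in>{1..<i}. inverse (m k n) powi eps (n - i)) = (\<Prod>k\<in>{1..<i}. (t k n / s k n) powi eps (n-i))"
    using ij by (intro prod.cong) (auto simp: m)
  have w: "(if i = j - 1 then 1 else (1 + m i (j - 1)) / m i (j - 1))
    = u_par n t s i (j - 1) / (if i = j - 1 then 1 else s i (j - 1))"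
  proof (cases "i = j - 1")
    case False
    then have "1 \<le> i" "i < j - 1" "j - 1 \<le> n" "j - 1 < n" using ij by auto
    moreover from this have "m i (j - 1) = s i (j - 1) / t i (j - 1)"
      "0 < t i (j - 1)" "0 < s i (j - 1)" using m pos by auto
    moreover have "(1 + b / a) / (b / a) = (a + b) / b" if "0 < a" "0 < b" for a b :: real
      using that by (simp add: field_simps)
    ultimately show ?thesis using False by (simp add: u_par_def)
  qed (simp add: u_par_def)
  have r: "r_par n t s i j = u_par n t s i (j - 1) / (if i = j - 1 then 1 else s i (j - 1)) / u_par n t s i j"
    unfolding r_par_def by simp
  show ?thesis
  proof (cases "j < n")
    case True
    have "1 / u_par n t s i j = inverse (1 + m i j) * inverse (t i j)"
      unfolding m[OF ij] using True ij pos[OF ij] by (simp add: u_par_def field_simps)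
    then show ?thesis
      unfolding P_form_def p_fac_aux_def r a b w using True by (simp add: field_simps)
  next
    case False
    then have [simp]: "j = n" using ij by simp
    have "1 / u_par n t s i n = (if odd (n - i) then 1 else inverse (m i n)) * inverse (t i n)"
      using ij pos[of i n] m[of i n] by (auto simp: u_par_def divide_simps mult.commute simp del: even_diff_nat)
    then have "u / u_par n t s i n = u * ((if odd (n - i) then 1 else inverse (m i n)) * inverse (t i n))" for u
      by (metis divide_inverse mult_1)
    then show ?thesis
      unfolding P_form_def p_fac_aux_def r a c w using False by (simp add: mult_ac del: even_diff_nat)
  qed
qed

lemma Q_form_eq:
  fixes t s m :: "nat \<Rightarrow> nat \<Rightarrow> real"
  assumes pos: "\<And>i j. 1 \<le> i \<Longrightarrow> i < j \<Longrightarrow> j \<le> n \<Longrightarrow> 0 < t i j \<and> 0 < s i j"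
    and m: "\<And>i j. 1 \<le> i \<Longrightarrow> i < j \<Longrightarrow> j \<le> n \<Longrightarrow> m i j = s i j / t i j"
    and ij: "1 \<le> i" "i < j" "j \<le> n"
  shows "Q_form n t s i j = P_form n t s i j *
     (if j < n then 1 else \<Prod>k\<in>{1..<i}. m k n powi eps (n - i) * m k n powi eps (n - i)) *
     m i j powi (if j < n then 1 else eps (n - i))"
proof -
  have i: "{1..i} = insert i {1..<i}" using ij by auto
  show ?thesis
  proof (cases "j < n")
    case True
    then show ?thesis using m[OF ij] unfolding Q_form_def P_form_def i by (simp add: mult_ac)
  next
    case False
    then have [simp]: "j = n" using ij by simp
    have "(\<Prod>k\<in>{1..<i}. (s k n / t k n) powi eps (n-i)) = (\<Prod>k\<in>{1..<i}. (t k n / s k n) powi eps (n-i))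
      * (\<Prod>k\<in>{1..<i}. m k n powi eps (n - i) * m k n powi eps (n - i))"
      unfolding prod.distrib[symmetric]
    proof (rule prod.cong)
      fix k assume "k \<in> {1..<i}"
      then have "0 < t k n \<and> 0 < s k n" "m k n = s k n / t k n"
        using pos[of k n] m[of k n] ij by auto
      then show "(s k n / t k n) powi eps (n-i)
        = (t k n / s k n) powi eps (n-i) * (m k n powi eps (n - i) * m k n powi eps (n - i))"
        by (simp add: powi_eps del: even_diff_nat)
    qed simp
    then show ?thesis using m[OF ij] unfolding Q_form_def P_form_def i by (simp add: mult_ac)
  qed
qed

lemma q_map_formula:
  assumes x: "x \<in> orthant n" and ij: "1 \<le> i" "i < j" "j \<le> n"
  defines "t \<equiv> \<lambda>i j. x (TVar i j)" and "s \<equiv> \<lambda>i j. x (SVar i j)"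
  shows "q_map n (p_map n (ratio_map n x)) (TVar i j) = P_form n t s i j"
    and "q_map n (p_map n (ratio_map n x)) (SVar i j) = Q_form n t s i j"
proof -
  have pos: "0 < t i j \<and> 0 < s i j" if "1 \<le> i" "i < j" "j \<le> n" for i j
    using x that by (auto simp: orthant_def PiE_iff t_def s_def)
  define y where "y = ratio_map n x"
  define z where "z = p_map n y"
  define m where "m i j = y (SVar i j)" for i j
  have y: "y (TVar i j) = t i j" "m i j = s i j / t i j" if "1 \<le> i" "i < j" "j \<le> n" for i j
    unfolding m_def y_def ratio_map_def using that
    by (auto simp: triangular_map_apply t_def s_def field_simps)
  \<comment> \<open>For \<open>i = j - 1\<close> the restricted function is undefined at
    \<open>(i, j - 1)\<close>; the conditional in \<open>p_fac_aux\<close> avoids exactly this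
    value.\<close>
  have loc: "p_fac_aux n (\<lambda>k l. restrict y {w \<in> coords n. p_rank w < 1} (SVar k l)) i j = p_fac_aux n m i j"
    if "1 \<le> i" "i < j" "j \<le> n" for i j
  proof -
    have r: "restrict y {w \<in> coords n. p_rank w < 1} (SVar k l) = m k l" if "1 \<le> k" "k < l" "l \<le> n" for k l
      using that by (simp add: m_def)
    have "restrict y {w \<in> coords n. p_rank w < 1} (SVar i (j - 1)) = m i (j - 1)" if "i \<noteq> j - 1"
    proof -
      have "i < j - 1" "j - 1 \<le> n" using that \<open>i < j\<close> \<open>j \<le> n\<close> by linarith+
      with \<open>1 \<le> i\<close> show ?thesis by (rule r)
    qed
    then show ?thesis
      unfolding p_fac_aux_def using that r
      by (intro arg_cong2[where f="(*)"] prod.cong if_cong refl arg_cong[where f=inverse]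
          arg_cong2[where f="(powi)"] arg_cong2[where f="(/)"] arg_cong2[where f="(+)"]) auto
  qed
  have z: "z (TVar i j) = P_form n t s i j" "z (SVar i j) = m i j" if "1 \<le> i" "i < j" "j \<le> n" for i j
  proof -
    show "z (TVar i j) = P_form n t s i j"
      unfolding z_def p_map_def using that loc[OF that] y[OF that]
      by (subst triangular_map_apply)
        (simp_all add: P_form_eq_p_fac[of n t s m, OF pos y(2) that] power_int_minus m_def[symmetric])
    show "z (SVar i j) = m i j"
      unfolding z_def p_map_def using that by (subst triangular_map_apply) (auto simp: m_def)
  qed
  show "q_map n (p_map n (ratio_map n x)) (TVar i j) = P_form n t s i j"
    unfolding y_def[symmetric] z_def[symmetric] q_map_def using ij
    by (subst triangular_map_apply) (auto simp: z)
  show "q_map n (p_map n (ratio_map n x)) (SVar i j) = Q_form n t s i j"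
    unfolding y_def[symmetric] z_def[symmetric] q_map_def using ij
    by (subst triangular_map_apply)
       (auto simp: z Q_form_eq[of n t s m, OF pos y(2) ij] intro!: prod.cong)
qed

lemma pq_map_measure:
  assumes p: "\<And>i j. 1 \<le> i \<Longrightarrow> i < j \<Longrightarrow> j \<le> n \<Longrightarrow> p i j = P_form n t_var s_var i j"
    and q: "\<And>i j. 1 \<le> i \<Longrightarrow> i < j \<Longrightarrow> j \<le> n \<Longrightarrow> q i j = Q_form n t_var s_var i j"
  shows "pq_map n p q \<in> measurable (log_measure n) (log_measure n) \<and>
    distr (log_measure n) (log_measure n) (pq_map n p q) = log_measure n"
proof (rule log_preserving_distr)
  let ?\<Phi> = "\<lambda>x. q_map n (p_map n (ratio_map n x))"
  show "log_preserving (coords n) ?\<Phi>"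
    by (rule log_preserving_comp[OF log_preserving_comp[OF ratio_map_preserving p_map_preserving]
          q_map_preserving])
  fix x assume x: "x \<in> orthant n"
  then have pos: "0 < x v" if "v \<in> coords n" for v using that by (auto simp: orthant_def PiE_iff)
  let ?t = "\<lambda>i j. x (TVar i j)" and ?s = "\<lambda>i j. x (SVar i j)"
  have rv: "regular_value x (t_var i j) (?t i j)" "regular_value x (s_var i j) (?s i j)" for i j
    by (simp_all add: t_var_def s_var_def regular_value_indet)
  show "pq_map n p q x = ?\<Phi> x"
  proof
    fix v
    show "pq_map n p q x v = ?\<Phi> x v"
    proof (cases "v \<in> coords n")
      case True
      show ?thesis
      proof (cases v)
        case [simp]: (TVar i j)
        have ij: "1 \<le> i" "i < j" "j \<le> n" using True by auto
        have "ratfun_eval x (p i j) = P_form n ?t ?s i j"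
          unfolding p[OF ij] by (intro ratfun_eval_eqI regular_value_forms rv ij) (auto intro!: pos)
        then show ?thesis using True by (simp add: pq_map_def q_map_formula(1)[OF x ij])
      next
        case [simp]: (SVar i j)
        have ij: "1 \<le> i" "i < j" "j \<le> n" using True by auto
        have "ratfun_eval x (q i j) = Q_form n ?t ?s i j"
          unfolding q[OF ij] by (intro ratfun_eval_eqI regular_value_forms rv ij) (auto intro!: pos)
        then show ?thesis using True by (simp add: pq_map_def q_map_formula(2)[OF x ij])
      qed
    next
      case False
      then show ?thesis by (simp add: pq_map_def q_map_def triangular_map_def)
    qed
  qed
  have "0 < ?\<Phi> x v" if "v \<in> coords n" for v
    using that q_map_formula[OF x] forms_pos[of n ?t ?s] pos by (cases v) auto
  then show "?\<Phi> x \<in> orthant n"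
    by (auto simp: orthant_def PiE_iff q_map_def triangular_map_def)
qed

lemma params_indet:
  assumes "1 \<le> N"
  shows "params N t_var s_var"
proof
  have r: "regular_value (\<lambda>_. 1) (t_var i j) 1" "regular_value (\<lambda>_. 1) (s_var i j) 1" for i j
    using regular_value_indet[of "\<lambda>_. 1"] by (simp_all add: t_var_def s_var_def)
  show "s_var i j \<noteq> 0" "t_var i j \<noteq> 0" "t_var i j + s_var i j \<noteq> 0" for i j
    using regular_value_nonzero[OF r(1)] regular_value_nonzero[OF r(2)]
      regular_value_nonzero[OF regular_value_add[OF r]] by auto
qed (fact assms)

theorem theorem4p1:
  fixes n :: nat and t s :: "nat \<Rightarrow> nat \<Rightarrow> ratfun"
  assumes n: "n \<ge> 2"
    and t: "t = t_var"
    and s: "s = s_var"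
  shows "(\<exists>Y T p q. factorization n t s Y T p q) \<and>
    (\<forall>Y T p q. factorization n t s Y T p q \<longrightarrow>
      ((\<forall>i j. 1 \<le> i \<and> i < j \<and> j < n \<longrightarrow>
          p i j = r_par n t s i j * (\<Prod>k\<in>{1..<i}. t k (j-1) / s k (j-1)) * (\<Prod>k\<in>{1..<i}. s k j / t k j) \<and>
          q i j = r_par n t s i j * (\<Prod>k\<in>{1..<i}. t k (j-1) / s k (j-1)) * (\<Prod>k\<in>{1..i}. s k j / t k j)) \<and>
       (\<forall>i. 1 \<le> i \<and> i < n \<longrightarrow>
          p i n = r_par n t s i n * (\<Prod>k\<in>{1..<i}. t k (n-1) / s k (n-1))
                    * (\<Prod>k\<in>{1..<i}. (t k n / s k n) powi eps (n-i)) \<and>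
          q i n = r_par n t s i n * (\<Prod>k\<in>{1..<i}. t k (n-1) / s k (n-1))
                    * (\<Prod>k\<in>{1..i}. (s k n / t k n) powi eps (n-i)))) \<and>
      T = torus_mat n (T_par n t s) \<and>
      (pq_map n p q \<in> measurable (log_measure n) (log_measure n) \<and>
       distr (log_measure n) (log_measure n) (pq_map n p q) = log_measure n))"
proof -
  define N where "N = n - 1"
  have nN: "n = Suc N" "1 \<le> N" using n by (auto simp: N_def)
  interpret params N t_var s_var by (rule params_indet[OF nN(2)])
  show ?thesis
    unfolding t s
  proof (intro conjI allI impI)
    show "\<exists>Y T p q. factorization n t_var s_var Y T p q"
      using existence unfolding nN by blast
  next
    fix Y T p q assume f: "factorization n t_var s_var Y T p q"
    note f' = f[unfolded nN(1)]
    have pq: "p i j = P_form n t_var s_var i j" "q i j = Q_form n t_var s_var i j"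
      if "1 \<le> i" "i < j" "j \<le> n" for i j
      using uniqueness(2)[OF f' that[unfolded nN(1)]] pq_eq_forms[OF that[unfolded nN(1)]] by (auto simp: nN)
    show "T = torus_mat n (T_par n t_var s_var)"
      unfolding uniqueness(1)[OF f'] torus_formula nN(1) ..
    show "pq_map n p q \<in> measurable (log_measure n) (log_measure n)"
      "distr (log_measure n) (log_measure n) (pq_map n p q) = log_measure n"
      using pq_map_measure[of n p q] pq by auto
    fix i assume i: "1 \<le> i \<and> i < n"
    then show "p i n = r_par n t_var s_var i n * (\<Prod>k\<in>{1..<i}. t_var k (n-1) / s_var k (n-1))
        * (\<Prod>k\<in>{1..<i}. (t_var k n / s_var k n) powi eps (n-i))"
      "q i n = r_par n t_var s_var i n * (\<Prod>k\<in>{1..<i}. t_var k (n-1) / s_var k (n-1))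
        * (\<Prod>k\<in>{1..i}. (s_var k n / t_var k n) powi eps (n-i))"
      using pq[of i n] by (simp_all add: P_form_def Q_form_def)
  next
    fix Y T p q i j assume f: "factorization n t_var s_var Y T p q" and ij: "1 \<le> i \<and> i < j \<and> j < n"
    note f' = f[unfolded nN(1)]
    have "p i j = P_form n t_var s_var i j" "q i j = Q_form n t_var s_var i j"
      using uniqueness(2)[OF f', of i j] pq_eq_forms[of i j] ij nN by auto
    then show "p i j = r_par n t_var s_var i j * (\<Prod>k\<in>{1..<i}. t_var k (j-1) / s_var k (j-1)) * (\<Prod>k\<in>{1..<i}. s_var k j / t_var k j)"
      "q i j = r_par n t_var s_var i j * (\<Prod>k\<in>{1..<i}. t_var k (j-1) / s_var k (j-1)) * (\<Prod>k\<in>{1..i}. s_var k j / t_var k j)"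
      using ij by (simp_all add: P_form_def Q_form_def)
  qed
qed

end
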